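(* Let $p\ge 1$ and let $(X_t)$ be a stationary ergodic ARCH($p$) process with true parameter $\theta_0=(\omega_0,\alpha_{01},\ldots,\alpha_{0p})^T$ and innovations $(\varepsilon_t)$, as described in the context. Suppose that: (i) $\theta_0$ belongs to the interior of the compact parameter space $\Theta\subset(0,\infty)\times[0,\infty)^p$; (ii) the top Lyapunov exponent of the sequence $\mathcal{A}_0=\{\mathcal{A}_{0t}\}$ satisfies $\gamma(\mathcal{A}_0)<0$; (iii) $\varepsilon_t^2$ has a non-degenerate distribution with $E\varepsilon_t^2=1$; (iv) $E\varepsilon_t^4<\infty$; (v) the matrix $\Gamma(\theta_0)=E\bigl(Y_{t-1}Y_{t-1}^T/\sigma_t^4(\theta_0)\bigr)$ is finite; and that the initial least squares estimator satisfies $\sqrt{n}(\hat\theta_n^{(LS)}-\theta_0)=O_p(1)$. Then the estimating function estimator $$\hat\theta_n^{(EF)}=\left(\sum_{t=1}^n\frac{Y_{t-1}Y_{t-1}^T}{\sigma_t^4(\hat\theta_n^{(LS)})}\right)^{-1}\left(\sum_{t=1}^n\frac{Y_{t-1}X_t^2}{\sigma_t^4(\hat\theta_n^{(LS)})}\right)$$ satisfies, as $n\to\infty$, $$\sqrt{n}\,(\hat\theta_n^{(EF)}-\theta_0)\stackrel{d}{\longrightarrow}\mathcal{N}\bigl(0,\ \mathrm{Var}(\varepsilon_t^2)\,\Gamma^{-1}(\theta_0)\bigr).$$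
   Context: Model. The ARCH($p$) process is given by $X_t=\sigma_t(\theta_0)\varepsilon_t$, $\sigma_t^2(\theta_0)=\omega_0+\sum_{j=1}^p\alpha_{0j}X_{t-j}^2$, where $\{\varepsilon_t\}$ is a sequence of i.i.d. real random variables with $E\varepsilon_t=0$, $E\varepsilon_t^2=1$, and $\varepsilon_t$ is independent of $X_s$, $s<t$. The parameter satisfies $\omega_0>0$, $\alpha_{0j}\ge0$ for $j=1,\ldots,p-1$, and $\alpha_{0p}>0$. The process is assumed stationary and ergodic. The true parameter lies in a compact parameter space $\Theta\subset(0,\infty)\times[0,\infty)^p$. Notation. $Y_t=(1,X_t^2,\ldots,X_{t-p+1}^2)^T\in\mathbb{R}^{p+1}$. For $\theta=(\omega,\alpha_1,\ldots,\alpha_p)^T$, $\sigma_t^2(\theta)=\theta^TY_{t-1}$ and $\sigma_t^4(\theta)=(\theta^TY_{t-1})^2$. The observations are $X_1^2,\ldots,X_n^2$ (together with the $p$ preceding values, so that $Y_0,\ldots,Y_{n-1}$ are available). Least squares estimator. $\hat\theta_n^{(LS)}=(Y^TY)^{-1}Y^TX$, where $Y$ is the $n\times(p+1)$ matrix with $t$-th row $Y_{t-1}^T$ and $X=(X_1^2,\ldots,X_n^2)^T$; equivalently, the minimizer of $Q_n(\theta)=\sum_{t=1}^n(X_t^2-\theta^TY_{t-1})^2$. Estimators involving matrix inverses are considered on the event where the inverse exists. Lyapunov exponent. $\mathcal{A}_{0t}$ is the $p\times p$ random matrix whose first row is $(\alpha_{01}\varepsilon_t^2,\ldots,\alpha_{0p}\varepsilon_t^2)$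 and whose $i$-th row, $2\le i\le p$, is the $(i-1)$-th standard unit row vector (ones on the subdiagonal, zeros elsewhere). Its top Lyapunov exponent is $\gamma(\mathcal{A}_0)=\inf_{t\ge1}\frac1t E(\log\|\mathcal{A}_{01}\mathcal{A}_{02}\cdots\mathcal{A}_{0t}\|)=\lim_{t\to\infty}\frac1t\log\|\mathcal{A}_{01}\cdots\mathcal{A}_{0t}\|$ (a.s.), which is defined since $E\|\mathcal{A}_{01}\|<\infty$; $\|\cdot\|$ is the spectral matrix norm. *)

theory Defs
  imports "HOL-Probability.Probability"
begin

section \<open>Index types\<close>

text \<open>
  The order \<open>p \<ge> 1\<close> of the model is \<open>CARD('p)\<close> for a finite linearly ordered type \<open>'p\<close>, whose
  elements, listed increasingly, stand for the lags \<open>1, \<dots>, p\<close>. Vectors in \<open>\<real>\<^sup>p\<^sup>+\<^sup>1\<close> are indexed by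
  \<open>'p option\<close>: the component \<open>None\<close> is the one belonging to the intercept \<open>\<omega>\<close>, the component
  \<open>Some j\<close> the one belonging to \<open>\<alpha>\<close> at lag \<open>lag j\<close>.
\<close>

definition lag :: "'p::{finite, linorder} \<Rightarrow> nat" where
  "lag j = card {..j}"

lemma bij_betw_lag: "bij_betw lag (UNIV :: 'p::{finite, linorder} set) {1..CARD('p)}"
proof -
  have less: "lag i < lag j" if "i < j" for i j :: 'p
    unfolding lag_def using that by (intro psubset_card_mono) auto
  have inj: "inj (lag :: 'p \<Rightarrow> nat)"
    by (rule injI) (metis less less_irrefl linorder_less_linear)
  have "lag j \<in> {1..CARD('p)}" for j :: 'p
    by (auto simp: lag_def Suc_le_eq card_gt_0_iff intro!: card_mono)
  then have "range (lag :: 'p \<Rightarrow> nat) = {1..CARD('p)}"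
    by (intro card_subset_eq) (auto simp: card_image[OF inj])
  with inj show ?thesis
    by (simp add: bij_betw_def)
qed

section \<open>General probabilistic notions\<close>

definition stationary_process :: "'a measure \<Rightarrow> (int \<Rightarrow> 'a \<Rightarrow> real) \<Rightarrow> bool" where
  "stationary_process M X \<longleftrightarrow>
     (\<forall>h. distr M (Pi\<^sub>M UNIV (\<lambda>_. borel)) (\<lambda>w t. X (t + h) w)
        = distr M (Pi\<^sub>M UNIV (\<lambda>_. borel)) (\<lambda>w t. X t w))"

definition ergodic_process :: "'a measure \<Rightarrow> (int \<Rightarrow> 'a \<Rightarrow> real) \<Rightarrow> bool" where
  "ergodic_process M X \<longleftrightarrow>
     (\<forall>A \<in> sets (Pi\<^sub>M UNIV (\<lambda>_. borel)).
        (\<forall>x. (\<lambda>t. x (t + 1)) \<in> A \<longleftrightarrow> x \<in> A) \<longrightarrow>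
        measure M {w \<in> space M. (\<lambda>t. X t w) \<in> A} \<in> {0, 1})"

text \<open>\<open>Z\<^sub>n = O\<^sub>p(1)\<close>\<close>
definition bounded_in_probability ::
    "'a measure \<Rightarrow> (nat \<Rightarrow> 'a \<Rightarrow> 'b::real_normed_vector) \<Rightarrow> bool" where
  "bounded_in_probability M Z \<longleftrightarrow>
     (\<forall>e>0. \<exists>K. \<forall>\<^sub>F n in sequentially. measure M {w \<in> space M. norm (Z n w) > K} < e)"

definition converges_in_distribution ::
    "'a measure \<Rightarrow> (nat \<Rightarrow> 'a \<Rightarrow> 'b::euclidean_space) \<Rightarrow> 'b measure \<Rightarrow> bool" where
  "converges_in_distribution M Z N \<longleftrightarrow>
     (\<forall>n. Z n \<in> borel_measurable M) \<and>
     (\<forall>f :: 'b \<Rightarrow> real. continuous_on UNIV f \<longrightarrow> bounded (range f) \<longrightarrow>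
        (\<lambda>n. \<integral>w. f (Z n w) \<partial>M) \<longlonglongrightarrow> (\<integral>x. f x \<partial>N))"

text \<open>The normal distribution with mean \<open>\<mu>\<close> and symmetric positive definite covariance \<open>S\<close>.\<close>
definition multivariate_normal :: "real^'n \<Rightarrow> real^'n^'n \<Rightarrow> (real^'n) measure" where
  "multivariate_normal \<mu> S = density lborel (\<lambda>x. ennreal
     (exp (- ((x - \<mu>) \<bullet> (matrix_inv S *v (x - \<mu>))) / 2) / sqrt ((2 * pi) ^ CARD('n) * det S)))"

text \<open>
  Expectation of an extended real random variable whose positive part has finite expectation; the
  value \<open>-\<infinity>\<close> is possible.
\<close>
definition ereal_expectation :: "'a measure \<Rightarrow> ('a \<Rightarrow> ereal) \<Rightarrow> ereal" where
  "ereal_expectation M f =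
     enn2ereal (\<integral>\<^sup>+ w. e2ennreal (f w) \<partial>M) - enn2ereal (\<integral>\<^sup>+ w. e2ennreal (- f w) \<partial>M)"

text \<open>Here the logarithm of \<open>0\<close> is \<open>-\<infinity>\<close>, in contrast to \<open>ln 0 = 0\<close>.\<close>
definition ereal_log :: "real \<Rightarrow> ereal" where
  "ereal_log x = (if x \<le> 0 then -\<infinity> else ereal (ln x))"

definition spectral_norm :: "real^'n^'m \<Rightarrow> real" where
  "spectral_norm A = onorm (\<lambda>v. A *v v)"

fun matrix_seq_prod :: "(int \<Rightarrow> real^'n^'n) \<Rightarrow> nat \<Rightarrow> real^'n^'n" where
  "matrix_seq_prod A 0 = mat 1"
| "matrix_seq_prod A (Suc t) = matrix_seq_prod A t ** A (int (Suc t))"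

text \<open>
  The infimum is taken over \<open>t \<ge> 1\<close> in the extended reals, and is \<open>-\<infinity>\<close> as soon as one of the
  products vanishes with positive probability.
\<close>
definition top_lyapunov_exponent :: "'a measure \<Rightarrow> (int \<Rightarrow> 'a \<Rightarrow> real^'n^'n) \<Rightarrow> ereal" where
  "top_lyapunov_exponent M A =
     (INF t\<in>{1..}. ereal (1 / real t) *
        ereal_expectation M (\<lambda>w. ereal_log (spectral_norm (matrix_seq_prod (\<lambda>s. A s w) t))))"

definition outer_product :: "real^'n \<Rightarrow> real^'m \<Rightarrow> real^'m^'n" where
  "outer_product x y = (\<chi> i j. x $ i * y $ j)"

section \<open>The model\<close>

text \<open>\<open>Y\<^sub>t = (1, X\<^sub>t\<^sup>2, \<dots>, X\<^sub>t\<^sub>-\<^sub>p\<^sub>+\<^sub>1\<^sup>2)\<close>\<close>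
definition regressor :: "(int \<Rightarrow> 'a \<Rightarrow> real) \<Rightarrow> int \<Rightarrow> 'a \<Rightarrow> real^('p::{finite, linorder} option)" where
  "regressor X t w =
     (\<chi> i. case i of None \<Rightarrow> 1 | Some j \<Rightarrow> (X (t - int (lag j) + 1) w)\<^sup>2)"

text \<open>\<open>\<sigma>\<^sub>t\<^sup>2(\<theta>) = \<theta>\<^sup>T Y\<^sub>t\<^sub>-\<^sub>1 = \<omega> + \<alpha>\<^sub>1 X\<^sub>t\<^sub>-\<^sub>1\<^sup>2 + \<dots> + \<alpha>\<^sub>p X\<^sub>t\<^sub>-\<^sub>p\<^sup>2\<close>\<close>
definition sigma2 ::
    "(int \<Rightarrow> 'a \<Rightarrow> real) \<Rightarrow> real^('p::{finite, linorder} option) \<Rightarrow> int \<Rightarrow> 'a \<Rightarrow> real" where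
  "sigma2 X \<theta> t w = \<theta> \<bullet> regressor X (t - 1) w"

locale arch_process = prob_space M
  for M :: "'a measure" and X \<epsilon> :: "int \<Rightarrow> 'a \<Rightarrow> real"
    and \<theta>\<^sub>0 :: "real^('p::{finite, linorder} option)" +
  assumes X_measurable: "\<And>t. random_variable borel (X t)"
    and innov_indep: "indep_vars (\<lambda>_. borel) \<epsilon> UNIV"
    and innov_distr: "\<And>s t. distr M borel (\<epsilon> s) = distr M borel (\<epsilon> t)"
    and innov_mean: "\<And>t. integrable M (\<epsilon> t)" "\<And>t. expectation (\<epsilon> t) = 0"
    and innov_square: "\<And>t. integrable M (\<lambda>w. (\<epsilon> t w)\<^sup>2)" "\<And>t. expectation (\<lambda>w. (\<epsilon> t w)\<^sup>2) = 1"
    and innov_indep_past: "\<And>t. indep_set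
          (sets (vimage_algebra (space M) (\<epsilon> t) borel))
          (sets (vimage_algebra (space M) (\<lambda>w. \<lambda>s\<in>{..<t}. X s w) (Pi\<^sub>M {..<t} (\<lambda>_. borel))))"
    and omega_pos: "\<theta>\<^sub>0 $ None > 0"
    and alpha_nonneg: "\<And>j. \<theta>\<^sub>0 $ Some j \<ge> 0"
    and alpha_last_pos: "\<And>j. lag j = CARD('p) \<Longrightarrow> \<theta>\<^sub>0 $ Some j > 0"
    and model: "\<And>t. AE w in M. X t w = sqrt (sigma2 X \<theta>\<^sub>0 t w) * \<epsilon> t w"
    and stationary: "stationary_process M X"
    and ergodic: "ergodic_process M X"

definition arch_parameters :: "(real^('p::finite option)) set" where
  "arch_parameters = {\<theta>. \<theta> $ None > 0 \<and> (\<forall>j. \<theta> $ Some j \<ge> 0)}"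

text \<open>The companion matrix \<open>\<A>\<^sub>0\<^sub>t\<close> as a function of \<open>\<theta>\<^sub>0\<close> and of the value of the innovation.\<close>
definition arch_matrix ::
    "real^('p::{finite, linorder} option) \<Rightarrow> real \<Rightarrow> real^('p::{finite, linorder})^('p::{finite, linorder})" where
  "arch_matrix \<theta> e =
     (\<chi> i j. if lag i = 1 then \<theta> $ Some j * e\<^sup>2 else if lag i = lag j + 1 then 1 else 0)"

text \<open>
  The integrand in \<open>\<Gamma>(\<theta>) = E(Y\<^sub>t\<^sub>-\<^sub>1 Y\<^sub>t\<^sub>-\<^sub>1\<^sup>T / \<sigma>\<^sub>t\<^sup>4(\<theta>))\<close>. Under stationarity the expectation does not
  depend on \<open>t\<close>; \<open>arch_Gamma\<close> uses \<open>t = 1\<close>.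
\<close>
definition weighted_outer ::
    "(int \<Rightarrow> 'a \<Rightarrow> real) \<Rightarrow> real^('p::{finite, linorder} option) \<Rightarrow> int \<Rightarrow> 'a \<Rightarrow>
       real^('p option)^('p option)" where
  "weighted_outer X \<theta> t w =
     (1 / (sigma2 X \<theta> t w)\<^sup>2) *\<^sub>R outer_product (regressor X (t - 1) w) (regressor X (t - 1) w)"

definition arch_Gamma ::
    "'a measure \<Rightarrow> (int \<Rightarrow> 'a \<Rightarrow> real) \<Rightarrow> real^('p::{finite, linorder} option) \<Rightarrow>
       real^('p option)^('p option)" where
  "arch_Gamma M X \<theta> = (\<integral>w. weighted_outer X \<theta> 1 w \<partial>M)"

section \<open>The estimators\<close>

text \<open>
  \<open>Y\<^sup>T Y\<close> for the design matrix with rows \<open>Y\<^sub>0\<^sup>T, \<dots>, Y\<^sub>n\<^sub>-\<^sub>1\<^sup>T\<close>, and \<open>Y\<^sup>T (X\<^sub>1\<^sup>2, \<dots>, X\<^sub>n\<^sup>2)\<^sup>T\<close>, written out as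
  sums over the rows.
\<close>
definition ls_matrix ::
    "(int \<Rightarrow> 'a \<Rightarrow> real) \<Rightarrow> nat \<Rightarrow> 'a \<Rightarrow> real^('p::{finite, linorder} option)^('p option)" where
  "ls_matrix X n w =
     (\<Sum>t = 1..int n. outer_product (regressor X (t - 1) w) (regressor X (t - 1) w))"

definition ls_vector ::
    "(int \<Rightarrow> 'a \<Rightarrow> real) \<Rightarrow> nat \<Rightarrow> 'a \<Rightarrow> real^('p::{finite, linorder} option)" where
  "ls_vector X n w = (\<Sum>t = 1..int n. (X t w)\<^sup>2 *\<^sub>R regressor X (t - 1) w)"

text \<open>
  At a singular matrix \<open>matrix_inv\<close> takes an unspecified fixed value; \<open>ef_well_defined\<close> below is
  the event on which all inverses and quotients involved exist.
\<close>
definition ls_estimator ::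
    "(int \<Rightarrow> 'a \<Rightarrow> real) \<Rightarrow> nat \<Rightarrow> 'a \<Rightarrow> real^('p::{finite, linorder} option)" where
  "ls_estimator X n w = matrix_inv (ls_matrix X n w) *v ls_vector X n w"

definition ef_matrix ::
    "(int \<Rightarrow> 'a \<Rightarrow> real) \<Rightarrow> nat \<Rightarrow> 'a \<Rightarrow> real^('p::{finite, linorder} option)^('p option)" where
  "ef_matrix X n w = (\<Sum>t = 1..int n. weighted_outer X (ls_estimator X n w) t w)"

definition ef_vector ::
    "(int \<Rightarrow> 'a \<Rightarrow> real) \<Rightarrow> nat \<Rightarrow> 'a \<Rightarrow> real^('p::{finite, linorder} option)" where
  "ef_vector X n w =
     (\<Sum>t = 1..int n. ((X t w)\<^sup>2 / (sigma2 X (ls_estimator X n w :: real^('p option)) t w)\<^sup>2)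
        *\<^sub>R regressor X (t - 1) w)"

definition ef_estimator ::
    "(int \<Rightarrow> 'a \<Rightarrow> real) \<Rightarrow> nat \<Rightarrow> 'a \<Rightarrow> real^('p::{finite, linorder} option)" where
  "ef_estimator X n w = matrix_inv (ef_matrix X n w) *v ef_vector X n w"

text \<open>The order of the model cannot be read off from \<open>X\<close>, whence the type argument.\<close>
definition ef_well_defined ::
    "'p::{finite, linorder} itself \<Rightarrow> (int \<Rightarrow> 'a \<Rightarrow> real) \<Rightarrow> nat \<Rightarrow> 'a \<Rightarrow> bool" where
  "ef_well_defined _ X n w \<longleftrightarrow>
     invertible (ls_matrix X n w :: real^('p option)^('p option)) \<and>
     (\<forall>t\<in>{1..int n}. sigma2 X (ls_estimator X n w :: real^('p option)) t w \<noteq> 0) \<and>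
     invertible (ef_matrix X n w :: real^('p option)^('p option))"

end

theory Submission
  imports Defs
begin

text \<open>
  Let \<open>s\<^sub>t = \<sigma>\<^sub>t\<^sup>2(\<theta>\<^sub>0) = \<theta>\<^sub>0 \<bullet> Y\<^sub>t\<^sub>-\<^sub>1\<close>. An interior \<open>\<theta>\<^sub>0\<close> has only positive components, so the regressor
  \<open>Y\<^sub>t\<^sub>-\<^sub>1\<close>, whose components are nonnegative, is at most a constant multiple of \<open>s\<^sub>t\<close>. The standardized
  regressor \<open>r\<^sub>t = Y\<^sub>t\<^sub>-\<^sub>1 / s\<^sub>t\<close> is therefore bounded, it depends on the past only, and
  \<open>\<theta>\<^sub>0 \<bullet> r\<^sub>t = 1\<close>. With \<open>\<eta>\<^sub>t = X\<^sub>t\<^sup>2 / s\<^sub>t - 1\<close>, which is \<open>\<epsilon>\<^sub>t\<^sup>2 - 1\<close> almost surely, the estimating equation is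
  that of a linear regression of \<open>1 + \<eta>\<^sub>t\<close> on \<open>r\<^sub>t\<close>, with bounded predictable design, i.i.d. noise and the
  weights \<open>1 / (1 + (\<theta> - \<theta>\<^sub>0) \<bullet> r\<^sub>t)\<^sup>2\<close>, where \<open>\<theta>\<close> is the least squares estimate.

  If \<open>u = \<surd>n (\<theta> - \<theta>\<^sub>0)\<close> stays bounded, the weights are \<open>1 - 2 u \<bullet> r\<^sub>t / \<surd>n + O(1/n)\<close> uniformly in \<open>t\<close>.
  Compared with weights \<open>1\<close> they change the normalized matrix \<open>(1/n) \<Sum> r\<^sub>t r\<^sub>t\<^sup>T\<close> by \<open>O(1/\<surd>n)\<close>, and the score
  \<open>(1/\<surd>n) \<Sum> \<eta>\<^sub>t r\<^sub>t\<close> by \<open>- 2 N\<^sub>n u + O(1/\<surd>n)\<close> with \<open>N\<^sub>n = (1/n) \<Sum> \<eta>\<^sub>t r\<^sub>t r\<^sub>t\<^sup>T\<close>, an average of martingale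
  differences which tends to zero. This is the deterministic estimate \<open>weighted_estimator_close\<close>; together
  with the limit laws below it shows that \<open>\<surd>n (\<theta>\<^sup>E\<^sup>F - \<theta>\<^sub>0)\<close> and \<open>\<Gamma>\<^sup>-\<^sup>1\<close> times the score differ by a
  quantity that tends to zero in probability (\<open>linearization_in_probability\<close>).

  The limit laws are Birkhoff's theorem (\<open>birkhoff_ergodic\<close>), by which \<open>(1/n) \<Sum> r\<^sub>t r\<^sub>t\<^sup>T\<close> tends to \<open>\<Gamma>\<close>; the
  orthogonality of the increments \<open>\<eta>\<^sub>t r\<^sub>t\<close>, which bounds the second moments of the score and of \<open>N\<^sub>n\<close>
  (\<open>second_moment_partial_sum_vec\<close>); and a central limit theorem for sums of bounded predictable
  weights times i.i.d. noise, proved by telescoping the characteristic function (\<open>clt_char\<close>). The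
  passage from characteristic functions to bounded continuous test functions approximates the latter by
  trigonometric polynomials (\<open>levy_cramer_continuity\<close>).

  Finally \<open>\<Gamma>\<close> is positive definite: if \<open>a \<bullet> \<Gamma> a = 0\<close> then \<open>a \<bullet> Y\<^sub>0 = 0\<close> almost surely, and if \<open>a \<noteq> 0\<close> this
  would express the square of the most recent innovation that occurs in it through the past, so that this
  square, being independent of the past, would be constant.
\<close>

section \<open>Birkhoff's ergodic theorem\<close>

definition birkhoff_sum :: "('a \<Rightarrow> 'a) \<Rightarrow> ('a \<Rightarrow> 'b::comm_monoid_add) \<Rightarrow> nat \<Rightarrow> 'a \<Rightarrow> 'b" where
  "birkhoff_sum T g n x = (\<Sum>k<n. g ((T ^^ k) x))"

lemma birkhoff_sum_Suc: "birkhoff_sum T g (Suc n) x = g x + birkhoff_sum T g n (T x)"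
  unfolding birkhoff_sum_def
  by (subst sum.lessThan_Suc_shift) (simp add: funpow_swap1)

text \<open>
  The maximum of the Birkhoff sums with at most \<open>n\<close> terms, including the empty one. Unfolding the first
  step of the orbit gives this recursion, which is all that the maximal ergodic theorem uses.
\<close>
primrec max_birkhoff :: "('a \<Rightarrow> 'a) \<Rightarrow> ('a \<Rightarrow> real) \<Rightarrow> nat \<Rightarrow> 'a \<Rightarrow> real" where
  "max_birkhoff T g 0 x = 0"
| "max_birkhoff T g (Suc n) x = max 0 (g x + max_birkhoff T g n (T x))"

lemma max_birkhoff_nonneg: "max_birkhoff T g n x \<ge> 0"
  by (cases n) auto

lemma max_birkhoff_mono: "max_birkhoff T g n x \<le> max_birkhoff T g (Suc n) x"
proof (induction n arbitrary: x)
  case (Suc n)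
  show ?case using Suc[of "T x"] by (auto simp: max_def)
qed auto

lemma birkhoff_sum_le_max: "birkhoff_sum T g n x \<le> max_birkhoff T g n x"
proof (induction n arbitrary: x)
  case (Suc n)
  show ?case using Suc[of "T x"] by (auto simp: birkhoff_sum_Suc max_def)
qed (auto simp: birkhoff_sum_def)

locale ergodic_transformation = prob_space M for M :: "'a measure" and T :: "'a \<Rightarrow> 'a" +
  assumes T_measurable [measurable]: "T \<in> M \<rightarrow>\<^sub>M M"
    and T_preserving: "distr M M T = M"
    and T_ergodic: "\<And>A. A \<in> sets M \<Longrightarrow> (\<And>x. x \<in> space M \<Longrightarrow> T x \<in> A \<longleftrightarrow> x \<in> A) \<Longrightarrow> prob A \<in> {0, 1}"
begin

lemma funpow_T_measurable [measurable]: "T ^^ k \<in> M \<rightarrow>\<^sub>M M"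
  by (induction k) auto

lemma birkhoff_sum_measurable [measurable]:
  fixes g :: "'a \<Rightarrow> real"
  assumes [measurable]: "g \<in> borel_measurable M"
  shows "birkhoff_sum T g n \<in> borel_measurable M"
  unfolding birkhoff_sum_def[abs_def] by measurable

lemma integral_T:
  fixes f :: "'a \<Rightarrow> real"
  assumes "integrable M f"
  shows "integrable M (\<lambda>x. f (T x))" "(\<integral>x. f (T x) \<partial>M) = (\<integral>x. f x \<partial>M)"
proof -
  have [measurable]: "f \<in> borel_measurable M" using assms by auto
  have 1: "integrable (distr M M T) f" using assms by (simp add: T_preserving)
  show "integrable M (\<lambda>x. f (T x))"
    by (rule integrable_distr[OF _ 1]) simp
  have "(\<integral>x. f x \<partial>M) = (\<integral>x. f x \<partial>distr M M T)" by (simp add: T_preserving)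
  also have "\<dots> = (\<integral>x. f (T x) \<partial>M)" by (rule integral_distr) auto
  finally show "(\<integral>x. f (T x) \<partial>M) = (\<integral>x. f x \<partial>M)" by simp
qed

lemma max_birkhoff_integrable:
  assumes "integrable M g"
  shows "integrable M (max_birkhoff T g n)"
proof (induction n)
  case (Suc n)
  then show ?case using assms integral_T(1)[OF Suc] by simp
qed simp

text \<open>
  Let \<open>m\<^sub>n\<close> be the maximum of the Birkhoff sums of length at most \<open>n\<close>. Where \<open>m\<^sub>n\<^sub>+\<^sub>1 > 0\<close>, the recursion
  reads \<open>g = m\<^sub>n\<^sub>+\<^sub>1 - m\<^sub>n \<circ> T\<close>, and elsewhere \<open>m\<^sub>n\<^sub>+\<^sub>1 - m\<^sub>n \<circ> T \<le> 0\<close>. Hence the integral of \<open>g\<close> over the former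
  set is at least that of \<open>m\<^sub>n\<^sub>+\<^sub>1 - m\<^sub>n \<circ> T\<close>, which by invariance is that of \<open>m\<^sub>n\<^sub>+\<^sub>1 - m\<^sub>n \<ge> 0\<close>. The sets exhaust
  the space as \<open>n\<close> grows.
\<close>
lemma maximal_ergodic:
  fixes g :: "'a \<Rightarrow> real"
  assumes g: "integrable M g" and pos: "AE x in M. \<exists>n. birkhoff_sum T g n x > 0"
  shows "(\<integral>x. g x \<partial>M) \<ge> 0"
proof -
  let ?m = "max_birkhoff T g"
  note int = max_birkhoff_integrable[OF g]
  have [measurable]: "g \<in> borel_measurable M" "?m n \<in> borel_measurable M" for n
    using g int by auto
  define h where "h n x = (if ?m (Suc n) x > 0 then g x else 0)" for n x
  have hm [measurable]: "h n \<in> borel_measurable M" for n unfolding h_def[abs_def] by measurable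
  have "0 \<le> (\<integral>x. h n x \<partial>M)" for n
  proof -
    have "(\<integral>x. ?m (Suc n) x - ?m n (T x) \<partial>M) = (\<integral>x. ?m (Suc n) x \<partial>M) - (\<integral>x. ?m n x \<partial>M)"
      using int[of "Suc n"] integral_T[OF int[of n]] by (simp del: max_birkhoff.simps)
    moreover have "(\<integral>x. ?m n x \<partial>M) \<le> (\<integral>x. ?m (Suc n) x \<partial>M)"
      by (intro integral_mono int max_birkhoff_mono)
    moreover have "(\<integral>x. ?m (Suc n) x - ?m n (T x) \<partial>M) \<le> (\<integral>x. h n x \<partial>M)"
    proof (rule integral_mono)
      show "integrable M (\<lambda>x. ?m (Suc n) x - ?m n (T x))"
        using int[of "Suc n"] integral_T[OF int[of n]] by (simp del: max_birkhoff.simps)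
      show "integrable M (h n)"
        by (rule Bochner_Integration.integrable_bound[OF g]) (auto simp: h_def)
      show "?m (Suc n) x - ?m n (T x) \<le> h n x" for x
        using max_birkhoff_nonneg[of T g n "T x"] by (auto simp: h_def max_def)
    qed
    ultimately show ?thesis by linarith
  qed
  moreover have "(\<lambda>n. \<integral>x. h n x \<partial>M) \<longlonglongrightarrow> (\<integral>x. g x \<partial>M)"
  proof (rule integral_dominated_convergence[where w = "\<lambda>x. \<bar>g x\<bar>"])
    show "AE x in M. (\<lambda>n. h n x) \<longlonglongrightarrow> g x"
      using pos
    proof eventually_elim
      case (elim x)
      then obtain n where "birkhoff_sum T g n x > 0" by auto
      then have n: "?m n x > 0" using birkhoff_sum_le_max[of T g n x] by linarith
      have mono: "incseq (\<lambda>n. ?m n x)" by (rule incseq_SucI) (rule max_birkhoff_mono)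
      have "h k x = g x" if "k \<ge> n" for k
        using n incseqD[OF mono, of n "Suc k"] that by (simp add: h_def del: max_birkhoff.simps)
      then show ?case
        by (intro tendsto_eventually eventually_sequentiallyI)
    qed
  qed (use g in \<open>auto simp: h_def\<close>)
  ultimately show ?thesis by (intro LIMSEQ_le_const) auto
qed

text \<open>
  Since \<open>S\<^sub>n\<^sub>+\<^sub>1 = g + S\<^sub>n \<circ> T\<close>, the set on which the Birkhoff sums are unbounded above is strictly invariant. If
  its probability were one, the maximal ergodic theorem would make the integral of \<open>g\<close> nonnegative.
\<close>
lemma birkhoff_sum_bounded_above:
  fixes g :: "'a \<Rightarrow> real"
  assumes g: "integrable M g" and neg: "(\<integral>x. g x \<partial>M) < 0"
  shows "AE x in M. \<exists>K. \<forall>n. birkhoff_sum T g n x \<le> K"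
proof -
  have [measurable]: "g \<in> borel_measurable M" using g by auto
  define B where "B = {x\<in>space M. \<forall>K::nat. \<exists>n. birkhoff_sum T g n x > real K}"
  have B[measurable]: "B \<in> sets M" unfolding B_def by measurable
  have "T x \<in> B \<longleftrightarrow> x \<in> B" if x: "x \<in> space M" for x
  proof -
    have Tx: "T x \<in> space M" using x measurable_space[OF T_measurable] by auto
    have "\<exists>n. birkhoff_sum T g n x > real K" if "\<forall>K::nat. \<exists>n. birkhoff_sum T g n (T x) > real K" for K
    proof -
      obtain L :: nat where L: "real L \<ge> real K - g x" by (meson real_arch_simple)
      obtain n where "birkhoff_sum T g n (T x) > real L" using \<open>\<forall>K::nat. _ K\<close> by blast
      then show ?thesis using L by (intro exI[of _ "Suc n"]) (auto simp: birkhoff_sum_Suc)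
    qed
    moreover have "\<exists>n. birkhoff_sum T g n (T x) > real K" if *: "\<forall>K::nat. \<exists>n. birkhoff_sum T g n x > real K" for K
    proof -
      obtain L :: nat where L: "real L \<ge> real K + g x" by (meson real_arch_simple)
      obtain n where n: "birkhoff_sum T g n x > real L" using * by blast
      then have "n \<noteq> 0" by (auto simp: birkhoff_sum_def intro!: Nat.gr0I)
      then obtain m where "n = Suc m" by (cases n) auto
      then show ?thesis using L n by (intro exI[of _ m]) (auto simp: birkhoff_sum_Suc)
    qed
    ultimately show ?thesis using x Tx by (auto simp: B_def)
  qed
  then have "prob B \<in> {0, 1}" by (intro T_ergodic B) auto
  moreover have "prob B \<noteq> 1"
  proof
    assume "prob B = 1"
    then have "AE x in M. x \<in> B" by (simp add: prob_eq_1)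
    then have "AE x in M. \<exists>n. birkhoff_sum T g n x > 0"
    proof eventually_elim
      case (elim x)
      then have "\<exists>n. birkhoff_sum T g n x > real 0" unfolding B_def by blast
      then show ?case by simp
    qed
    from maximal_ergodic[OF g this] neg show False by simp
  qed
  ultimately have "prob B = 0" by auto
  then have "AE x in M. x \<notin> B" by (simp add: prob_eq_0)
  with AE_space show ?thesis
  proof eventually_elim
    case (elim x)
    then obtain K :: nat where "\<forall>n. \<not> birkhoff_sum T g n x > real K" unfolding B_def by auto
    then show ?case by (intro exI[of _ "real K"]) (auto simp: not_less)
  qed
qed

text \<open>
  Subtracting a constant slightly larger than the mean makes the integral negative, so that the sums of the
  difference stay bounded above.
\<close>
lemma birkhoff_average_eventually_less:
  fixes f :: "'a \<Rightarrow> real"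
  assumes f: "integrable M f" and e: "e > 0"
  shows "AE x in M. \<forall>\<^sub>F n in sequentially. birkhoff_sum T f n x / real n < (\<integral>x. f x \<partial>M) + e"
proof -
  define c where "c = (\<integral>x. f x \<partial>M) + e / 2"
  have "AE x in M. \<exists>K. \<forall>n. birkhoff_sum T (\<lambda>x. f x - c) n x \<le> K"
    using f e by (intro birkhoff_sum_bounded_above) (auto simp: c_def prob_space)
  then show ?thesis
  proof eventually_elim
    case (elim x)
    then obtain K where K: "\<And>n. birkhoff_sum T (\<lambda>x. f x - c) n x \<le> K" by auto
    have K': "birkhoff_sum T f n x \<le> K + real n * c" for n
      using K[of n] by (simp add: birkhoff_sum_def sum_subtractf)
    have lim: "(\<lambda>n. K / real n) \<longlonglongrightarrow> 0" by (rule lim_const_over_n)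
    have "\<forall>\<^sub>F n in sequentially. K / real n < e / 2"
      using order_tendstoD(2)[OF lim, of "e / 2"] e by simp
    with eventually_gt_at_top[of 0] show ?case
    proof eventually_elim
      case (elim n)
      have "birkhoff_sum T f n x / real n \<le> (K + real n * c) / real n"
        using K' elim by (intro divide_right_mono) auto
      also have "\<dots> = K / real n + c" using elim by (simp add: field_simps)
      finally show ?case using elim unfolding c_def by linarith
    qed
  qed
qed

theorem birkhoff_ergodic_real:
  fixes f :: "'a \<Rightarrow> real"
  assumes f: "integrable M f"
  shows "AE x in M. (\<lambda>n. birkhoff_sum T f n x / real n) \<longlonglongrightarrow> (\<integral>x. f x \<partial>M)"
proof -
  have "AE x in M. \<forall>j. \<forall>\<^sub>F n in sequentially.
      birkhoff_sum T f n x / real n < (\<integral>x. f x \<partial>M) + inverse (real (Suc j))"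
    by (subst AE_all_countable, intro allI birkhoff_average_eventually_less f) auto
  moreover have "AE x in M. \<forall>j. \<forall>\<^sub>F n in sequentially.
      birkhoff_sum T (\<lambda>x. - f x) n x / real n < (\<integral>x. - f x \<partial>M) + inverse (real (Suc j))"
    using f by (subst AE_all_countable, intro allI birkhoff_average_eventually_less) auto
  ultimately show ?thesis
  proof eventually_elim
    case (elim x)
    show ?case
    proof (rule tendstoI)
      fix e :: real assume "e > 0"
      then obtain j where j: "inverse (real (Suc j)) < e" using reals_Archimedean by blast
      from elim(1)[THEN spec, of j] elim(2)[THEN spec, of j]
      show "\<forall>\<^sub>F n in sequentially. dist (birkhoff_sum T f n x / real n) (\<integral>x. f x \<partial>M) < e"
      proof eventually_elim
        case (elim n)
        then show ?case using j
          by (auto simp: dist_real_def birkhoff_sum_def sum_negf abs_less_iff)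
      qed
    qed
  qed
qed

theorem birkhoff_ergodic:
  fixes f :: "'a \<Rightarrow> 'b::euclidean_space"
  assumes f: "integrable M f"
  shows "AE x in M. (\<lambda>n. birkhoff_sum T f n x /\<^sub>R real n) \<longlonglongrightarrow> (\<integral>x. f x \<partial>M)"
proof -
  have "AE x in M. \<forall>b\<in>Basis. (\<lambda>n. birkhoff_sum T (\<lambda>x. f x \<bullet> b) n x / real n) \<longlonglongrightarrow> (\<integral>x. f x \<bullet> b \<partial>M)"
    using f by (intro AE_finite_allI birkhoff_ergodic_real) auto
  then show ?thesis
  proof eventually_elim
    case (elim x)
    have eq: "(\<integral>x. f x \<bullet> b \<partial>M) = (\<integral>x. f x \<partial>M) \<bullet> b" for b
      using f by (intro integral_inner_left) auto
    show ?case
      unfolding tendsto_componentwise_iff[of "\<lambda>n. birkhoff_sum T f n x /\<^sub>R real n"]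
    proof
      fix b :: 'b assume "b \<in> Basis"
      with elim have "(\<lambda>n. birkhoff_sum T (\<lambda>x. f x \<bullet> b) n x / real n) \<longlonglongrightarrow> (\<integral>x. f x \<partial>M) \<bullet> b"
        by (simp add: eq)
      then show "(\<lambda>n. (birkhoff_sum T f n x /\<^sub>R real n) \<bullet> b) \<longlonglongrightarrow> (\<integral>x. f x \<partial>M) \<bullet> b"
        by (simp add: birkhoff_sum_def inner_sum_left divide_inverse_commute)
    qed
  qed
qed

end

section \<open>Predictable weights times independent noise\<close>

lemma (in prob_space) joint_distr_of_indep_set:
  assumes F: "subalgebra M F" and ind: "indep_set (sets F) (sets (vimage_algebra (space M) Z N))"
    and H: "H \<in> F \<rightarrow>\<^sub>M S" and Z [measurable]: "random_variable N Z"
  shows "distr M (S \<Otimes>\<^sub>M N) (\<lambda>w. (H w, Z w)) = distr M S H \<Otimes>\<^sub>M distr M N Z"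
proof (rule pair_measure_eqI[symmetric])
  have HM [measurable]: "random_variable S H"
    by (rule measurable_from_subalg[OF F H])
  interpret H: prob_space "distr M S H" by (rule prob_space_distr) simp
  interpret Z: prob_space "distr M N Z" by (rule prob_space_distr) simp
  show "sigma_finite_measure (distr M S H)" "sigma_finite_measure (distr M N Z)" ..
  show "sets (distr M S H \<Otimes>\<^sub>M distr M N Z) = sets (distr M (S \<Otimes>\<^sub>M N) (\<lambda>w. (H w, Z w)))"
    by (simp cong: sets_pair_measure_cong)
  fix A B assume "A \<in> sets (distr M S H)" "B \<in> sets (distr M N Z)"
  then have [measurable]: "A \<in> sets S" "B \<in> sets N" by auto
  have "H -` A \<inter> space M \<in> sets F"
    using measurable_sets[OF H \<open>A \<in> sets S\<close>] F by (simp add: subalgebra_def)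
  moreover have "Z -` B \<inter> space M \<in> sets (vimage_algebra (space M) Z N)"
    by (auto intro: in_vimage_algebra)
  ultimately have "prob ((H -` A \<inter> space M) \<inter> (Z -` B \<inter> space M)) = prob (H -` A \<inter> space M) * prob (Z -` B \<inter> space M)"
    using ind by (auto simp: indep_sets2_eq)
  moreover have "(\<lambda>w. (H w, Z w)) -` (A \<times> B) \<inter> space M = (H -` A \<inter> space M) \<inter> (Z -` B \<inter> space M)" by auto
  ultimately show "emeasure (distr M S H) A * emeasure (distr M N Z) B
      = emeasure (distr M (S \<Otimes>\<^sub>M N) (\<lambda>w. (H w, Z w))) (A \<times> B)"
    by (simp add: emeasure_distr emeasure_eq_measure ennreal_mult')
qed

lemma (in prob_space) indep_var_of_indep_set:
  assumes F: "subalgebra M F" and ind: "indep_set (sets F) (sets (vimage_algebra (space M) Z N))"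
    and H: "H \<in> F \<rightarrow>\<^sub>M S" and Z: "random_variable N Z"
  shows "indep_var S H N Z"
  unfolding indep_var_distribution_eq
  using joint_distr_of_indep_set[OF assms] measurable_from_subalg[OF F H] Z by simp

text \<open>
  Allows a random variable to be replaced by an almost surely equal one that has better measurability, as
  happens when \<open>\<epsilon>\<^sub>t\<^sup>2\<close> is written through the observed process.
\<close>
lemma (in prob_space) indep_set_vimage_algebra_AE_cong:
  assumes ind: "indep_set A (sets (vimage_algebra (space M) Z N))"
    and Z: "random_variable N Z" and Z': "random_variable N Z'" and eq: "AE w in M. Z w = Z' w"
  shows "indep_set A (sets (vimage_algebra (space M) Z' N))"
proof -
  have sp: "Z \<in> space M \<rightarrow> space N" "Z' \<in> space M \<rightarrow> space N"
    using Z Z' by (auto dest: measurable_space)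
  have "prob (a \<inter> (Z' -` B \<inter> space M)) = prob a * prob (Z' -` B \<inter> space M)"
    if a: "a \<in> A" and B: "B \<in> sets N" for a B
  proof -
    have aM: "a \<in> events" using ind a by (auto simp: indep_sets2_eq)
    have m: "Z -` B \<inter> space M \<in> events" "Z' -` B \<inter> space M \<in> events"
      using Z Z' B by (auto intro: measurable_sets)
    have "prob (a \<inter> (Z' -` B \<inter> space M)) = prob (a \<inter> (Z -` B \<inter> space M))"
      using eq aM m by (intro finite_measure_eq_AE) (auto elim!: eventually_mono)
    moreover have "prob (Z' -` B \<inter> space M) = prob (Z -` B \<inter> space M)"
      using eq m by (intro finite_measure_eq_AE) (auto elim!: eventually_mono)
    moreover have "Z -` B \<inter> space M \<in> sets (vimage_algebra (space M) Z N)"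
      using B by (auto simp: sets_vimage_algebra2[OF sp(1)])
    ultimately show ?thesis
      using ind a by (auto simp: indep_sets2_eq)
  qed
  moreover have "Z' -` B \<inter> space M \<in> events" if "B \<in> sets N" for B
    using Z' that by (auto intro: measurable_sets)
  ultimately show ?thesis
    using ind unfolding indep_sets2_eq
    by (auto simp: sets_vimage_algebra2[OF sp(2)])
qed

text \<open>
  An i.i.d. centred sequence adapted to a filtration and independent of its past. Index shift: \<open>F k\<close> is what is
  known before \<open>\<eta> k\<close> is drawn, so a predictable weight for \<open>\<eta> k\<close> is \<open>F k\<close>-measurable.
\<close>
locale martingale_noise = prob_space M for M :: "'a measure" +
  fixes F :: "nat \<Rightarrow> 'a measure" and \<eta> :: "nat \<Rightarrow> 'a \<Rightarrow> real" and D :: "real measure" and \<kappa> :: real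
  assumes F_subalgebra: "\<And>k. subalgebra M (F k)"
    and F_mono: "\<And>k. sets (F k) \<subseteq> sets (F (Suc k))"
    and noise_adapted: "\<And>k. \<eta> k \<in> borel_measurable (F (Suc k))"
    and noise_indep: "\<And>k. indep_set (sets (F k)) (sets (vimage_algebra (space M) (\<eta> k) borel))"
    and noise_distr: "\<And>k. distr M borel (\<eta> k) = D"
    and noise_square: "integrable D (\<lambda>x. x\<^sup>2)" "(\<integral>x. x\<^sup>2 \<partial>D) = \<kappa>"
    and noise_mean: "(\<integral>x. x \<partial>D) = 0"
begin

lemma F_measurable_mono:
  fixes f :: "'a \<Rightarrow> 'b::topological_space"
  assumes "f \<in> borel_measurable (F j)" "j \<le> k"
  shows "f \<in> borel_measurable (F k)"
proof -
  have "sets (F j) \<subseteq> sets (F k)" using assms(2) F_mono by (rule lift_Suc_mono_le[rotated])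
  moreover have "space (F j) = space (F k)" using F_subalgebra by (simp add: subalgebra_def)
  ultimately show ?thesis
    using assms(1) by (auto simp: measurable_def)
qed

lemma F_measurable:
  fixes f :: "'a \<Rightarrow> 'b::topological_space"
  shows "f \<in> borel_measurable (F k) \<Longrightarrow> f \<in> borel_measurable M"
  by (rule measurable_from_subalg[OF F_subalgebra])

lemma noise_measurable [measurable]: "\<eta> k \<in> borel_measurable M"
  by (rule F_measurable[OF noise_adapted])

sublocale D: prob_space D
  using prob_space_distr[OF noise_measurable, of 0] unfolding noise_distr .

lemma sets_D [simp, measurable_cong]: "sets D = sets borel"
  using sets_distr[of M borel "\<eta> 0"] unfolding noise_distr .

lemma space_D [simp]: "space D = UNIV"
  using space_distr[of M borel "\<eta> 0"] unfolding noise_distr by (simp only: space_borel)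

lemma D_integrable: "integrable D (\<lambda>x. x)"
  by (rule D.square_integrable_imp_integrable[OF measurable_ident_sets[OF sets_D] noise_square(1)])

lemma noise_integral:
  fixes f :: "real \<Rightarrow> real"
  assumes "f \<in> borel_measurable borel"
  shows "integrable M (\<lambda>w. f (\<eta> k w)) \<longleftrightarrow> integrable D f" "(\<integral>w. f (\<eta> k w) \<partial>M) = (\<integral>x. f x \<partial>D)"
  using integrable_distr_eq[of "\<eta> k" M borel f] integral_distr[of "\<eta> k" M borel f] assms
  by (auto simp: noise_distr)

lemma noise_moments:
  "integrable M (\<eta> k)" "expectation (\<eta> k) = 0"
  "integrable M (\<lambda>w. (\<eta> k w)\<^sup>2)" "expectation (\<lambda>w. (\<eta> k w)\<^sup>2) = \<kappa>"
  using noise_integral[of "\<lambda>x. x" k] noise_integral[of "\<lambda>x. x\<^sup>2" k]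
  by (simp_all add: D_integrable noise_mean noise_square)

lemma variance_nonneg: "\<kappa> \<ge> 0"
  using integral_nonneg_AE[where M = D and f = "\<lambda>x. x\<^sup>2"] by (simp add: noise_square(2))

lemma indep_past:
  fixes H :: "'a \<Rightarrow> real"
  assumes "H \<in> borel_measurable (F k)"
  shows "indep_var borel H borel (\<eta> k)"
  by (rule indep_var_of_indep_set[OF F_subalgebra noise_indep assms noise_measurable])

lemma past_orthogonal:
  fixes H :: "'a \<Rightarrow> real"
  assumes H: "H \<in> borel_measurable (F k)" "integrable M H"
  shows "integrable M (\<lambda>w. H w * \<eta> k w)" "(\<integral>w. H w * \<eta> k w \<partial>M) = 0"
  using indep_var_integrable[OF indep_past[OF H(1)] H(2) noise_moments(1)]
    indep_var_lebesgue_integral[OF indep_past[OF H(1)] H(2) noise_moments(1)]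
  by (simp_all add: noise_moments(2))

lemma partial_sum_adapted:
  fixes a :: "nat \<Rightarrow> 'a \<Rightarrow> real"
  assumes a: "\<And>k. a k \<in> borel_measurable (F k)"
  shows "(\<lambda>w. \<Sum>k<n. a k w * \<eta> k w) \<in> borel_measurable (F n)"
proof (rule borel_measurable_sum)
  fix k assume "k \<in> {..<n}"
  then show "(\<lambda>w. a k w * \<eta> k w) \<in> borel_measurable (F n)"
    by (intro borel_measurable_times F_measurable_mono[OF a] F_measurable_mono[OF noise_adapted]) auto
qed

text \<open>
  The cross term of \<open>S\<^sub>n + a\<^sub>n \<eta>\<^sub>n\<close> is \<open>2 S\<^sub>n a\<^sub>n\<close>, which belongs to the past, times \<open>\<eta>\<^sub>n\<close>; so it has mean zero and the
  second moments add up.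
\<close>
lemma second_moment_partial_sum:
  fixes a :: "nat \<Rightarrow> 'a \<Rightarrow> real"
  assumes a: "\<And>k. a k \<in> borel_measurable (F k)" and C: "\<And>k w. \<bar>a k w\<bar> \<le> C"
  shows "integrable M (\<lambda>w. (\<Sum>k<n. a k w * \<eta> k w)\<^sup>2) \<and>
    (\<integral>w. (\<Sum>k<n. a k w * \<eta> k w)\<^sup>2 \<partial>M) \<le> real n * (C\<^sup>2 * \<kappa>)"
proof (induction n)
  case (Suc n)
  define S where "S w = (\<Sum>k<n. a k w * \<eta> k w)" for w
  have IH: "integrable M (\<lambda>w. (S w)\<^sup>2)" "(\<integral>w. (S w)\<^sup>2 \<partial>M) \<le> real n * (C\<^sup>2 * \<kappa>)"
    using Suc by (auto simp: S_def)
  have SF: "S \<in> borel_measurable (F n)"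
    unfolding S_def[abs_def] by (rule partial_sum_adapted[OF a])
  note [measurable] = F_measurable[OF SF] F_measurable[OF a]
  have Sint: "integrable M S" by (rule square_integrable_imp_integrable[OF _ IH(1)]) measurable
  have "\<bar>S w * a n w\<bar> \<le> \<bar>C * S w\<bar>" for w
    using mult_left_mono[OF order_trans[OF C[of n w] abs_ge_self] abs_ge_zero[of "S w"]]
    by (simp add: abs_mult mult.commute)
  then have Saint: "integrable M (\<lambda>w. S w * a n w)"
    by (intro Bochner_Integration.integrable_bound[OF integrable_mult_right[OF Sint, of C]]) auto
  have cross: "integrable M (\<lambda>w. S w * a n w * \<eta> n w)" "(\<integral>w. S w * a n w * \<eta> n w \<partial>M) = 0"
    using past_orthogonal[OF _ Saint, of n] borel_measurable_times[OF SF a[of n]] by auto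
  have le: "(a n w * \<eta> n w)\<^sup>2 \<le> C\<^sup>2 * (\<eta> n w)\<^sup>2" for w
    using power_mono[OF C[of n w], of 2] by (simp add: power_mult_distrib mult_right_mono)
  have sq: "integrable M (\<lambda>w. (a n w * \<eta> n w)\<^sup>2)"
    using le by (intro Bochner_Integration.integrable_bound[OF integrable_mult_right[OF noise_moments(3)[of n], of "C\<^sup>2"]]) auto
  have sq': "(\<integral>w. (a n w * \<eta> n w)\<^sup>2 \<partial>M) \<le> C\<^sup>2 * \<kappa>"
    using integral_mono[OF sq integrable_mult_right[OF noise_moments(3)[of n], of "C\<^sup>2"]] le noise_moments(4) by simp
  have eq: "(\<Sum>k<Suc n. a k w * \<eta> k w)\<^sup>2 = (S w)\<^sup>2 + 2 * (S w * a n w * \<eta> n w) + (a n w * \<eta> n w)\<^sup>2" for w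
    by (simp add: S_def power2_eq_square algebra_simps)
  show ?case
    unfolding eq using IH sq sq' cross by (simp add: distrib_right)
qed simp

lemma second_moment_partial_sum_vec:
  fixes a :: "nat \<Rightarrow> 'a \<Rightarrow> 'b::euclidean_space"
  assumes a: "\<And>k. a k \<in> borel_measurable (F k)" and C: "\<And>k w. norm (a k w) \<le> C"
  shows "integrable M (\<lambda>w. (norm (\<Sum>k<n. \<eta> k w *\<^sub>R a k w))\<^sup>2)"
    and "(\<integral>w. (norm (\<Sum>k<n. \<eta> k w *\<^sub>R a k w))\<^sup>2 \<partial>M) \<le> real DIM('b) * (real n * (C\<^sup>2 * \<kappa>))"
proof -
  have eq: "(norm (\<Sum>k<n. \<eta> k w *\<^sub>R a k w))\<^sup>2 = (\<Sum>b\<in>Basis. (\<Sum>k<n. (a k w \<bullet> b) * \<eta> k w)\<^sup>2)" for w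
    unfolding power2_norm_eq_inner
    by (subst euclidean_inner) (simp add: power2_eq_square inner_sum_left mult.commute)
  have *: "integrable M (\<lambda>w. (\<Sum>k<n. (a k w \<bullet> b) * \<eta> k w)\<^sup>2) \<and>
    (\<integral>w. (\<Sum>k<n. (a k w \<bullet> b) * \<eta> k w)\<^sup>2 \<partial>M) \<le> real n * (C\<^sup>2 * \<kappa>)" if "b \<in> Basis" for b
    using a that by (intro second_moment_partial_sum) (auto intro: order_trans[OF Basis_le_norm C])
  show "integrable M (\<lambda>w. (norm (\<Sum>k<n. \<eta> k w *\<^sub>R a k w))\<^sup>2)"
    unfolding eq using * by (intro Bochner_Integration.integrable_sum) auto
  show "(\<integral>w. (norm (\<Sum>k<n. \<eta> k w *\<^sub>R a k w))\<^sup>2 \<partial>M) \<le> real DIM('b) * (real n * (C\<^sup>2 * \<kappa>))"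
    unfolding eq using *
    by (subst Bochner_Integration.integral_sum) (auto intro!: sum_bounded_above)
qed

text \<open>
  Conditioning on the past: the pair of past quantities and the new noise have a product law, so that Fubini's
  theorem integrates the noise out for fixed \<open>b\<close>. The truncation of the first factor at \<open>B\<close> makes the integrand
  bounded on the whole product space, not only at the values that \<open>H\<close> takes.
\<close>
lemma char_product:
  fixes H :: "'a \<Rightarrow> complex" and b :: "'a \<Rightarrow> real"
  assumes H: "H \<in> borel_measurable (F k)" and bd: "\<And>w. norm (H w) \<le> B" and b: "b \<in> borel_measurable (F k)"
  shows "(\<integral>w. H w * iexp (b w * \<eta> k w) \<partial>M) = (\<integral>w. H w * char D (b w) \<partial>M)"
proof -
  interpret D: real_distribution D by unfold_locales auto
  have Hb: "(\<lambda>w. (H w, b w)) \<in> borel_measurable (F k)" using H b by simp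
  note [measurable] = F_measurable[OF H] F_measurable[OF b] F_measurable[OF Hb]
  let ?P = "distr M borel (\<lambda>w. (H w, b w))"
  let ?g = "\<lambda>((h::complex, t::real), x::real). (if norm h \<le> B then h else 0) * iexp (t * x)"
  interpret HB: prob_space ?P by (rule prob_space_distr) simp
  interpret HD: pair_prob_space ?P D ..
  have eq: "distr M (borel \<Otimes>\<^sub>M borel) (\<lambda>w. ((H w, b w), \<eta> k w)) = ?P \<Otimes>\<^sub>M D"
    using joint_distr_of_indep_set[OF F_subalgebra noise_indep Hb] by (simp add: noise_distr)
  have gm[measurable]: "?g \<in> borel_measurable (borel \<Otimes>\<^sub>M borel)"
    by (simp add: split_beta' borel_prod[symmetric])
  have gm'[measurable]: "?g \<in> borel_measurable (?P \<Otimes>\<^sub>M D)"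
    using gm by (simp cong: measurable_cong_sets)
  have "\<bar>B\<bar> \<ge> 0" by simp
  then have gb: "norm (?g z) \<le> \<bar>B\<bar>" for z
    by (auto simp: split_beta norm_mult)
  have int: "integrable (?P \<Otimes>\<^sub>M D) ?g"
    by (rule HD.P.integrable_const_bound[where B="\<bar>B\<bar>", OF AE_I2[OF gb] gm'])
  have "(\<integral>w. H w * iexp (b w * \<eta> k w) \<partial>M) = (\<integral>w. ?g ((H w, b w), \<eta> k w) \<partial>M)"
    using bd by simp
  also have "\<dots> = (\<integral>z. ?g z \<partial>distr M (borel \<Otimes>\<^sub>M borel) (\<lambda>w. ((H w, b w), \<eta> k w)))"
    by (rule integral_distr[OF _ gm, symmetric]) measurable
  also have "\<dots> = (\<integral>z. ?g z \<partial>(?P \<Otimes>\<^sub>M D))" unfolding eq ..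
  also have "\<dots> = (\<integral>y. (\<integral>x. ?g (y, x) \<partial>D) \<partial>?P)"
    by (rule HD.integral_fst'[OF int, symmetric])
  also have "\<dots> = (\<integral>y. (if norm (fst y) \<le> B then fst y else 0) * char D (snd y) \<partial>?P)"
    by (simp add: split_beta char_def)
  also have "\<dots> = (\<integral>w. (if norm (H w) \<le> B then H w else 0) * char D (b w) \<partial>M)"
    by (subst integral_distr) (auto simp: borel_prod[symmetric] cong: if_cong)
  finally show ?thesis using bd by simp
qed

text \<open>
  Let \<open>S\<^sub>k\<close> be the partial sums divided by \<open>\<surd>n\<close> and \<open>V\<^sub>k = \<kappa> \<Sum>\<^sub>j\<^sub><\<^sub>k b\<^sub>j\<^sup>2 / (2 n)\<close>. Since \<open>V\<^sub>k\<^sub>+\<^sub>1\<close> is already known at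
  time \<open>k\<close>, passing from \<open>L\<^sub>k = E (exp (i S\<^sub>k) exp V\<^sub>k)\<close> to \<open>L\<^sub>k\<^sub>+\<^sub>1\<close> exchanges the factor \<open>exp (- \<kappa> b\<^sub>k\<^sup>2 / (2 n))\<close> for
  the value of the characteristic function of the noise at \<open>b\<^sub>k / \<surd>n\<close>. These differ by \<open>o(1/n)\<close> uniformly, so
  \<open>L\<^sub>n\<close> tends to \<open>L\<^sub>0 = 1\<close>; and \<open>V\<^sub>n\<close> tends to the constant \<open>\<kappa> v / 2\<close>.
\<close>
theorem clt_char:
  fixes b :: "nat \<Rightarrow> 'a \<Rightarrow> real"
  assumes b: "\<And>k. b k \<in> borel_measurable (F k)" and C: "\<And>k w. \<bar>b k w\<bar> \<le> C"
    and v: "AE w in M. (\<lambda>n. (\<Sum>k<n. (b k w)\<^sup>2) / real n) \<longlonglongrightarrow> v"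
  shows "(\<lambda>n. \<integral>w. iexp ((\<Sum>k<n. b k w * \<eta> k w) / sqrt (real n)) \<partial>M) \<longlonglongrightarrow> of_real (exp (- (\<kappa> * v) / 2))"
proof -
  interpret D: real_distribution D by unfold_locales auto
  note [measurable] = F_measurable[OF b]
  have C0: "C \<ge> 0" using C[of 0] order_trans[OF abs_ge_zero] by blast
  have b2: "(b k w)\<^sup>2 \<le> C\<^sup>2" for k w using power_mono[OF C[of k w], of 2] by simp
  define m where "m n = (\<integral>x. min (6 * x\<^sup>2) (C / sqrt (real n) * \<bar>x\<bar> ^ 3) \<partial>D)" for n
  define r where "r n = C\<^sup>2 / 6 * m n + (\<kappa> * C\<^sup>2 / 2)\<^sup>2 / real n" for n
  define E0 where "E0 = exp (\<kappa> * C\<^sup>2 / 2)"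
  have m_int: "integrable D (\<lambda>x. min (6 * x\<^sup>2) (c * \<bar>x\<bar> ^ 3))" if "c \<ge> 0" for c
    using that by (intro Bochner_Integration.integrable_bound[OF integrable_mult_right[OF noise_square(1), of 6]]) auto
  have "m \<longlonglongrightarrow> (\<integral>x. 0 \<partial>D)"
    unfolding m_def
  proof (rule integral_dominated_convergence[where w = "\<lambda>x. 6 * x\<^sup>2"])
    have "(\<lambda>n. min (6 * x\<^sup>2) (C / sqrt (real n) * \<bar>x\<bar> ^ 3)) \<longlonglongrightarrow> min (6 * x\<^sup>2) (0 * \<bar>x\<bar> ^ 3)" for x
      by (intro tendsto_intros real_tendsto_divide_at_top[OF tendsto_const]
          filterlim_compose[OF sqrt_at_top filterlim_real_sequentially])
    then show "AE x in D. (\<lambda>n. min (6 * x\<^sup>2) (C / sqrt (real n) * \<bar>x\<bar> ^ 3)) \<longlonglongrightarrow> 0"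
      by (simp add: min_absorb2)
  qed (use C0 noise_square in auto)
  then have "m \<longlonglongrightarrow> 0" by simp
  then have "r \<longlonglongrightarrow> C\<^sup>2 / 6 * 0 + 0"
    unfolding r_def by (intro tendsto_intros lim_const_over_n)
  then have r0: "r \<longlonglongrightarrow> 0" by simp
  \<comment> \<open>Both terms agree with \<open>1 - \<kappa> t\<^sup>2 / (2 n)\<close> up to the two summands of \<open>r n\<close> over \<open>n\<close>.\<close>
  have approx: "cmod (char D (t / sqrt (real n)) - of_real (exp (- (\<kappa> * t\<^sup>2 / (2 * real n))))) \<le> r n / real n"
    if t: "\<bar>t\<bar> \<le> C" and n: "n > 0" for t n
  proof -
    define u where "u = t / sqrt (real n)"
    have u: "\<bar>u\<bar> \<le> C / sqrt (real n)" using t n by (simp add: u_def divide_right_mono)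
    have u2: "u\<^sup>2 = t\<^sup>2 / real n" using n by (simp add: u_def power_divide)
    have t2: "t\<^sup>2 \<le> C\<^sup>2" using power_mono[OF t, of 2] by simp
    define y where "y = \<kappa> * t\<^sup>2 / (2 * real n)"
    have y0: "y \<ge> 0" using variance_nonneg by (simp add: y_def)
    have yle: "y \<le> \<kappa> * C\<^sup>2 / 2 / real n"
      unfolding y_def using t2 variance_nonneg n by (simp add: divide_right_mono mult_left_mono)
    have "cmod (char D u - (1 - u\<^sup>2 * \<kappa> / 2)) \<le> (u\<^sup>2 / 6) * (\<integral>x. min (6 * x\<^sup>2) (\<bar>u\<bar> * \<bar>x\<bar> ^ 3) \<partial>D)"
      by (rule D.char_approx3) (use D_integrable noise_mean noise_square in auto)
    also have "\<dots> \<le> (C\<^sup>2 / real n / 6) * m n"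
    proof (rule mult_mono)
      show "u\<^sup>2 / 6 \<le> C\<^sup>2 / real n / 6" using t2 n by (simp add: u2 divide_right_mono)
      show "(\<integral>x. min (6 * x\<^sup>2) (\<bar>u\<bar> * \<bar>x\<bar> ^ 3) \<partial>D) \<le> m n"
        unfolding m_def using u C0 by (intro integral_mono m_int min.mono mult_right_mono) auto
    qed (auto intro!: integral_nonneg_AE)
    finally have 1: "cmod (char D u - of_real (1 - y)) \<le> C\<^sup>2 / 6 * m n / real n"
      by (simp add: y_def u2 algebra_simps)
    have "exp (- y) \<le> 1 / (1 + y)"
      using exp_ge_add_one_self[of y] y0 by (simp add: exp_minus inverse_eq_divide frac_le)
    also have "\<dots> \<le> 1 - y + y\<^sup>2"
    proof -
      have "(1 - y + y\<^sup>2) * (1 + y) = 1 + y ^ 3" by (simp add: algebra_simps power2_eq_square power3_eq_cube)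
      then show ?thesis using y0 by (simp add: divide_le_eq)
    qed
    finally have "\<bar>(1 - y) - exp (- y)\<bar> \<le> y\<^sup>2"
      using exp_ge_add_one_self[of "- y"] by simp
    also have "\<dots> \<le> (\<kappa> * C\<^sup>2 / 2 / real n)\<^sup>2" using yle y0 by (rule power_mono)
    also have "\<dots> = (\<kappa> * C\<^sup>2 / 2)\<^sup>2 / real n / real n" by (simp add: power2_eq_square)
    finally have 2: "cmod (of_real (1 - y) - of_real (exp (- y))) \<le> (\<kappa> * C\<^sup>2 / 2)\<^sup>2 / real n / real n"
      by (simp only: norm_of_real flip: of_real_diff)
    have "cmod (char D u - of_real (exp (- y))) \<le> C\<^sup>2 / 6 * m n / real n + (\<kappa> * C\<^sup>2 / 2)\<^sup>2 / real n / real n"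
      using norm_triangle_mono[OF 1 2] by simp
    also have "\<dots> = r n / real n" by (simp add: r_def add_divide_distrib)
    finally show ?thesis by (simp add: u_def y_def)
  qed
  define S where "S n k w = (\<Sum>j<k. b j w * \<eta> j w) / sqrt (real n)" for n k w
  define V where "V n k w = \<kappa> * (\<Sum>j<k. (b j w)\<^sup>2) / (2 * real n)" for n k w
  have SF: "S n k \<in> borel_measurable (F k)" for n k
    unfolding S_def[abs_def] by (intro borel_measurable_divide partial_sum_adapted b borel_measurable_const)
  have VF: "V n k \<in> borel_measurable (F j)" if "k \<le> Suc j" for n k j
    unfolding V_def[abs_def] using that
    by (intro borel_measurable_divide borel_measurable_times borel_measurable_const borel_measurable_sum
        borel_measurable_power F_measurable_mono[OF b]) auto
  note [measurable] = F_measurable[OF SF] F_measurable[OF VF[OF le_SucI[OF order_refl]]]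
  have V_bound: "V n k w \<le> \<kappa> * C\<^sup>2 / 2" if "k \<le> n" for n k w
  proof (cases "n = 0")
    case False
    have "(\<Sum>j<k. (b j w)\<^sup>2) \<le> real k * C\<^sup>2" using sum_bounded_above[of "{..<k}" "\<lambda>j. (b j w)\<^sup>2" "C\<^sup>2"] b2 by auto
    also have "\<dots> \<le> real n * C\<^sup>2" using that by (intro mult_right_mono) auto
    finally have "\<kappa> * (\<Sum>j<k. (b j w)\<^sup>2) \<le> \<kappa> * (real n * C\<^sup>2)" using variance_nonneg by (rule mult_left_mono)
    then show ?thesis using False by (simp add: V_def field_simps)
  qed (use variance_nonneg in \<open>auto simp: V_def\<close>)
  have VE: "exp (V n n w) \<le> E0" for n w using V_bound[of n n w] by (simp add: E0_def)
  define L where "L n k = (\<integral>w. iexp (S n k w) * of_real (exp (V n k w)) \<partial>M)" for n k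
  have L0: "L n 0 = 1" for n by (simp add: L_def S_def V_def prob_space)
  have step: "cmod (L n (Suc k) - L n k) \<le> E0 * (r n / real n)" if k: "k < n" for n k
  proof -
    define H where "H w = iexp (S n k w) * of_real (exp (V n (Suc k) w))" for w
    have HF: "H \<in> borel_measurable (F k)"
      unfolding H_def[abs_def]
      using SF[of n k] VF[of "Suc k" k n] by measurable
    have Hb: "cmod (H w) \<le> E0" for w
      using V_bound[of "Suc k" n w] k by (auto simp: H_def norm_mult E0_def)
    have cF: "(\<lambda>w. b k w / sqrt (real n)) \<in> borel_measurable (F k)" using b by simp
    note [measurable] = F_measurable[OF HF] F_measurable[OF cF]
    let ?e = "\<lambda>w. complex_of_real (exp (- (\<kappa> * (b k w)\<^sup>2 / (2 * real n))))"
    have "L n (Suc k) = (\<integral>w. H w * iexp (b k w / sqrt (real n) * \<eta> k w) \<partial>M)"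
      unfolding L_def H_def
      by (intro Bochner_Integration.integral_cong refl)
        (simp add: S_def add_divide_distrib distrib_left exp_add mult_ac)
    also have "\<dots> = (\<integral>w. H w * char D (b k w / sqrt (real n)) \<partial>M)"
      by (rule char_product[OF HF Hb cF])
    finally have 1: "L n (Suc k) = (\<integral>w. H w * char D (b k w / sqrt (real n)) \<partial>M)" .
    have 2: "L n k = (\<integral>w. H w * ?e w \<partial>M)"
      unfolding L_def H_def
      by (intro Bochner_Integration.integral_cong refl)
        (simp add: V_def distrib_left add_divide_distrib mult_exp_exp flip: of_real_mult)
    have int1: "integrable M (\<lambda>w. H w * char D (b k w / sqrt (real n)))"
      by (rule integrable_const_bound[where B = "E0 * 1"])
        (auto simp only: norm_mult intro!: AE_I2 mult_mono Hb D.cmod_char_le_1 norm_ge_zero, auto simp: E0_def)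
    have int2: "integrable M (\<lambda>w. H w * ?e w)"
      by (rule integrable_const_bound[where B = "E0 * 1"])
        (use variance_nonneg in \<open>auto simp: norm_mult intro!: AE_I2 mult_mono[OF Hb, where d = 1, simplified]\<close>, auto simp: E0_def)
    have bound: "cmod (H w * char D (b k w / sqrt (real n)) - H w * ?e w) \<le> E0 * (r n / real n)" for w
      using mult_mono[OF Hb[of w] approx[OF C[of k w], of n]] k
      by (simp add: norm_mult E0_def flip: right_diff_distrib)
    have "L n (Suc k) - L n k = (\<integral>w. H w * char D (b k w / sqrt (real n)) - H w * ?e w \<partial>M)"
      unfolding 1 2 by (rule Bochner_Integration.integral_diff[OF int1 int2, symmetric])
    also have "cmod \<dots> \<le> (\<integral>w. cmod (H w * char D (b k w / sqrt (real n)) - H w * ?e w) \<partial>M)"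
      by (rule integral_norm_bound)
    also have "\<dots> \<le> (\<integral>w. E0 * (r n / real n) \<partial>M)"
      using int1 int2 bound by (intro integral_mono) auto
    also have "\<dots> = E0 * (r n / real n)" by (simp add: prob_space)
    finally show ?thesis .
  qed
  have L1: "cmod (L n k - 1) \<le> real k * (E0 * (r n / real n))" if "k \<le> n" for n k
    using that
  proof (induction k)
    case (Suc k)
    have "cmod (L n (Suc k) - 1) \<le> E0 * (r n / real n) + real k * (E0 * (r n / real n))"
      using norm_triangle_mono[OF step[of k n] Suc.IH] Suc.prems by simp
    then show ?case by (simp add: algebra_simps add_divide_distrib)
  qed (simp add: L0)
  have "(\<lambda>n. L n n - 1) \<longlonglongrightarrow> 0"
  proof (rule Lim_null_comparison)
    show "\<forall>\<^sub>F n in sequentially. cmod (L n n - 1) \<le> E0 * r n"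
      using eventually_gt_at_top[of 0]
    proof eventually_elim
      case (elim n)
      then show ?case using L1[of n n] by simp
    qed
    show "(\<lambda>n. E0 * r n) \<longlonglongrightarrow> 0" using tendsto_mult_right_zero[OF r0] .
  qed
  then have Ln: "(\<lambda>n. L n n) \<longlonglongrightarrow> 1" by (simp add: LIM_zero_iff)
  let ?v = "complex_of_real (exp (- (\<kappa> * v) / 2))"
  have "(\<lambda>n. \<integral>w. iexp (S n n w) - ?v * (iexp (S n n w) * of_real (exp (V n n w))) \<partial>M) \<longlonglongrightarrow> (\<integral>w. 0 \<partial>M)"
  proof (rule integral_dominated_convergence[where w = "\<lambda>w. 1 + exp (- (\<kappa> * v) / 2) * E0"])
    show "AE w in M. (\<lambda>n. iexp (S n n w) - ?v * (iexp (S n n w) * of_real (exp (V n n w)))) \<longlonglongrightarrow> 0"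
      using v
    proof eventually_elim
      case (elim w)
      have "(\<lambda>n. V n n w) \<longlonglongrightarrow> \<kappa> / 2 * v"
        using tendsto_mult_left[OF elim, of "\<kappa> / 2"] by (simp add: V_def)
      then have "(\<lambda>n. 1 - exp (- (\<kappa> * v) / 2) * exp (V n n w)) \<longlonglongrightarrow> 1 - exp (- (\<kappa> * v) / 2) * exp (\<kappa> / 2 * v)"
        by (intro tendsto_intros)
      then have *: "(\<lambda>n. 1 - exp (- (\<kappa> * v) / 2) * exp (V n n w)) \<longlonglongrightarrow> 0"
        by (simp add: mult_exp_exp)
      have eq: "iexp (S n n w) - ?v * (iexp (S n n w) * of_real (exp (V n n w)))
          = iexp (S n n w) * of_real (1 - exp (- (\<kappa> * v) / 2) * exp (V n n w))" for n
        by (simp add: algebra_simps)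
      show ?case
        unfolding eq
        by (rule Lim_null_comparison[OF _ tendsto_norm_zero[OF *]])
          (auto simp: norm_mult simp del: of_real_diff of_real_mult)
    qed
    show "AE w in M. cmod (iexp (S n n w) - ?v * (iexp (S n n w) * of_real (exp (V n n w)))) \<le> 1 + exp (- (\<kappa> * v) / 2) * E0" for n
      by (rule AE_I2) (auto intro!: order_trans[OF norm_triangle_ineq4] add_mono mult_left_mono VE simp: norm_mult)
  qed auto
  moreover have "(\<integral>w. iexp (S n n w) - ?v * (iexp (S n n w) * of_real (exp (V n n w))) \<partial>M)
      = (\<integral>w. iexp (S n n w) \<partial>M) - ?v * L n n" for n
  proof -
    have "integrable M (\<lambda>w. iexp (S n n w))" by (intro integrable_iexp) auto
    moreover have "integrable M (\<lambda>w. iexp (S n n w) * complex_of_real (exp (V n n w)))"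
      by (rule integrable_const_bound[where B = E0]) (auto simp: norm_mult intro!: VE)
    ultimately show ?thesis by (simp add: L_def)
  qed
  ultimately have "(\<lambda>n. (\<integral>w. iexp (S n n w) \<partial>M) - ?v * L n n) \<longlonglongrightarrow> 0" by simp
  from tendsto_add[OF this tendsto_mult[OF tendsto_const[of ?v] Ln]]
  show ?thesis by (simp add: S_def)
qed

end

section \<open>Continuity theorem for characteristic functions in several variables\<close>

text \<open>
  The span of the functions whose integrals are determined by a characteristic function; phases are kept in the
  cosine so that products stay in the span by the addition theorem alone.
\<close>
inductive trig_poly :: "('b::euclidean_space \<Rightarrow> real) \<Rightarrow> bool" where
  trig_cos: "trig_poly (\<lambda>x. cos (a \<bullet> x + c))"
| trig_add: "trig_poly f \<Longrightarrow> trig_poly g \<Longrightarrow> trig_poly (\<lambda>x. f x + g x)"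
| trig_scale: "trig_poly f \<Longrightarrow> trig_poly (\<lambda>x. c * f x)"

lemma trig_poly_const: "trig_poly (\<lambda>x. c)"
  using trig_scale[OF trig_cos[of 0 0], of c] by simp

lemma trig_poly_sin: "trig_poly (\<lambda>x. sin (a \<bullet> x))"
  using trig_cos[of a "- pi / 2"] by (simp add: cos_diff)

lemma trig_poly_sum: "(\<And>i. i \<in> I \<Longrightarrow> trig_poly (f i)) \<Longrightarrow> trig_poly (\<lambda>x. \<Sum>i\<in>I. f i x)"
  by (induction I rule: infinite_finite_induct) (auto intro: trig_poly_const trig_add)

lemma trig_poly_mult:
  assumes "trig_poly f" "trig_poly g"
  shows "trig_poly (\<lambda>x. f x * g x)"
  using assms
proof (induction f)
  case (trig_cos a c)
  from trig_cos show ?case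
  proof (induction g)
    case (trig_cos a' c')
    have "(\<lambda>x. cos (a \<bullet> x + c) * cos (a' \<bullet> x + c'))
        = (\<lambda>x. (1/2) * (cos ((a - a') \<bullet> x + (c - c')) + cos ((a + a') \<bullet> x + (c + c'))))"
    proof
      fix x
      have "(a - a') \<bullet> x + (c - c') = (a \<bullet> x + c) - (a' \<bullet> x + c')"
        "(a + a') \<bullet> x + (c + c') = (a \<bullet> x + c) + (a' \<bullet> x + c')" by (simp_all add: algebra_simps)
      then show "cos (a \<bullet> x + c) * cos (a' \<bullet> x + c')
          = (1/2) * (cos ((a - a') \<bullet> x + (c - c')) + cos ((a + a') \<bullet> x + (c + c')))"
        by (simp only: cos_times_cos)
    qed
    then show ?case by (simp only:) (intro trig_poly.intros)
  next
    case (trig_add f g)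
    show ?case using trig_poly.trig_add[OF trig_add.IH] by (simp add: distrib_left)
  next
    case (trig_scale f d)
    show ?case using trig_poly.trig_scale[OF trig_scale.IH, of d] by (simp add: mult.left_commute)
  qed
next
  case (trig_add f h)
  show ?case using trig_poly.trig_add[OF trig_add.IH] trig_add.prems by (simp add: distrib_right)
next
  case (trig_scale f c)
  show ?case using trig_poly.trig_scale[OF trig_scale.IH, of c] trig_scale.prems by (simp add: mult.assoc)
qed

lemma trig_poly_continuous: "trig_poly f \<Longrightarrow> continuous_on UNIV f"
  by (induction rule: trig_poly.induct) (auto intro!: continuous_intros)

lemma trig_poly_bounded: "trig_poly f \<Longrightarrow> \<exists>B. \<forall>x. \<bar>f x\<bar> \<le> B"
proof (induction rule: trig_poly.induct)
  case (trig_cos a c)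
  show ?case by (intro exI[of _ 1]) simp
next
  case (trig_add f g)
  then obtain B B' where "\<And>x. \<bar>f x\<bar> \<le> B" "\<And>x. \<bar>g x\<bar> \<le> B'" by auto
  then show ?case by (intro exI[of _ "B + B'"]) (meson abs_triangle_ineq add_mono order_trans)
next
  case (trig_scale f c)
  then obtain B where "\<And>x. \<bar>f x\<bar> \<le> B" by auto
  then show ?case by (intro exI[of _ "\<bar>c\<bar> * B"]) (auto simp: abs_mult mult_left_mono)
qed

lemma trig_poly_measurable: "trig_poly f \<Longrightarrow> f \<in> borel_measurable borel"
  by (intro borel_measurable_continuous_onI trig_poly_continuous)

lemma trig_poly_of_polynomial:
  fixes q :: "'b::euclidean_space \<Rightarrow> real"
  assumes "real_polynomial_function q"
  shows "trig_poly (\<lambda>x. q (\<Sum>i\<in>Basis. sin (c * (x \<bullet> i)) *\<^sub>R i))"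
  using assms
proof (induction q rule: real_polynomial_function.induct)
  case (linear f)
  have "(\<lambda>x. f (\<Sum>i\<in>Basis. sin (c * (x \<bullet> i)) *\<^sub>R i)) = (\<lambda>x. \<Sum>i\<in>Basis. f i * sin ((c *\<^sub>R i) \<bullet> x))"
    using linear by (simp add: bounded_linear.linear linear_sum linear_scale inner_commute mult.commute)
  then show ?case by (simp only:) (intro trig_poly_sum trig_scale trig_poly_sin)
qed (auto intro: trig_poly_const trig_add trig_poly_mult)

text \<open>
  On the ball of radius \<open>K\<close> one has \<open>x\<^sub>i = arcsin (sin (c x\<^sub>i)) / c\<close> with \<open>c = \<pi> / (2 K)\<close>. So there \<open>f\<close> is a continuous
  function \<open>g\<close> of the numbers \<open>sin (c x\<^sub>i)\<close>, which range over a cube, and a polynomial approximation of \<open>g\<close>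
  on that cube becomes a trigonometric polynomial. As the sines never leave the cube, the approximation is bounded
  by \<open>B + e\<close> on the whole space and not only on the ball.
\<close>
lemma trig_poly_approximation:
  fixes f :: "'b::euclidean_space \<Rightarrow> real"
  assumes f: "continuous_on UNIV f" and B: "\<And>x. \<bar>f x\<bar> \<le> B" and K: "K > 0" and e: "e > 0"
  obtains q where "trig_poly q" "\<And>x. \<bar>q x\<bar> \<le> B + e" "\<And>x. norm x \<le> K \<Longrightarrow> \<bar>f x - q x\<bar> \<le> e"
proof -
  define c where "c = pi / (2 * K)"
  have c: "c > 0" using K by (simp add: c_def)
  define Q where "Q = cbox (- One) (One :: 'b)"
  have Q: "z \<in> Q \<longleftrightarrow> (\<forall>i\<in>Basis. - 1 \<le> z \<bullet> i \<and> z \<bullet> i \<le> 1)" for z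
    by (auto simp: Q_def mem_box inner_sum_left_Basis)
  define g where "g z = f (\<Sum>i\<in>Basis. (arcsin (z \<bullet> i) / c) *\<^sub>R i)" for z
  have "continuous_on Q g"
    unfolding g_def using c Q
    by (intro continuous_on_compose2[OF f] continuous_intros) auto
  then obtain p where p: "real_polynomial_function p" "\<And>z. z \<in> Q \<Longrightarrow> \<bar>g z - p z\<bar> < e"
    using Stone_Weierstrass_real_polynomial_function[of Q g e] e by (auto simp: Q_def)
  define s where "s x = (\<Sum>i\<in>Basis. sin (c * (x \<bullet> i)) *\<^sub>R i)" for x :: 'b
  have s: "s x \<bullet> i = sin (c * (x \<bullet> i))" if "i \<in> Basis" for x i
    using that by (simp add: s_def)
  have sQ: "s x \<in> Q" for x by (simp add: Q s)
  show ?thesis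
  proof (rule that)
    show "trig_poly (\<lambda>x. p (s x))"
      unfolding s_def by (rule trig_poly_of_polynomial[OF p(1)])
    show "\<bar>p (s x)\<bar> \<le> B + e" for x
    proof -
      have "\<bar>g (s x)\<bar> \<le> B" by (simp add: g_def B)
      then show ?thesis using p(2)[OF sQ[of x]] by linarith
    qed
    show "\<bar>f x - p (s x)\<bar> \<le> e" if "norm x \<le> K" for x
    proof -
      have "arcsin (sin (c * (x \<bullet> i))) / c = x \<bullet> i" if i: "i \<in> Basis" for i
      proof -
        have "\<bar>x \<bullet> i\<bar> \<le> K" using Basis_le_norm[OF i, of x] \<open>norm x \<le> K\<close> by linarith
        then have "\<bar>c * (x \<bullet> i)\<bar> \<le> c * K" using c by (simp add: abs_mult)
        also have "c * K = pi / 2" using K by (simp add: c_def)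
        finally have "\<bar>c * (x \<bullet> i)\<bar> \<le> pi / 2" .
        then have "arcsin (sin (c * (x \<bullet> i))) = c * (x \<bullet> i)" by (intro arcsin_sin) (auto simp: abs_le_iff)
        then show ?thesis using c by simp
      qed
      then have "g (s x) = f x" by (simp add: g_def s euclidean_representation cong: sum.cong)
      then show ?thesis using p(2)[OF sQ[of x]] by simp
    qed
  qed
qed

text \<open>Outside the ball both functions are bounded by \<open>B\<close>, and only the probability of that event enters.\<close>
lemma (in prob_space) integral_close_if_close_on_ball:
  fixes Z :: "'a \<Rightarrow> 'b::euclidean_space"
  assumes Z [measurable]: "random_variable borel Z"
    and f [measurable]: "f \<in> borel_measurable borel" and q [measurable]: "q \<in> borel_measurable borel"
    and fB: "\<And>x. \<bar>f x\<bar> \<le> B" and qB: "\<And>x. \<bar>q x\<bar> \<le> B"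
    and close: "\<And>x. norm x \<le> K \<Longrightarrow> \<bar>f x - q x\<bar> \<le> e" and e: "e \<ge> 0"
  shows "\<bar>(\<integral>w. f (Z w) \<partial>M) - (\<integral>w. q (Z w) \<partial>M)\<bar> \<le> e + 2 * B * \<P>(w in M. norm (Z w) > K)"
proof -
  let ?A = "{w\<in>space M. norm (Z w) > K}"
  have int: "integrable M (\<lambda>w. f (Z w))" "integrable M (\<lambda>w. q (Z w))"
    using fB qB by (auto intro!: integrable_const_bound[where B = B])
  have B0: "B \<ge> 0" using fB[of undefined] abs_ge_zero[of "f undefined"] by linarith
  have intA: "integrable M (indicator ?A :: 'a \<Rightarrow> real)"
    by (intro integrable_real_indicator) (auto simp: less_top[symmetric])
  have "\<bar>(\<integral>w. f (Z w) \<partial>M) - (\<integral>w. q (Z w) \<partial>M)\<bar> = \<bar>\<integral>w. f (Z w) - q (Z w) \<partial>M\<bar>"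
    using int by simp
  also have "\<dots> \<le> (\<integral>w. \<bar>f (Z w) - q (Z w)\<bar> \<partial>M)" by (rule integral_abs_bound)
  also have "\<dots> \<le> (\<integral>w. e + 2 * B * indicator ?A w \<partial>M)"
  proof (rule integral_mono)
    show "\<bar>f (Z w) - q (Z w)\<bar> \<le> e + 2 * B * indicator ?A w" if "w \<in> space M" for w
    proof (cases "norm (Z w) \<le> K")
      case True
      then show ?thesis using close[OF True] by simp
    next
      case False
      then show ?thesis using fB[of "Z w"] qB[of "Z w"] e that by (auto simp: indicator_def)
    qed
    show "integrable M (\<lambda>w. e + 2 * B * indicator ?A w)"
      using intA by simp
  qed (use int in auto)
  also have "\<dots> = e + 2 * B * prob ?A" using intA by (simp add: prob_space)
  finally show ?thesis .
qed

lemma (in prob_space) Re_char_eq: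
  fixes Z :: "'a \<Rightarrow> 'b::euclidean_space"
  assumes [measurable]: "random_variable borel Z"
  shows "Re (iexp c * (\<integral>w. iexp (a \<bullet> Z w) \<partial>M)) = (\<integral>w. cos (a \<bullet> Z w + c) \<partial>M)"
proof -
  have re: "Re (iexp c * iexp t) = cos (t + c)" for t
    by (simp add: Re_exp mult_exp_exp flip: distrib_left of_real_add) (simp add: add.commute)
  have i: "integrable M (\<lambda>w. iexp (a \<bullet> Z w))" by (intro integrable_iexp) auto
  have "Re (iexp c * (\<integral>w. iexp (a \<bullet> Z w) \<partial>M)) = Re (\<integral>w. iexp c * iexp (a \<bullet> Z w) \<partial>M)" by simp
  also have "\<dots> = (\<integral>w. Re (iexp c * iexp (a \<bullet> Z w)) \<partial>M)" using i by (intro integral_Re[symmetric]) auto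
  finally show ?thesis unfolding re .
qed

text \<open>
  Tightness reduces a bounded continuous function to its values on a large ball, where it is close to a
  trigonometric polynomial with a comparable global bound; integrals of trigonometric polynomials converge because
  characteristic functions do.
\<close>
theorem (in prob_space) levy_cramer_continuity:
  fixes Z :: "nat \<Rightarrow> 'a \<Rightarrow> 'b::euclidean_space" and N :: "'b measure"
  assumes Z [measurable]: "\<And>n. random_variable borel (Z n)"
    and N: "prob_space N" "sets N = sets borel"
    and tight: "bounded_in_probability M Z"
    and char: "\<And>a. (\<lambda>n. \<integral>w. iexp (a \<bullet> Z n w) \<partial>M) \<longlonglongrightarrow> (\<integral>x. iexp (a \<bullet> x) \<partial>N)"
  shows "converges_in_distribution M Z N"
proof -
  interpret N: prob_space N by (rule N(1))
  note [measurable_cong] = N(2)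
  have id: "(\<lambda>x. x) \<in> borel_measurable N" by simp
  have cos_lim: "(\<lambda>n. \<integral>w. cos (a \<bullet> Z n w + c) \<partial>M) \<longlonglongrightarrow> (\<integral>x. cos (a \<bullet> x + c) \<partial>N)" for a c
    using tendsto_Re[OF tendsto_mult[OF tendsto_const[of "iexp c"] char[of a]]]
    unfolding Re_char_eq[OF Z] N.Re_char_eq[OF id] .
  have trig_lim: "(\<lambda>n. \<integral>w. q (Z n w) \<partial>M) \<longlonglongrightarrow> (\<integral>x. q x \<partial>N)" if "trig_poly q" for q
    using that
  proof (induction rule: trig_poly.induct)
    case (trig_cos a c)
    show ?case by (rule cos_lim)
  next
    case (trig_add f g)
    have i: "integrable M (\<lambda>w. h (Z n w))" "integrable N h" if h: "trig_poly h" for h n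
    proof -
      have [measurable]: "h \<in> borel_measurable borel" by (rule trig_poly_measurable[OF h])
      obtain B where "\<And>x. \<bar>h x\<bar> \<le> B" using trig_poly_bounded[OF h] by auto
      then show "integrable M (\<lambda>w. h (Z n w))" "integrable N h"
        by (auto intro!: integrable_const_bound[where B = B] N.integrable_const_bound[where B = B])
    qed
    show ?case using tendsto_add[OF trig_add.IH] by (simp add: i trig_add.hyps)
  next
    case (trig_scale f c)
    show ?case using tendsto_mult_left[OF trig_scale.IH, of c] by simp
  qed
  have "(\<lambda>n. \<integral>w. f (Z n w) \<partial>M) \<longlonglongrightarrow> (\<integral>x. f x \<partial>N)"
    if f: "continuous_on UNIV f" and bd: "bounded (range f)" for f :: "'b \<Rightarrow> real"
  proof (rule tendstoI)
    fix e :: real assume e: "e > 0"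
    obtain B where B: "\<And>x. \<bar>f x\<bar> \<le> B" using bd by (auto simp: bounded_iff)
    have B0: "B \<ge> 0" using B[of undefined] abs_ge_zero[of "f undefined"] by linarith
    have [measurable]: "f \<in> borel_measurable borel" by (intro borel_measurable_continuous_onI f)
    define d where "d = min 1 (e / (8 * (1 + 2 * (B + 1))))"
    have d: "d > 0" "d \<le> 1" using e B0 by (auto simp: d_def)
    have d': "2 * (d + 2 * (B + 1) * d) < e / 2"
    proof -
      have "d * (1 + 2 * (B + 1)) \<le> e / 8"
      proof -
        have "d \<le> e / (8 * (1 + 2 * (B + 1)))" by (simp add: d_def)
        then show ?thesis using B0 by (simp add: field_simps)
      qed
      then show ?thesis using e by (simp add: algebra_simps)
    qed
    obtain K1 where K1: "\<forall>\<^sub>F n in sequentially. \<P>(w in M. norm (Z n w) > K1) < d"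
      using tight d unfolding bounded_in_probability_def by blast
    have "(\<lambda>k. N.prob {x\<in>space N. norm x > real k}) \<longlonglongrightarrow> N.prob (\<Inter>k. {x\<in>space N. norm x > real k})"
      by (intro N.finite_Lim_measure_decseq) (auto simp: decseq_def)
    moreover have "(\<Inter>k. {x\<in>space N. norm x > real k}) = {}"
    proof safe
      fix x assume "x \<in> (\<Inter>k. {x\<in>space N. norm x > real k})"
      moreover obtain k where "norm x \<le> real k" using real_arch_simple by blast
      ultimately show "x \<in> {}" by (auto simp: not_less[symmetric])
    qed
    ultimately have "\<forall>\<^sub>F k in sequentially. N.prob {x\<in>space N. norm x > real k} < d"
      using d by (auto dest: order_tendstoD)
    then obtain K2 :: nat where K2: "N.prob {x\<in>space N. norm x > real K2} < d"
      by (auto simp: eventually_sequentially)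
    define K where "K = max 1 (max K1 (real K2))"
    have K: "K > 0" "K1 \<le> K" "real K2 \<le> K" by (auto simp: K_def)
    obtain q where q: "trig_poly q" "\<And>x. \<bar>q x\<bar> \<le> B + d" "\<And>x. norm x \<le> K \<Longrightarrow> \<bar>f x - q x\<bar> \<le> d"
      using trig_poly_approximation[OF f B K(1) d(1)] by blast
    have [measurable]: "q \<in> borel_measurable borel" by (rule trig_poly_measurable[OF q(1)])
    have qB: "\<bar>q x\<bar> \<le> B + 1" and fB: "\<bar>f x\<bar> \<le> B + 1" for x using q(2)[of x] B[of x] d by auto
    have N_close: "\<bar>(\<integral>x. f x \<partial>N) - (\<integral>x. q x \<partial>N)\<bar> \<le> d + 2 * (B + 1) * d"
    proof -
      have "\<bar>(\<integral>x. f x \<partial>N) - (\<integral>x. q x \<partial>N)\<bar> \<le> d + 2 * (B + 1) * N.prob {x\<in>space N. norm x > K}"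
        using d by (intro N.integral_close_if_close_on_ball[where Z = "\<lambda>x. x", OF _ _ _ fB qB q(3)]) auto
      also have "N.prob {x\<in>space N. norm x > K} \<le> N.prob {x\<in>space N. norm x > real K2}"
        using K by (intro N.finite_measure_mono) auto
      finally show ?thesis using K2 B0 by (smt (verit, best) mult_left_mono)
    qed
    have q_lim: "\<forall>\<^sub>F n in sequentially. dist (\<integral>w. q (Z n w) \<partial>M) (\<integral>x. q x \<partial>N) < e / 2"
      using tendstoD[OF trig_lim[OF q(1)], of "e / 2"] e by simp
    have tri: "\<bar>a - b\<bar> < e" if "\<bar>a - a'\<bar> \<le> r" "\<bar>b - b'\<bar> \<le> r" "\<bar>a' - b'\<bar> < e / 2" "2 * r < e / 2" for a b a' b' r :: real
      using that by linarith
    from K1 q_lim show "\<forall>\<^sub>F n in sequentially. dist (\<integral>w. f (Z n w) \<partial>M) (\<integral>x. f x \<partial>N) < e"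
    proof eventually_elim
      case (elim n)
      have "\<bar>(\<integral>w. f (Z n w) \<partial>M) - (\<integral>w. q (Z n w) \<partial>M)\<bar> \<le> d + 2 * (B + 1) * \<P>(w in M. norm (Z n w) > K)"
        using d by (intro integral_close_if_close_on_ball[OF _ _ _ fB qB q(3)]) auto
      also have "\<P>(w in M. norm (Z n w) > K) \<le> \<P>(w in M. norm (Z n w) > K1)"
        using K by (intro finite_measure_mono) auto
      finally have "\<bar>(\<integral>w. f (Z n w) \<partial>M) - (\<integral>w. q (Z n w) \<partial>M)\<bar> \<le> d + 2 * (B + 1) * d"
        using elim(1) B0 by (smt (verit, best) mult_left_mono)
      from tri[OF this N_close elim(2)[unfolded dist_real_def] d'] show ?case by (simp add: dist_real_def)
    qed
  qed
  then show ?thesis unfolding converges_in_distribution_def using Z by auto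
qed

section \<open>Linear change of variables for Lebesgue measure\<close>

text \<open>
  For fixed values of the other coordinates a shear is a translation in direction \<open>i\<close>, so the innermost of the
  iterated integrals is unchanged.
\<close>
lemma nn_integral_lborel_shear:
  fixes h :: "'b::euclidean_space \<Rightarrow> ennreal"
  assumes h [measurable]: "h \<in> borel_measurable borel" and ij: "i \<in> Basis" "j \<in> Basis" "i \<noteq> j"
  shows "(\<integral>\<^sup>+x. h (x + (t * (x \<bullet> j)) *\<^sub>R i) \<partial>lborel) = (\<integral>\<^sup>+x. h x \<partial>lborel)"
proof -
  interpret product_sigma_finite "\<lambda>_::'b. lborel :: real measure" by unfold_locales
  define I where "I = Basis - {i}"
  have I: "finite I" "i \<notin> I" "Basis = insert i I" "j \<in> I" using ij by (auto simp: I_def)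
  define R where "R f = (\<Sum>b\<in>Basis. f b *\<^sub>R b)" for f :: "'b \<Rightarrow> real"
  have R [measurable]: "R \<in> (\<Pi>\<^sub>M b\<in>Basis. lborel) \<rightarrow>\<^sub>M borel" unfolding R_def by measurable
  have split: "(\<integral>\<^sup>+x. k x \<partial>lborel) = (\<integral>\<^sup>+f. (\<integral>\<^sup>+y. k (y *\<^sub>R i + (\<Sum>b\<in>I. f b *\<^sub>R b)) \<partial>lborel) \<partial>(\<Pi>\<^sub>M b\<in>I. lborel))"
    if [measurable]: "k \<in> borel_measurable borel" for k :: "'b \<Rightarrow> ennreal"
  proof -
    have upd: "R (f(i := y)) = y *\<^sub>R i + (\<Sum>b\<in>I. f b *\<^sub>R b)" for f y
    proof -
      have "(\<Sum>b\<in>I. (f(i := y)) b *\<^sub>R b) = (\<Sum>b\<in>I. f b *\<^sub>R b)" using I by (intro sum.cong) auto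
      then show ?thesis unfolding R_def I(3) using I(1,2) by simp
    qed
    have "(\<integral>\<^sup>+x. k x \<partial>lborel) = (\<integral>\<^sup>+f. k (R f) \<partial>(\<Pi>\<^sub>M b\<in>Basis. lborel))"
      by (subst lborel_eq) (simp add: nn_integral_distr R_def)
    also have "\<dots> = (\<integral>\<^sup>+f. (\<integral>\<^sup>+y. k (R (f(i := y))) \<partial>lborel) \<partial>(\<Pi>\<^sub>M b\<in>I. lborel))"
      unfolding I(3) by (rule product_nn_integral_insert) (use I in \<open>auto simp flip: I(3)\<close>)
    also have "\<dots> = (\<integral>\<^sup>+f. (\<integral>\<^sup>+y. k (y *\<^sub>R i + (\<Sum>b\<in>I. f b *\<^sub>R b)) \<partial>lborel) \<partial>(\<Pi>\<^sub>M b\<in>I. lborel))"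
      unfolding upd ..
    finally show ?thesis .
  qed
  have j: "(y *\<^sub>R i + (\<Sum>b\<in>I. f b *\<^sub>R b)) \<bullet> j = f j" for y f
  proof -
    have "(\<Sum>b\<in>I. f b *\<^sub>R b) \<bullet> j = (\<Sum>b\<in>I. if b = j then f j else 0)"
      unfolding inner_sum_left using ij I by (intro sum.cong) (auto simp: inner_Basis I_def)
    also have "\<dots> = f j" using I by simp
    finally show ?thesis using ij by (simp add: inner_add_left inner_Basis)
  qed
  have arg: "(y *\<^sub>R i + (\<Sum>b\<in>I. f b *\<^sub>R b)) + (t * ((y *\<^sub>R i + (\<Sum>b\<in>I. f b *\<^sub>R b)) \<bullet> j)) *\<^sub>R i
      = (t * f j + 1 * y) *\<^sub>R i + (\<Sum>b\<in>I. f b *\<^sub>R b)" for y f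
    unfolding j by (simp add: algebra_simps)
  have "(\<integral>\<^sup>+x. h (x + (t * (x \<bullet> j)) *\<^sub>R i) \<partial>lborel)
      = (\<integral>\<^sup>+f. (\<integral>\<^sup>+y. h ((t * f j + 1 * y) *\<^sub>R i + (\<Sum>b\<in>I. f b *\<^sub>R b)) \<partial>lborel) \<partial>(\<Pi>\<^sub>M b\<in>I. lborel))"
    using split[of "\<lambda>x. h (x + (t * (x \<bullet> j)) *\<^sub>R i)"] unfolding arg by simp
  also have "\<dots> = (\<integral>\<^sup>+f. (\<integral>\<^sup>+y. h (y *\<^sub>R i + (\<Sum>b\<in>I. f b *\<^sub>R b)) \<partial>lborel) \<partial>(\<Pi>\<^sub>M b\<in>I. lborel))"
  proof (rule nn_integral_cong)
    fix f
    show "(\<integral>\<^sup>+y. h ((t * f j + 1 * y) *\<^sub>R i + (\<Sum>b\<in>I. f b *\<^sub>R b)) \<partial>lborel)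
        = (\<integral>\<^sup>+y. h (y *\<^sub>R i + (\<Sum>b\<in>I. f b *\<^sub>R b)) \<partial>lborel)"
      using nn_integral_real_affine[of "\<lambda>y. h (y *\<^sub>R i + (\<Sum>b\<in>I. f b *\<^sub>R b))" 1 "t * f j"] by simp
  qed
  also have "\<dots> = (\<integral>\<^sup>+x. h x \<partial>lborel)" by (rule split[symmetric]) simp
  finally show ?thesis .
qed

lemma prod_Basis_vec: "(\<Prod>b\<in>(Basis :: (real^'n) set). g b) = (\<Prod>i\<in>UNIV. g (axis i 1))"
proof -
  have eq: "(Basis :: (real^'n) set) = range (\<lambda>i. axis i 1)" by (auto simp: Basis_vec_def)
  show ?thesis
    unfolding eq by (subst prod.reindex) (auto simp: inj_on_def axis_eq_axis)
qed

lemma nn_integral_lborel_transpose_coordinates: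
  fixes m n :: "'n::finite" and h :: "real^'n \<Rightarrow> ennreal"
  defines "\<tau> \<equiv> Transposition.transpose m n"
  assumes h [measurable]: "h \<in> borel_measurable borel"
  shows "(\<integral>\<^sup>+x. h (\<chi> i. x $ \<tau> i) \<partial>lborel) = (\<integral>\<^sup>+x. h x \<partial>lborel)"
proof -
  let ?s = "\<lambda>x :: real^'n. \<chi> i. x $ \<tau> i"
  have s [measurable]: "?s \<in> borel_measurable borel"
    by (intro borel_measurable_continuous_onI continuous_intros)
  have "lborel = distr lborel borel ?s"
  proof (rule lborel_eqI)
    fix l u :: "real^'n" assume le: "\<And>b. b \<in> Basis \<Longrightarrow> l \<bullet> b \<le> u \<bullet> b"
    have le': "l $ i \<le> u $ i" for i using le[of "axis i 1"] by (auto simp: inner_axis Basis_vec_def)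
    have inv: "\<tau> (\<tau> i) = i" for i by (simp add: \<tau>_def)
    have "?s -` box l u = box (?s l) (?s u)"
      unfolding set_eq_iff vimage_def mem_box_cart mem_Collect_eq by (simp, metis inv)
    then have "emeasure (distr lborel borel ?s) (box l u) = emeasure lborel (box (?s l) (?s u))"
      by (simp add: emeasure_distr)
    also have "\<dots> = (\<Prod>b\<in>Basis. (?s u - ?s l) \<bullet> b)"
      by (rule emeasure_lborel_box) (auto simp: Basis_vec_def inner_axis le')
    also have "(\<Prod>b\<in>Basis. (?s u - ?s l) \<bullet> b) = (\<Prod>i\<in>UNIV. (u - l) $ \<tau> i)"
      by (simp add: prod_Basis_vec inner_axis)
    also have "\<dots> = (\<Prod>i\<in>UNIV. (u - l) $ i)"
      by (rule prod.reindex_bij_betw[of \<tau> UNIV UNIV "\<lambda>i. (u - l) $ i"]) (rule o_bij[of \<tau>]; simp add: fun_eq_iff inv)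
    also have "\<dots> = (\<Prod>b\<in>Basis. (u - l) \<bullet> b)" by (simp add: prod_Basis_vec inner_axis)
    finally show "emeasure (distr lborel borel ?s) (box l u) = (\<Prod>b\<in>Basis. (u - l) \<bullet> b)" .
  qed simp
  then have "(\<integral>\<^sup>+x. h x \<partial>lborel) = (\<integral>\<^sup>+x. h x \<partial>distr lborel borel ?s)" by simp
  then show ?thesis by (simp add: nn_integral_distr)
qed

lemma matrix_vector_mult_measurable [measurable]: "(\<lambda>x. (A :: real^'n^'m) *v x) \<in> borel_measurable borel"
  by (intro borel_measurable_continuous_onI linear_continuous_on) (simp add: matrix_vector_mul_bounded_linear)

text \<open>
  The formula is stable under products of matrices and holds for diagonal matrices, transpositions and
  shears, which generate the invertible matrices.
\<close>
theorem nn_integral_lborel_linear: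
  fixes A :: "real^'n^'n" and h :: "real^'n \<Rightarrow> ennreal"
  assumes "det A \<noteq> 0" "h \<in> borel_measurable borel"
  shows "ennreal \<bar>det A\<bar> * (\<integral>\<^sup>+x. h (A *v x) \<partial>lborel) = (\<integral>\<^sup>+x. h x \<partial>lborel)"
proof -
  define P where "P A \<longleftrightarrow> (det A \<noteq> 0 \<longrightarrow> (\<forall>h\<in>borel_measurable borel.
    ennreal \<bar>det A\<bar> * (\<integral>\<^sup>+x. h (A *v x) \<partial>lborel) = (\<integral>\<^sup>+x. h x \<partial>lborel)))" for A :: "real^'n^'n"
  have "P A"
  proof (induction A rule: induct_matrix_elementary)
    case (1 A B)
    show "P (A ** B)"
      unfolding P_def
    proof (intro impI ballI)
      assume "det (A ** B) \<noteq> 0"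
      then have d: "det A \<noteq> 0" "det B \<noteq> 0" by (auto simp: det_mul)
      fix h :: "real^'n \<Rightarrow> ennreal" assume [measurable]: "h \<in> borel_measurable borel"
      have "ennreal \<bar>det (A ** B)\<bar> * (\<integral>\<^sup>+x. h ((A ** B) *v x) \<partial>lborel)
          = ennreal \<bar>det A\<bar> * (ennreal \<bar>det B\<bar> * (\<integral>\<^sup>+x. h (A *v (B *v x)) \<partial>lborel))"
        by (simp add: det_mul abs_mult ennreal_mult mult.assoc matrix_vector_mul_assoc)
      also have "ennreal \<bar>det B\<bar> * (\<integral>\<^sup>+x. h (A *v (B *v x)) \<partial>lborel) = (\<integral>\<^sup>+x. h (A *v x) \<partial>lborel)"
        using 1(2) d unfolding P_def by (auto dest!: bspec[where x = "\<lambda>x. h (A *v x)"])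
      also have "ennreal \<bar>det A\<bar> * \<dots> = (\<integral>\<^sup>+x. h x \<partial>lborel)"
        using 1(1) d unfolding P_def by auto
      finally show "ennreal \<bar>det (A ** B)\<bar> * (\<integral>\<^sup>+x. h ((A ** B) *v x) \<partial>lborel) = (\<integral>\<^sup>+x. h x \<partial>lborel)" .
    qed
  next
    case (2 A i)
    then show ?case by (simp add: P_def det_zero_row)
  next
    case (3 A)
    have det: "det A = (\<Prod>i\<in>UNIV. A $ i $ i)" using 3 by (rule det_diagonal)
    show ?case
      unfolding P_def
    proof (intro impI ballI)
      assume "det A \<noteq> 0"
      then have nz: "A $ i $ i \<noteq> 0" for i by (simp add: det)
      fix h :: "real^'n \<Rightarrow> ennreal" assume [measurable]: "h \<in> borel_measurable borel"
      define c where "c b = (A *v b) \<bullet> b" for b :: "real^'n"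
      have c: "c (axis i 1) = A $ i $ i" for i
        by (simp add: c_def inner_axis matrix_vector_mult_basis column_def)
      have Av: "A *v x = 0 + (\<Sum>j\<in>Basis. (c j * (x \<bullet> j)) *\<^sub>R j)" for x
      proof (rule euclidean_eqI)
        fix b :: "real^'n" assume "b \<in> Basis"
        then obtain i where b: "b = axis i 1" by (auto simp: Basis_vec_def)
        have "(A *v x) $ i = (\<Sum>j\<in>UNIV. A $ i $ j * x $ j)" by (simp add: matrix_vector_mult_def)
        also have "\<dots> = (\<Sum>j\<in>UNIV. if j = i then A $ i $ i * x $ i else 0)"
          using 3 by (intro sum.cong) auto
        finally have "(A *v x) $ i = A $ i $ i * x $ i" by simp
        moreover have "(0 + (\<Sum>j\<in>Basis. (c j * (x \<bullet> j)) *\<^sub>R j)) \<bullet> b = c b * (x \<bullet> b)"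
          using \<open>b \<in> Basis\<close> by simp
        ultimately show "(A *v x) \<bullet> b = (0 + (\<Sum>j\<in>Basis. (c j * (x \<bullet> j)) *\<^sub>R j)) \<bullet> b"
          by (simp only:) (simp add: inner_axis c b)
      qed
      have "(\<Prod>j\<in>Basis. \<bar>c j\<bar>) = \<bar>det A\<bar>" by (simp add: prod_Basis_vec c det abs_prod)
      then have "lborel = density (distr lborel borel (\<lambda>x. A *v x)) (\<lambda>_. ennreal \<bar>det A\<bar>)"
        unfolding Av using nz by (subst lborel_affine_euclidean[of c 0]) (auto simp: Basis_vec_def c)
      then have "(\<integral>\<^sup>+x. h x \<partial>lborel) = (\<integral>\<^sup>+x. h x \<partial>density (distr lborel borel (\<lambda>x. A *v x)) (\<lambda>_. ennreal \<bar>det A\<bar>))"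
        by simp
      also have "\<dots> = ennreal \<bar>det A\<bar> * (\<integral>\<^sup>+x. h (A *v x) \<partial>lborel)"
        by (simp add: nn_integral_density nn_integral_distr nn_integral_cmult)
      finally show "ennreal \<bar>det A\<bar> * (\<integral>\<^sup>+x. h (A *v x) \<partial>lborel) = (\<integral>\<^sup>+x. h x \<partial>lborel)" by simp
    qed
  next
    case (4 m n)
    let ?A = "\<chi> i j. (mat 1 :: real^'n^'n) $ i $ Transposition.transpose m n j"
    have det: "\<bar>det ?A\<bar> = 1"
      by (subst det_permute_columns) (auto simp: permutes_swap_id sign_def)
    have "?A *v x = (\<chi> i. x $ Transposition.transpose m n i)" for x
    proof -
      have eq: "(i = Transposition.transpose m n j) = (j = Transposition.transpose m n i)" for i j
        by (metis transpose_involutory)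
      have "(\<Sum>j\<in>UNIV. if i = Transposition.transpose m n j then x $ j else 0) = x $ Transposition.transpose m n i" for i
        unfolding eq by simp
      then show ?thesis
        by (simp add: vec_eq_iff matrix_vector_mult_def mat_def if_distrib[of "\<lambda>c. c * _"] cong: if_cong)
    qed
    then show ?case
      unfolding P_def using det by (auto simp: nn_integral_lborel_transpose_coordinates)
  next
    case (5 m n c)
    let ?A = "(\<chi> i j. if i = m \<and> j = n then c else of_bool (i = j)) :: real^'n^'n"
    have "?A = (\<chi> k. if k = m then row m (mat 1) + c *s row n (mat 1) else row k (mat 1))"
      using 5 by (auto simp: vec_eq_iff row_def mat_def)
    then have det: "det ?A = 1" using det_row_operation[OF 5, of "mat 1 :: real^'n^'n" c] by simp
    have "?A *v x = x + (c * (x \<bullet> axis n 1)) *\<^sub>R axis m 1" for x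
    proof -
      have "(?A *v x) $ i = (\<Sum>j\<in>UNIV. (if j = i then x $ i else 0) + (if j = n then (if i = m then c * x $ n else 0) else 0))" for i
        unfolding matrix_vector_mult_def using 5 by (auto intro!: sum.cong)
      moreover have "x \<bullet> axis n 1 = x $ n" by (simp add: inner_axis)
      ultimately show ?thesis by (simp only: vec_eq_iff sum.distrib) (simp add: axis_def)
    qed
    then show ?case
      unfolding P_def using 5 det
      by (auto intro!: nn_integral_lborel_shear simp: axis_eq_axis Basis_vec_def)
  qed
  then show ?thesis using assms by (auto simp: P_def)
qed

section \<open>The multivariate normal distribution\<close>

lemma symmetric_matrix_inner: "transpose S = S \<Longrightarrow> (x :: real^'n) \<bullet> (S *v y) = (S *v x) \<bullet> y"
  by (metis dot_lmul_matrix vector_transpose_matrix)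

text \<open>
  A set that is orthonormal for the inner product \<open>x \<bullet> S y\<close> is linearly independent, so there is one of maximal
  cardinality. It spans the space: otherwise the Gram-Schmidt step enlarges it.
\<close>
lemma positive_definite_orthonormal_basis:
  fixes S :: "real^'n^'n"
  assumes sym: "transpose S = S" and pos: "\<And>x. x \<noteq> 0 \<Longrightarrow> x \<bullet> (S *v x) > 0"
  obtains b :: "'n \<Rightarrow> real^'n" where "\<And>i j. b i \<bullet> (S *v b j) = (if i = j then 1 else 0)"
proof -
  define ON where "ON B \<longleftrightarrow> finite B \<and> (\<forall>x\<in>B. \<forall>y\<in>B. x \<bullet> (S *v y) = (if x = y then 1 else 0))" for B
  have coeff: "x \<bullet> (S *v (\<Sum>y\<in>B. c y *\<^sub>R y)) = c x" if "ON B" "x \<in> B" for B x and c :: "real^'n \<Rightarrow> real"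
  proof -
    have "x \<bullet> (S *v (\<Sum>y\<in>B. c y *\<^sub>R y)) = (\<Sum>y\<in>B. c y * (x \<bullet> (S *v y)))"
      by (simp add: linear_sum[OF matrix_vector_mul_linear] inner_sum_right matrix_vector_mult_scaleR)
    also have "\<dots> = (\<Sum>y\<in>B. if y = x then c x else 0)"
      using that by (intro sum.cong) (auto simp: ON_def)
    finally show ?thesis using that by (simp add: ON_def)
  qed
  have indep: "independent B" if "ON B" for B
  proof (rule notI)
    assume dep: "dependent B"
    have "finite B" using that by (simp add: ON_def)
    then have "\<exists>c. (\<exists>x\<in>B. c x \<noteq> 0) \<and> (\<Sum>y\<in>B. c y *\<^sub>R y) = 0"
      using dep by (simp add: dependent_finite)
    then obtain c x where "(\<Sum>y\<in>B. c y *\<^sub>R y) = 0" "x \<in> B" "c x \<noteq> 0" by blast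
    then show False using coeff[OF that, of x c] by simp
  qed
  have "card B \<le> CARD('n)" if "ON B" for B
    using independent_bound[OF indep[OF that]] by simp
  moreover have "ON {}" by (simp add: ON_def)
  ultimately obtain B where B: "ON B" and max: "\<And>B'. ON B' \<Longrightarrow> card B' \<le> card B"
    using ex_has_greatest_nat[of ON "{}" card "CARD('n) + 1"] by (auto simp: less_Suc_eq_le)
  have "span B = UNIV"
  proof (rule ccontr)
    assume "span B \<noteq> UNIV"
    then obtain x where x: "x \<notin> span B" by auto
    define p where "p = (\<Sum>y\<in>B. (y \<bullet> (S *v x)) *\<^sub>R y)"
    define z where "z = x - p"
    have "p \<in> span B" unfolding p_def by (intro span_sum span_scale span_base)
    then have "z \<noteq> 0" using x by (auto simp: z_def)
    then have zz: "z \<bullet> (S *v z) > 0" by (rule pos)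
    define u where "u = (1 / sqrt (z \<bullet> (S *v z))) *\<^sub>R z"
    have uu: "u \<bullet> (S *v u) = 1" using zz by (simp add: u_def matrix_vector_mult_scaleR flip: power2_eq_square)
    have "y \<bullet> (S *v z) = 0" if "y \<in> B" for y
      using coeff[OF B that, of "\<lambda>y. y \<bullet> (S *v x)"] by (simp add: z_def p_def matrix_vector_mult_diff_distrib inner_diff_right)
    then have yu: "y \<bullet> (S *v u) = 0" if "y \<in> B" for y using that by (simp add: u_def matrix_vector_mult_scaleR)
    then have uy: "u \<bullet> (S *v y) = 0" if "y \<in> B" for y
      using that symmetric_matrix_inner[OF sym, of u y] by (simp add: inner_commute)
    have "u \<notin> B" using yu uu by force
    moreover have "ON (insert u B)" using B uu yu uy \<open>u \<notin> B\<close> by (auto simp: ON_def)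
    ultimately show False using max[of "insert u B"] B by (simp add: ON_def)
  qed
  then have "card B = CARD('n)"
    using basis_card_eq_dim[of B UNIV] indep[OF B] by (simp add: dim_UNIV)
  then obtain b where b: "bij_betw b (UNIV :: 'n set) B"
    using finite_same_card_bij[of "UNIV :: 'n set" B] B by (auto simp: ON_def)
  show ?thesis
  proof (rule that[of b])
    show "b i \<bullet> (S *v b j) = (if i = j then 1 else 0)" for i j
      using B bij_betwE[OF b] bij_betw_imp_inj_on[OF b] by (auto simp: ON_def inj_on_def)
  qed
qed

text \<open>
  If the columns of \<open>C\<close> are orthonormal for \<open>x \<bullet> S y\<close>, then \<open>C\<^sup>T S C = 1\<close>, and the transpose of \<open>C\<^sup>-\<^sup>1\<close> is the factor
  sought.
\<close>
lemma positive_definite_factorization: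
  fixes S :: "real^'n^'n"
  assumes sym: "transpose S = S" and pos: "\<And>x. x \<noteq> 0 \<Longrightarrow> x \<bullet> (S *v x) > 0"
  obtains B where "S = B ** transpose B" "det B \<noteq> 0"
proof -
  obtain b :: "'n \<Rightarrow> real^'n" where b: "\<And>i j. b i \<bullet> (S *v b j) = (if i = j then 1 else 0)"
    using positive_definite_orthonormal_basis[OF sym pos] by metis
  define C where "C = (\<chi> i j. b j $ i)"
  have col: "column j C = b j" for j by (simp add: C_def column_def vec_eq_iff)
  have row: "row i (transpose C) = b i" for i by (simp add: row_transpose col)
  have "(transpose C ** (S ** C)) $ i $ j = b i \<bullet> (S *v b j)" for i j
  proof -
    have "column j (S ** C) = S *v b j"
      by (simp add: column_def matrix_matrix_mult_def matrix_vector_mult_def vec_eq_iff flip: col)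
    moreover have "(transpose C ** (S ** C)) $ i $ j = row i (transpose C) \<bullet> column j (S ** C)"
      by (simp add: matrix_matrix_mult_def row_def column_def inner_vec_def)
    ultimately show ?thesis by (simp only: row)
  qed
  then have I: "transpose C ** (S ** C) = mat 1"
    by (simp add: vec_eq_iff b mat_def)
  then have "det C * (det S * det C) = 1"
    by (metis det_mul det_transpose det_I)
  then have dC: "det C \<noteq> 0" by auto
  then obtain D where D: "C ** D = mat 1" "D ** C = mat 1"
    using invertible_det_nz[of C] by (auto simp: invertible_def)
  have D': "transpose D ** transpose C = mat 1"
    by (metis D(1) matrix_transpose_mul transpose_mat)
  have "transpose D ** D = transpose D ** (transpose C ** (S ** C)) ** D" unfolding I by simp
  also have "\<dots> = (transpose D ** transpose C) ** S ** (C ** D)" by (simp add: matrix_mul_assoc)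
  also have "\<dots> = S" by (simp add: D D')
  finally have "S = transpose D ** transpose (transpose D)" by simp
  moreover have "det (transpose D) \<noteq> 0"
    using D(1) by (metis det_I det_mul det_transpose mult_zero_right zero_neq_one)
  ultimately show ?thesis by (rule that)
qed

definition std_normal_vec :: "(real^'n) measure" where
  "std_normal_vec = density lborel (\<lambda>z. ennreal (\<Prod>b\<in>Basis. std_normal_density (z \<bullet> b)))"

lemma sets_std_normal_vec [simp, measurable_cong]: "sets std_normal_vec = sets borel"
  by (simp add: std_normal_vec_def)

lemma prob_space_std_normal_vec: "prob_space (std_normal_vec :: (real^'n) measure)"
proof
  have "emeasure (std_normal_vec :: (real^'n) measure) (space std_normal_vec)
      = (\<integral>\<^sup>+z. (\<Prod>b\<in>(Basis :: (real^'n) set). ennreal (std_normal_density (z \<bullet> b))) \<partial>lborel)"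
    unfolding std_normal_vec_def by (subst emeasure_density) (auto simp: prod_ennreal)
  also have "\<dots> = (\<Prod>b\<in>(Basis :: (real^'n) set). (\<integral>\<^sup>+x. ennreal (std_normal_density x) \<partial>lborel))"
    by (rule nn_integral_lborel_prod) auto
  also have "(\<integral>\<^sup>+x. ennreal (std_normal_density x) \<partial>lborel) = 1"
    by (subst nn_integral_eq_integral) (auto simp: integrable_normal_density integral_normal_density)
  finally show "emeasure (std_normal_vec :: (real^'n) measure) (space std_normal_vec) = 1" by simp
qed

lemma char_std_normal_vec:
  fixes a :: "real^'n"
  shows "(\<integral>z. iexp (a \<bullet> z) \<partial>std_normal_vec) = of_real (exp (- (a \<bullet> a) / 2))"
proof -
  interpret product_sigma_finite "\<lambda>_::real^'n. lborel :: real measure" by unfold_locales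
  let ?f = "\<lambda>b x. std_normal_density x *\<^sub>R iexp ((a \<bullet> b) * x)"
  have "(\<integral>z. iexp (a \<bullet> z) \<partial>std_normal_vec)
      = (\<integral>z. (\<Prod>b\<in>Basis. std_normal_density (z \<bullet> b)) *\<^sub>R iexp (a \<bullet> z) \<partial>lborel)"
    unfolding std_normal_vec_def by (rule integral_density) (auto intro!: prod_nonneg)
  also have "\<dots> = (\<integral>z. (\<Prod>b\<in>Basis. ?f b (z \<bullet> b)) \<partial>lborel)"
  proof (intro Bochner_Integration.integral_cong refl)
    fix z :: "real^'n"
    have "iexp (a \<bullet> z) = (\<Prod>b\<in>Basis. iexp ((a \<bullet> b) * (z \<bullet> b)))"
      by (subst euclidean_inner) (simp add: exp_sum sum_distrib_left)
    then show "(\<Prod>b\<in>Basis. std_normal_density (z \<bullet> b)) *\<^sub>R iexp (a \<bullet> z) = (\<Prod>b\<in>Basis. ?f b (z \<bullet> b))"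
      by (simp add: prod.distrib scaleR_conv_of_real)
  qed
  also have "\<dots> = (\<integral>f. (\<Prod>b\<in>Basis. ?f b ((\<Sum>b\<in>Basis. f b *\<^sub>R b) \<bullet> b)) \<partial>(\<Pi>\<^sub>M b\<in>Basis. lborel))"
    by (subst lborel_eq, subst integral_distr) auto
  also have "\<dots> = (\<integral>f. (\<Prod>b\<in>Basis. ?f b (f b)) \<partial>(\<Pi>\<^sub>M b\<in>(Basis :: (real^'n) set). lborel))"
    by (intro Bochner_Integration.integral_cong refl prod.cong) simp
  also have "\<dots> = (\<Prod>b\<in>Basis. (\<integral>x. ?f b x \<partial>lborel))"
    by (rule product_integral_prod) (auto intro!: Bochner_Integration.integrable_bound[OF integrable_normal_density[of 1 0]])
  also have "\<dots> = (\<Prod>b\<in>Basis. char std_normal_distribution (a \<bullet> b))"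
    unfolding char_def by (subst integral_density) auto
  also have "\<dots> = (\<Prod>b\<in>Basis. of_real (exp (- (a \<bullet> b)\<^sup>2 / 2)))"
    by (simp add: char_std_normal_distribution)
  also have "\<dots> = of_real (exp (\<Sum>b\<in>Basis. - (a \<bullet> b)\<^sup>2 / 2))"
    by (simp add: exp_sum)
  also have "(\<Sum>b\<in>Basis. - (a \<bullet> b)\<^sup>2 / 2) = - (a \<bullet> a) / 2"
    by (subst (2) euclidean_inner) (simp add: power2_eq_square sum_negf sum_divide_distrib)
  finally show ?thesis .
qed

lemma std_normal_vec_density_eq:
  "(\<Prod>b\<in>Basis. std_normal_density ((z :: real^'n) \<bullet> b)) = exp (- (z \<bullet> z) / 2) / sqrt ((2 * pi) ^ CARD('n))"
proof -
  have "(\<Prod>b\<in>Basis. std_normal_density (z \<bullet> b)) = (1 / sqrt (2 * pi)) ^ CARD('n) * exp (\<Sum>b\<in>Basis. - (z \<bullet> b)\<^sup>2 / 2)"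
    by (simp add: std_normal_density_def prod_dividef prod.distrib exp_sum power_one_over divide_simps)
  also have "(\<Sum>b\<in>Basis. - (z \<bullet> b)\<^sup>2 / 2) = - (z \<bullet> z) / 2"
    by (subst (2) euclidean_inner) (simp add: power2_eq_square sum_negf sum_divide_distrib)
  finally show ?thesis by (simp only: power_one_over real_sqrt_power mult_1 times_divide_eq_left)
qed

lemma matrix_inv_eq: "A ** B = mat 1 \<Longrightarrow> matrix_inv (A :: real^'n^'n) = B"
  unfolding matrix_inv_def
  by (rule some_equality) (metis matrix_left_right_inverse matrix_mul_assoc matrix_mul_lid matrix_mul_rid)+

text \<open>
  With \<open>x = B z\<close> the quadratic form \<open>x \<bullet> (B B\<^sup>T)\<^sup>-\<^sup>1 x\<close> becomes \<open>z \<bullet> z\<close>, and the factor \<open>\<bar>det B\<bar>\<close> in the normalization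
  is the one from the change of variables.
\<close>
lemma multivariate_normal_linear_image:
  fixes B :: "real^'n^'n"
  assumes B: "det B \<noteq> 0"
  shows "multivariate_normal 0 (B ** transpose B) = distr std_normal_vec borel (\<lambda>z. B *v z)"
proof (rule measure_eqI)
  let ?S = "B ** transpose B"
  let ?d = "\<lambda>x. exp (- ((x - 0) \<bullet> (matrix_inv ?S *v (x - 0))) / 2) / sqrt ((2 * pi) ^ CARD('n) * det ?S)"
  obtain D where D: "B ** D = mat 1" "D ** B = mat 1"
    using B invertible_det_nz[of B] by (auto simp: invertible_def)
  have "?S ** (transpose D ** D) = B ** transpose (D ** B) ** D" by (simp add: matrix_transpose_mul matrix_mul_assoc)
  also have "\<dots> = mat 1" by (simp add: D)
  finally have inv: "matrix_inv ?S = transpose D ** D" by (rule matrix_inv_eq)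
  have quad: "(B *v z) \<bullet> (matrix_inv ?S *v (B *v z)) = z \<bullet> z" for z
  proof -
    have "(B *v z) \<bullet> (matrix_inv ?S *v (B *v z)) = (B *v z) \<bullet> (transpose D *v z)"
      unfolding inv by (simp add: matrix_vector_mul_assoc matrix_mul_assoc[symmetric] D)
    also have "\<dots> = (D *v (B *v z)) \<bullet> z" by (metis dot_lmul_matrix vector_transpose_matrix transpose_transpose)
    finally show ?thesis by (simp add: matrix_vector_mul_assoc D)
  qed
  have det: "sqrt ((2 * pi) ^ CARD('n) * det ?S) = sqrt ((2 * pi) ^ CARD('n)) * \<bar>det B\<bar>"
    by (simp add: det_mul real_sqrt_mult)
  have dens: "\<bar>det B\<bar> * ?d (B *v z) = (\<Prod>b\<in>Basis. std_normal_density (z \<bullet> b))" for z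
    unfolding det std_normal_vec_density_eq using B quad by simp
  have dm: "?d \<in> borel_measurable borel" by measurable
  fix A assume "A \<in> sets (multivariate_normal 0 ?S)"
  then have A [measurable]: "A \<in> sets borel" by (simp add: multivariate_normal_def)
  have "emeasure (multivariate_normal 0 ?S) A = (\<integral>\<^sup>+x. ennreal (?d x) * indicator A x \<partial>lborel)"
    unfolding multivariate_normal_def using dm by (subst emeasure_density) auto
  also have "\<dots> = ennreal \<bar>det B\<bar> * (\<integral>\<^sup>+z. ennreal (?d (B *v z)) * indicator A (B *v z) \<partial>lborel)"
    using dm by (intro nn_integral_lborel_linear[OF B, symmetric]) auto
  also have "\<dots> = (\<integral>\<^sup>+z. ennreal (\<bar>det B\<bar> * ?d (B *v z)) * indicator A (B *v z) \<partial>lborel)"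
  proof (subst nn_integral_cmult[symmetric])
    have "(\<lambda>z. ?d (B *v z)) \<in> borel_measurable borel" by (rule measurable_compose[OF matrix_vector_mult_measurable dm])
    then show "(\<lambda>z. ennreal (?d (B *v z)) * indicator A (B *v z)) \<in> borel_measurable lborel" by simp
    show "(\<integral>\<^sup>+z. ennreal \<bar>det B\<bar> * (ennreal (?d (B *v z)) * indicator A (B *v z)) \<partial>lborel)
        = (\<integral>\<^sup>+z. ennreal (\<bar>det B\<bar> * ?d (B *v z)) * indicator A (B *v z) \<partial>lborel)"
      by (rule nn_integral_cong) (simp only: ennreal_mult'[OF abs_ge_zero] mult.assoc)
  qed
  also have "\<dots> = (\<integral>\<^sup>+z. ennreal (\<Prod>b\<in>Basis. std_normal_density (z \<bullet> b)) * indicator ((\<lambda>z. B *v z) -` A) z \<partial>lborel)"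
    unfolding dens by (simp add: indicator_def)
  also have "\<dots> = emeasure std_normal_vec ((\<lambda>z. B *v z) -` A)"
    unfolding std_normal_vec_def using measurable_sets[OF matrix_vector_mult_measurable A, of B]
    by (subst emeasure_density) (auto simp: space_borel)
  also have "\<dots> = emeasure (distr std_normal_vec borel (\<lambda>z. B *v z)) A"
    by (subst emeasure_distr) (auto simp: std_normal_vec_def)
  finally show "emeasure (multivariate_normal 0 ?S) A = emeasure (distr std_normal_vec borel (\<lambda>z. B *v z)) A" .
qed (simp add: multivariate_normal_def)

theorem
  fixes S :: "real^'n^'n"
  assumes sym: "transpose S = S" and pos: "\<And>x. x \<noteq> 0 \<Longrightarrow> x \<bullet> (S *v x) > 0"
  shows prob_space_multivariate_normal: "prob_space (multivariate_normal 0 S)"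
    and char_multivariate_normal: "(\<integral>x. iexp (a \<bullet> x) \<partial>multivariate_normal 0 S) = of_real (exp (- (a \<bullet> (S *v a)) / 2))"
proof -
  obtain B where S: "S = B ** transpose B" and B: "det B \<noteq> 0"
    using positive_definite_factorization[OF sym pos] by metis
  note eq = multivariate_normal_linear_image[OF B, folded S]
  have m: "(\<lambda>z. B *v z) \<in> std_normal_vec \<rightarrow>\<^sub>M borel" by measurable
  show "prob_space (multivariate_normal 0 S)"
    unfolding eq by (rule prob_space.prob_space_distr[OF prob_space_std_normal_vec m])
  have "(\<integral>x. iexp (a \<bullet> x) \<partial>multivariate_normal 0 S) = (\<integral>z. iexp (a \<bullet> (B *v z)) \<partial>std_normal_vec)"
    unfolding eq by (rule integral_distr[OF m]) measurable
  also have "\<dots> = (\<integral>z. iexp ((transpose B *v a) \<bullet> z) \<partial>std_normal_vec)"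
    by (metis dot_lmul_matrix vector_transpose_matrix transpose_transpose)
  also have "\<dots> = of_real (exp (- ((transpose B *v a) \<bullet> (transpose B *v a)) / 2))"
    by (rule char_std_normal_vec)
  also have "(transpose B *v a) \<bullet> (transpose B *v a) = a \<bullet> (S *v a)"
    unfolding S matrix_vector_mul_assoc[symmetric]
    by (metis dot_lmul_matrix vector_transpose_matrix transpose_transpose)
  finally show "(\<integral>x. iexp (a \<bullet> x) \<partial>multivariate_normal 0 S) = of_real (exp (- (a \<bullet> (S *v a)) / 2))" .
qed

section \<open>Matrices: measurability and quadratic forms\<close>

lemma borel_measurable_vecI:
  fixes f :: "'a \<Rightarrow> 'b::euclidean_space^'n"
  assumes "\<And>i. (\<lambda>x. f x $ i) \<in> borel_measurable M"
  shows "f \<in> borel_measurable M"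
proof -
  have "(\<lambda>x. f x \<bullet> b) \<in> borel_measurable M" if b: "b \<in> Basis" for b
  proof -
    obtain i u where b: "b = axis i u" using b by (auto simp: Basis_vec_def)
    show ?thesis using borel_measurable_inner[OF assms[of i] borel_measurable_const[of u]] by (simp add: b inner_axis)
  qed
  then show ?thesis by (subst borel_measurable_euclidean_space) auto
qed

lemma borel_measurable_vec_nth [measurable (raw)]:
  fixes f :: "'a \<Rightarrow> 'b::real_normed_vector^'n"
  assumes "f \<in> borel_measurable M"
  shows "(\<lambda>x. f x $ i) \<in> borel_measurable M"
  by (rule borel_measurable_continuous_on[OF _ assms]) (intro continuous_intros)

lemma borel_measurable_det:
  fixes A :: "'a \<Rightarrow> real^'n^'n"
  assumes [measurable]: "A \<in> borel_measurable M"
  shows "(\<lambda>x. det (A x)) \<in> borel_measurable M"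
  unfolding det_def by measurable

lemma borel_measurable_matrix_vector_mult:
  fixes A :: "'a \<Rightarrow> real^'n^'m"
  assumes [measurable]: "A \<in> borel_measurable M" "b \<in> borel_measurable M"
  shows "(\<lambda>x. A x *v b x) \<in> borel_measurable M"
  by (rule borel_measurable_vecI) (simp add: matrix_vector_mult_def)

lemma matrix_inv_inverse:
  assumes "invertible (A :: real^'n^'n)"
  shows "A ** matrix_inv A = mat 1" "matrix_inv A ** A = mat 1"
  using someI_ex[of "\<lambda>A'. A ** A' = mat 1 \<and> A' ** A = mat 1"] assms
  by (auto simp: matrix_inv_def invertible_def)

text \<open>
  Cramer's rule where the determinant does not vanish. At a singular matrix the predicate in the definition of
  \<open>matrix_inv\<close> is unsatisfiable, whichever matrix it is, so that the chosen value is one and the same constant.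
\<close>
lemma borel_measurable_matrix_inv_mult:
  fixes A :: "'a \<Rightarrow> real^'n^'n"
  assumes [measurable]: "A \<in> borel_measurable M" "b \<in> borel_measurable M"
  shows "(\<lambda>x. matrix_inv (A x) *v b x) \<in> borel_measurable M"
proof -
  \<comment> \<open>the common value of \<open>matrix_inv\<close> at all singular matrices\<close>
  define C0 where "C0 = (SOME A' :: real^'n^'n. False)"
  have sing: "matrix_inv B = C0" if "det B = 0" for B :: "real^'n^'n"
  proof -
    have "\<not> (B ** A' = mat 1 \<and> A' ** B = mat 1)" for A'
      using that invertible_det_nz[of B] by (auto simp: invertible_def)
    then have "(\<lambda>A'. B ** A' = mat 1 \<and> A' ** B = mat 1) = (\<lambda>_. False)" by blast
    then show ?thesis unfolding matrix_inv_def C0_def by simp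
  qed
  have reg: "matrix_inv B *v c = (\<chi> k. det (\<chi> i j. if j = k then c $ i else B $ i $ j) / det B)"
    if "det B \<noteq> 0" for B :: "real^'n^'n" and c
  proof -
    have "B *v (matrix_inv B *v c) = c"
      using matrix_inv_inverse[of B] that by (simp add: matrix_vector_mul_assoc invertible_det_nz)
    then show ?thesis using cramer[OF that] by blast
  qed
  have eq: "(\<lambda>x. matrix_inv (A x) *v b x) = (\<lambda>x. if det (A x) = 0 then C0 *v b x
      else (\<chi> k. det (\<chi> i j. if j = k then b x $ i else A x $ i $ j) / det (A x)))"
    by (auto simp: sing reg)
  have [measurable]: "(\<lambda>x. det (A x)) \<in> borel_measurable M" by (rule borel_measurable_det) simp
  have [measurable]: "(\<lambda>x. C0 *v b x) \<in> borel_measurable M" by (rule borel_measurable_matrix_vector_mult) auto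
  have "(\<lambda>x. det (\<chi> i j. if j = k then b x $ i else A x $ i $ j)) \<in> borel_measurable M" for k
  proof (intro borel_measurable_det borel_measurable_vecI)
    show "(\<lambda>x. (\<chi> i j. if j = k then b x $ i else A x $ i $ j) $ i' $ j') \<in> borel_measurable M" for i' j'
      by (cases "j' = k") auto
  qed
  then have [measurable]: "(\<lambda>x. \<chi> k. det (\<chi> i j. if j = k then b x $ i else A x $ i $ j) / det (A x)) \<in> borel_measurable M"
    by (intro borel_measurable_vecI) auto
  show ?thesis unfolding eq by measurable
qed

lemma norm_matrix_vector_mult_le:
  fixes A :: "real^'n^'m"
  shows "norm (A *v x) \<le> norm A * norm x"
proof -
  have "norm (A *v x) = L2_set (\<lambda>i. norm (A $ i \<bullet> x)) UNIV"
    by (simp add: norm_vec_def matrix_vector_mul_component)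
  also have "\<dots> \<le> L2_set (\<lambda>i. norm (A $ i) * norm x) UNIV"
    by (intro L2_set_mono) (auto simp: Cauchy_Schwarz_ineq2)
  also have "\<dots> = norm A * norm x" by (simp add: norm_vec_def L2_set_left_distrib[symmetric])
  finally show ?thesis .
qed

lemma norm_outer_product: "norm (outer_product x y) = norm x * norm y"
proof -
  have "norm (outer_product x y $ i) = norm (x $ i) * norm y" for i
  proof -
    have "outer_product x y $ i = x $ i *\<^sub>R y" by (simp add: outer_product_def vec_eq_iff)
    then show ?thesis by simp
  qed
  then have "norm (outer_product x y) = L2_set (\<lambda>i. norm (x $ i) * norm y) UNIV"
    by (simp add: norm_vec_def)
  also have "\<dots> = norm x * norm y" by (simp add: norm_vec_def[of x] L2_set_left_distrib[symmetric])
  finally show ?thesis .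
qed

lemma outer_product_mult_vec: "outer_product x y *v v = (y \<bullet> v) *\<^sub>R x"
  by (simp add: outer_product_def matrix_vector_mult_def vec_eq_iff inner_vec_def sum_distrib_left mult_ac)

lemma outer_product_scaleR: "outer_product (c *\<^sub>R x) (d *\<^sub>R y) = (c * d) *\<^sub>R outer_product x y"
  by (simp add: outer_product_def vec_eq_iff)

lemma matrix_vector_mult_sum_left: "(\<Sum>k\<in>I. A k) *v (v :: real^'n) = (\<Sum>k\<in>I. A k *v v)"
  by (induction I rule: infinite_finite_induct) (auto simp: matrix_vector_mult_add_rdistrib)

lemma borel_measurable_outer_product:
  fixes f :: "'a \<Rightarrow> real^'n" and g :: "'a \<Rightarrow> real^'m"
  assumes [measurable]: "f \<in> borel_measurable M" "g \<in> borel_measurable M"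
  shows "(\<lambda>x. outer_product (f x) (g x)) \<in> borel_measurable M"
  by (intro borel_measurable_vecI) (simp add: outer_product_def)

lemma bounded_linear_quadratic_form: "bounded_linear (\<lambda>G :: real^'n^'n. a \<bullet> (G *v b))"
proof (rule bounded_linear_intro[where K = "norm a * norm b"])
  show "norm (a \<bullet> (G *v b)) \<le> norm G * (norm a * norm b)" for G :: "real^'n^'n"
    using order_trans[OF Cauchy_Schwarz_ineq2[of a "G *v b"] mult_left_mono[OF norm_matrix_vector_mult_le norm_ge_zero]]
    by (simp add: mult_ac)
qed (simp_all add: matrix_vector_mult_add_rdistrib inner_add_right scaleR_matrix_vector_assoc[symmetric])

lemma quadratic_form_outer: "a \<bullet> (outer_product v v *v a) = (a \<bullet> v)\<^sup>2" for a v :: "real^'n"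
  by (simp add: outer_product_mult_vec power2_eq_square inner_commute)

lemma coercive_perturbation:
  fixes G A :: "real^'n^'n"
  assumes G: "\<And>x. x \<bullet> (G *v x) \<ge> c * (norm x)\<^sup>2" and d: "norm (A - G) \<le> d"
  shows "x \<bullet> (A *v x) \<ge> (c - d) * (norm x)\<^sup>2"
proof -
  have "\<bar>x \<bullet> ((A - G) *v x)\<bar> \<le> norm x * norm ((A - G) *v x)" by (rule Cauchy_Schwarz_ineq2)
  also have "\<dots> \<le> norm x * (d * norm x)"
    by (intro mult_left_mono order_trans[OF norm_matrix_vector_mult_le] mult_right_mono d) auto
  finally have "\<bar>x \<bullet> ((A - G) *v x)\<bar> \<le> d * (norm x)\<^sup>2" by (simp add: power2_eq_square mult_ac)
  then show ?thesis using G[of x]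
    by (simp add: matrix_vector_mult_diff_rdistrib inner_diff_right algebra_simps)
qed

lemma coercive_norm_le:
  fixes A :: "real^'n^'n"
  assumes "x \<bullet> (A *v x) \<ge> c * (norm x)\<^sup>2"
  shows "c * norm x \<le> norm (A *v x)"
proof (cases "x = 0")
  case False
  have "c * norm x * norm x \<le> norm (A *v x) * norm x"
    using assms norm_cauchy_schwarz[of x "A *v x"] by (simp add: power2_eq_square mult_ac)
  then show ?thesis using False by simp
qed simp

lemma positive_definite_invertible:
  fixes A :: "real^'n^'n"
  assumes "\<And>x. x \<noteq> 0 \<Longrightarrow> x \<bullet> (A *v x) > 0"
  shows "invertible A"
  unfolding invertible_left_inverse matrix_left_invertible_ker
  using assms by (metis inner_zero_right less_irrefl)

text \<open>The quadratic form attains its minimum on the unit sphere.\<close>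
lemma positive_definite_coercive:
  fixes A :: "real^'n^'n"
  assumes pos: "\<And>x. x \<noteq> 0 \<Longrightarrow> x \<bullet> (A *v x) > 0"
  obtains c where "c > 0" "\<And>x. x \<bullet> (A *v x) \<ge> c * (norm x)\<^sup>2"
proof -
  let ?S = "sphere (0 :: real^'n) 1"
  have cont: "continuous_on ?S (\<lambda>x. x \<bullet> (A *v x))"
    by (intro continuous_intros linear_continuous_on) (simp add: matrix_vector_mul_bounded_linear)
  have "axis undefined 1 \<in> ?S" by simp
  then have "?S \<noteq> {}" by blast
  from continuous_attains_inf[OF compact_sphere this cont]
  obtain m where m: "m \<in> ?S" "\<forall>y\<in>?S. m \<bullet> (A *v m) \<le> y \<bullet> (A *v y)" by (elim bexE)
  show ?thesis
  proof (rule that[of "m \<bullet> (A *v m)"])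
    show "m \<bullet> (A *v m) > 0" using m(1) by (intro pos) auto
    show "x \<bullet> (A *v x) \<ge> m \<bullet> (A *v m) * (norm x)\<^sup>2" for x
    proof (cases "x = 0")
      case False
      then have "(1 / norm x) *\<^sub>R x \<in> ?S" by simp
      from bspec[OF m(2) this] False show ?thesis
        by (simp add: matrix_vector_mult_scaleR power2_eq_square field_simps)
    qed simp
  qed
qed

section \<open>Convergence in probability\<close>

context prob_space
begin

lemma bounded_in_probability_of_first_moment:
  fixes Z :: "nat \<Rightarrow> 'a \<Rightarrow> 'b::euclidean_space"
  assumes Z: "\<And>n. integrable M (\<lambda>w. norm (Z n w))" and c: "\<And>n. (\<integral>w. norm (Z n w) \<partial>M) \<le> c"
  shows "bounded_in_probability M Z"
  unfolding bounded_in_probability_def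
proof (intro allI impI)
  fix e :: real assume e: "e > 0"
  have "0 \<le> (\<integral>w. norm (Z 0 w) \<partial>M)" by (intro integral_nonneg_AE) auto
  then have c0: "c \<ge> 0" using c[of 0] by linarith
  define K where "K = (c + 1) / e"
  have K: "K > 0" using c0 e by (simp add: K_def)
  have "\<P>(w in M. norm (Z n w) > K) < e" for n
  proof -
    have [measurable]: "(\<lambda>w. norm (Z n w)) \<in> borel_measurable M" using Z by blast
    have "\<P>(w in M. norm (Z n w) > K) \<le> \<P>(w in M. norm (Z n w) \<ge> K)"
      by (intro finite_measure_mono) auto
    also have "\<dots> \<le> (\<integral>w. norm (Z n w) \<partial>M) / K"
      by (rule integral_Markov_inequality_measure[OF Z sets.empty_sets _ K]) auto
    also have "\<dots> \<le> c / K" using c K by (intro divide_right_mono) auto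
    also have "\<dots> < e" using c0 e by (simp add: K_def field_simps)
    finally show ?thesis .
  qed
  then show "\<exists>K. \<forall>\<^sub>F n in sequentially. \<P>(w in M. norm (Z n w) > K) < e"
    by (intro exI[of _ K] always_eventually allI)
qed

lemma AE_tendsto_zero_imp_in_probability:
  fixes Z :: "nat \<Rightarrow> 'a \<Rightarrow> 'b::euclidean_space"
  assumes [measurable]: "\<And>n. random_variable borel (Z n)" and lim: "AE w in M. (\<lambda>n. Z n w) \<longlonglongrightarrow> 0" and e: "e > 0"
  shows "(\<lambda>n. \<P>(w in M. norm (Z n w) > e)) \<longlonglongrightarrow> 0"
proof -
  have "(\<lambda>n. \<integral>w. indicator {w\<in>space M. norm (Z n w) > e} w \<partial>M) \<longlonglongrightarrow> (\<integral>w. (0 :: real) \<partial>M)"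
  proof (rule integral_dominated_convergence[where w = "\<lambda>_. 1"])
    show "AE w in M. (\<lambda>n. indicator {w\<in>space M. norm (Z n w) > e} w :: real) \<longlonglongrightarrow> 0"
      using lim
    proof eventually_elim
      case (elim w)
      from order_tendstoD(2)[OF tendsto_norm_zero[OF elim] e]
      show ?case by (intro tendsto_eventually) (auto elim!: eventually_mono simp: indicator_def)
    qed
  qed (auto simp: indicator_def)
  then show ?thesis by simp
qed

lemma second_moment_tendsto_zero_imp_in_probability:
  fixes Z :: "nat \<Rightarrow> 'a \<Rightarrow> 'b::euclidean_space"
  assumes Z: "\<And>n. integrable M (\<lambda>w. (norm (Z n w))\<^sup>2)" and lim: "(\<lambda>n. \<integral>w. (norm (Z n w))\<^sup>2 \<partial>M) \<longlonglongrightarrow> 0" and e: "e > 0"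
    and [measurable]: "\<And>n. random_variable borel (Z n)"
  shows "(\<lambda>n. \<P>(w in M. norm (Z n w) > e)) \<longlonglongrightarrow> 0"
proof (rule tendsto_sandwich[OF _ _ tendsto_const tendsto_divide_zero[OF lim, of "e\<^sup>2"]])
  have "\<P>(w in M. norm (Z n w) > e) \<le> (\<integral>w. (norm (Z n w))\<^sup>2 \<partial>M) / e\<^sup>2" for n
  proof -
    have "\<P>(w in M. norm (Z n w) > e) \<le> \<P>(w in M. (norm (Z n w))\<^sup>2 \<ge> e\<^sup>2)"
      using e by (intro finite_measure_mono) (auto intro: power_mono)
    also have "\<dots> \<le> (\<integral>w. (norm (Z n w))\<^sup>2 \<partial>M) / e\<^sup>2"
      using e by (intro integral_Markov_inequality_measure[OF Z sets.empty_sets]) auto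
    finally show ?thesis .
  qed
  then show "\<forall>\<^sub>F n in sequentially. \<P>(w in M. norm (Z n w) > e) \<le> (\<integral>w. (norm (Z n w))\<^sup>2 \<partial>M) / e\<^sup>2" by simp
qed simp

lemma bounded_in_probability_perturb:
  fixes Y Z :: "nat \<Rightarrow> 'a \<Rightarrow> 'b::euclidean_space"
  assumes [measurable]: "\<And>n. random_variable borel (Y n)" "\<And>n. random_variable borel (Z n)"
    and Y: "bounded_in_probability M Y"
    and diff: "(\<lambda>n. \<P>(w in M. norm (Z n w - Y n w) > 1)) \<longlonglongrightarrow> 0"
  shows "bounded_in_probability M Z"
  unfolding bounded_in_probability_def
proof (intro allI impI)
  fix e :: real assume e: "e > 0"
  obtain K where K: "\<forall>\<^sub>F n in sequentially. \<P>(w in M. norm (Y n w) > K) < e / 2"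
    using Y e unfolding bounded_in_probability_def by (meson half_gt_zero)
  have "\<forall>\<^sub>F n in sequentially. \<P>(w in M. norm (Z n w - Y n w) > 1) < e / 2"
    using order_tendstoD(2)[OF diff, of "e / 2"] e by simp
  with K have "\<forall>\<^sub>F n in sequentially. \<P>(w in M. norm (Z n w) > K + 1) < e"
  proof eventually_elim
    case (elim n)
    have "norm (Z n w) \<le> norm (Z n w - Y n w) + norm (Y n w)" for w
      using norm_triangle_ineq[of "Z n w - Y n w" "Y n w"] by simp
    then have "{w\<in>space M. norm (Z n w) > K + 1} \<subseteq> {w\<in>space M. norm (Z n w - Y n w) > 1} \<union> {w\<in>space M. norm (Y n w) > K}"
      by (auto simp: not_less) (smt (verit, best))
    then have "\<P>(w in M. norm (Z n w) > K + 1)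
        \<le> prob ({w\<in>space M. norm (Z n w - Y n w) > 1} \<union> {w\<in>space M. norm (Y n w) > K})"
      by (intro finite_measure_mono) auto
    also have "\<dots> \<le> \<P>(w in M. norm (Z n w - Y n w) > 1) + \<P>(w in M. norm (Y n w) > K)"
      by (intro measure_Un_le) auto
    finally show ?case using elim by linarith
  qed
  then show "\<exists>K. \<forall>\<^sub>F n in sequentially. \<P>(w in M. norm (Z n w) > K) < e" by blast
qed

text \<open>
  The map \<open>x \<mapsto> exp (i a \<bullet> x)\<close> is bounded and Lipschitz, so the two characteristic functions differ by at most
  \<open>norm a * d\<close> plus twice the probability that the variables are more than \<open>d\<close> apart.
\<close>
lemma slutsky_char:
  fixes Y Z :: "nat \<Rightarrow> 'a \<Rightarrow> 'b::euclidean_space"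
  assumes [measurable]: "\<And>n. random_variable borel (Y n)" "\<And>n. random_variable borel (Z n)"
    and diff: "\<And>e. e > 0 \<Longrightarrow> (\<lambda>n. \<P>(w in M. norm (Z n w - Y n w) > e)) \<longlonglongrightarrow> 0"
    and Y: "(\<lambda>n. \<integral>w. iexp (a \<bullet> Y n w) \<partial>M) \<longlonglongrightarrow> c"
  shows "(\<lambda>n. \<integral>w. iexp (a \<bullet> Z n w) \<partial>M) \<longlonglongrightarrow> c"
proof -
  have int: "integrable M (\<lambda>w. iexp (a \<bullet> Y n w))" "integrable M (\<lambda>w. iexp (a \<bullet> Z n w))" for n
    by (auto intro!: integrable_iexp)
  have lip: "cmod (iexp x - iexp y) \<le> \<bar>x - y\<bar>" for x y :: real
  proof -
    have "iexp x - iexp y = iexp y * (iexp (x - y) - 1)"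
      by (simp add: algebra_simps exp_add[symmetric] of_real_diff)
    then have "cmod (iexp x - iexp y) = cmod (iexp (x - y) - 1)" by (simp add: norm_mult)
    also have "\<dots> \<le> \<bar>x - y\<bar>" using iexp_approx1[of "x - y" 0] by simp
    finally show ?thesis .
  qed
  have "(\<lambda>n. (\<integral>w. iexp (a \<bullet> Z n w) \<partial>M) - (\<integral>w. iexp (a \<bullet> Y n w) \<partial>M)) \<longlonglongrightarrow> 0"
  proof (rule tendstoI)
    fix e :: real assume e: "e > 0"
    define d where "d = e / (2 * (norm a + 1))"
    have d: "d > 0" using e by (simp add: d_def add_nonneg_pos)
    have ad: "norm a * d \<le> e / 2"
    proof -
      have "norm a * d \<le> (norm a + 1) * d" using d by (intro mult_right_mono) auto
      also have "(norm a + 1) * d = e / 2" unfolding d_def using norm_ge_zero[of a] by (simp add: field_simps add_nonneg_eq_0_iff)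
      finally show ?thesis .
    qed
    have "\<forall>\<^sub>F n in sequentially. \<P>(w in M. norm (Z n w - Y n w) > d) < e / 4"
      using order_tendstoD(2)[OF diff[OF d], of "e / 4"] e by simp
    then show "\<forall>\<^sub>F n in sequentially. dist ((\<integral>w. iexp (a \<bullet> Z n w) \<partial>M) - (\<integral>w. iexp (a \<bullet> Y n w) \<partial>M)) 0 < e"
    proof eventually_elim
      case (elim n)
      let ?A = "{w\<in>space M. norm (Z n w - Y n w) > d}"
      let ?D = "\<lambda>w. iexp (a \<bullet> Z n w) - iexp (a \<bullet> Y n w)"
      have intA: "integrable M (indicator ?A :: 'a \<Rightarrow> real)"
        by (intro integrable_real_indicator) (auto simp: less_top[symmetric])
      have "cmod ((\<integral>w. iexp (a \<bullet> Z n w) \<partial>M) - (\<integral>w. iexp (a \<bullet> Y n w) \<partial>M)) = cmod (\<integral>w. ?D w \<partial>M)"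
        using int by simp
      also have "\<dots> \<le> (\<integral>w. cmod (?D w) \<partial>M)" by (rule integral_norm_bound)
      also have "\<dots> \<le> (\<integral>w. e / 2 + 2 * indicator ?A w \<partial>M)"
      proof (rule integral_mono)
        show "integrable M (\<lambda>w. cmod (?D w))" using int by (intro integrable_norm Bochner_Integration.integrable_diff)
        show "integrable M (\<lambda>w. e / 2 + 2 * indicator ?A w)" using intA by simp
        fix w assume w: "w \<in> space M"
        show "cmod (?D w) \<le> e / 2 + 2 * indicator ?A w"
        proof (cases "w \<in> ?A")
          case True
          have "cmod (?D w) \<le> 1 + 1"
            by (rule order_trans[OF norm_triangle_ineq4]) simp
          then show ?thesis using True e by simp
        next
          case False
          then have le: "norm (Z n w - Y n w) \<le> d" using w by simp
          have "cmod (?D w) \<le> \<bar>a \<bullet> Z n w - a \<bullet> Y n w\<bar>" by (rule lip)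
          also have "\<dots> = \<bar>a \<bullet> (Z n w - Y n w)\<bar>" by (simp add: inner_diff_right)
          also have "\<dots> \<le> norm a * norm (Z n w - Y n w)" by (rule Cauchy_Schwarz_ineq2)
          also have "\<dots> \<le> norm a * d" using le by (intro mult_left_mono) auto
          finally show ?thesis using ad False by simp
        qed
      qed
      also have "\<dots> = e / 2 + 2 * prob ?A" using intA by (simp add: prob_space)
      finally show ?case using elim by simp
    qed
  qed
  from tendsto_add[OF this Y] show ?thesis by simp
qed

end

section \<open>Perturbation of the weights in a linear regression\<close>

lemma inverse_square_bounds:
  fixes x :: real
  assumes x: "\<bar>x\<bar> \<le> 1 / 2"
  shows "\<bar>1 / (1 + x)\<^sup>2 - 1\<bar> \<le> 10 * \<bar>x\<bar>" and "\<bar>1 / (1 + x)\<^sup>2 - 1 + 2 * x\<bar> \<le> 16 * x\<^sup>2"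
proof -
  have "1 + x \<ge> 1 / 2" using x by linarith
  then have "(1 + x)\<^sup>2 \<ge> (1 / 2)\<^sup>2" by (intro power_mono) auto
  then have q: "(1 + x)\<^sup>2 \<ge> 1 / 4" by (simp add: power2_eq_square)
  then have pos: "(1 + x)\<^sup>2 > 0" by linarith
  have div: "\<bar>y / (1 + x)\<^sup>2\<bar> \<le> 4 * b" if "\<bar>y\<bar> \<le> b" for y b
  proof -
    have "b \<ge> 0" using that by linarith
    then have "b * 1 \<le> b * (4 * (1 + x)\<^sup>2)" using q by (intro mult_left_mono) auto
    then show ?thesis using that pos by (simp add: abs_divide divide_le_eq mult_ac)
  qed
  have x2: "x\<^sup>2 \<le> \<bar>x\<bar> / 2" using mult_left_mono[OF x abs_ge_zero[of x]] by (simp add: power2_eq_square flip: abs_mult)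
  have "1 / (1 + x)\<^sup>2 - 1 = (- (2 * x) - x\<^sup>2) / (1 + x)\<^sup>2"
    using pos by (simp add: field_simps power2_eq_square)
  moreover have "\<bar>- (2 * x) - x\<^sup>2\<bar> \<le> 5 / 2 * \<bar>x\<bar>"
  proof -
    have "\<bar>- (2 * x) - x\<^sup>2\<bar> \<le> 2 * \<bar>x\<bar> + x\<^sup>2"
      using abs_triangle_ineq4[of "- (2 * x)" "x\<^sup>2"] by simp
    then show ?thesis using x2 by linarith
  qed
  ultimately show "\<bar>1 / (1 + x)\<^sup>2 - 1\<bar> \<le> 10 * \<bar>x\<bar>"
    using div[of "- (2 * x) - x\<^sup>2" "5 / 2 * \<bar>x\<bar>"] by simp
  have "1 / (1 + x)\<^sup>2 - 1 + 2 * x = (3 + 2 * x) * x\<^sup>2 / (1 + x)\<^sup>2"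
    using pos by (simp add: field_simps power2_eq_square)
  moreover have "\<bar>(3 + 2 * x) * x\<^sup>2\<bar> \<le> 4 * x\<^sup>2"
  proof -
    have "\<bar>3 + 2 * x\<bar> \<le> 4" using x by linarith
    then show ?thesis by (simp add: abs_mult mult_right_mono)
  qed
  ultimately show "\<bar>1 / (1 + x)\<^sup>2 - 1 + 2 * x\<bar> \<le> 16 * x\<^sup>2"
    using div[of "(3 + 2 * x) * x\<^sup>2" "4 * x\<^sup>2"] by simp
qed

lemma norm_average_le:
  fixes f :: "nat \<Rightarrow> 'b::real_normed_vector"
  assumes "\<And>k. k < n \<Longrightarrow> norm (f k) \<le> b" "n > 0"
  shows "norm ((1 / real n) *\<^sub>R (\<Sum>k<n. f k)) \<le> b"
proof -
  have "norm (\<Sum>k<n. f k) \<le> real n * b"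
    using sum_norm_bound[of "{..<n}" f b] assms(1) by simp
  then show ?thesis using assms(2) by (simp add: divide_le_eq mult.commute)
qed

text \<open>
  The deterministic side of the estimator: in the application \<open>r\<close> and \<open>\<eta>\<close> are one realization of the
  standardized regressors and of the noise. Because \<open>\<theta>\<^sub>0 \<bullet> r k = 1\<close>, the response \<open>1 + \<eta> k\<close> equals
  \<open>\<theta>\<^sub>0 \<bullet> r k + \<eta> k\<close>.
\<close>
locale weighted_regression =
  fixes n :: nat and r :: "nat \<Rightarrow> real^'m" and \<eta> :: "nat \<Rightarrow> real" and \<theta>\<^sub>0 :: "real^'m" and C :: real
  assumes n: "n > 0" and r_bound: "\<And>k. norm (r k) \<le> C" and r_unit: "\<And>k. \<theta>\<^sub>0 \<bullet> r k = 1"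
begin

definition A0 where "A0 = (1 / real n) *\<^sub>R (\<Sum>k<n. outer_product (r k) (r k))"
definition W0 where "W0 = (1 / sqrt (real n)) *\<^sub>R (\<Sum>k<n. \<eta> k *\<^sub>R r k)"
definition N0 where "N0 = (1 / real n) *\<^sub>R (\<Sum>k<n. \<eta> k *\<^sub>R outer_product (r k) (r k))"
definition E0 where "E0 = (1 / real n) * (\<Sum>k<n. \<bar>\<eta> k\<bar>)"
text \<open>In the application, the factor \<open>\<sigma>\<^sub>t\<^sup>4(\<theta>\<^sub>0) / \<sigma>\<^sub>t\<^sup>4(\<theta>)\<close>, since \<open>\<sigma>\<^sub>t\<^sup>2(\<theta>) = \<sigma>\<^sub>t\<^sup>2(\<theta>\<^sub>0) (1 + (\<theta> - \<theta>\<^sub>0) \<bullet> r\<^sub>t)\<close>.\<close>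
definition wt where "wt \<theta> k = 1 / (1 + (\<theta> - \<theta>\<^sub>0) \<bullet> r k)\<^sup>2"

context
  fixes \<theta> :: "real^'m" and K :: real
  assumes K: "norm (sqrt (real n) *\<^sub>R (\<theta> - \<theta>\<^sub>0)) \<le> K" and small: "K * C / sqrt (real n) \<le> 1 / 2"
begin

lemma C_nonneg: "C \<ge> 0" using r_bound[of 0] norm_ge_zero order_trans by blast

lemma K_nonneg: "K \<ge> 0" using K norm_ge_zero order_trans by blast

lemma deviation_bound: "\<bar>(\<theta> - \<theta>\<^sub>0) \<bullet> r k\<bar> \<le> K * C / sqrt (real n)"
proof -
  have "sqrt (real n) * norm (\<theta> - \<theta>\<^sub>0) \<le> K" using K by (simp only: norm_scaleR) simp
  then have le: "norm (\<theta> - \<theta>\<^sub>0) \<le> K / sqrt (real n)" using n by (simp add: pos_le_divide_eq mult.commute)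
  have "\<bar>(\<theta> - \<theta>\<^sub>0) \<bullet> r k\<bar> \<le> norm (\<theta> - \<theta>\<^sub>0) * norm (r k)" by (rule Cauchy_Schwarz_ineq2)
  also have "\<dots> \<le> (K / sqrt (real n)) * C"
    using le K_nonneg r_bound[of k] by (intro mult_mono) auto
  finally show ?thesis by simp
qed

lemma deviation_le_half: "\<bar>(\<theta> - \<theta>\<^sub>0) \<bullet> r k\<bar> \<le> 1 / 2"
  using deviation_bound[of k] small by linarith

lemma weighted_matrix_close:
  "norm ((1 / real n) *\<^sub>R (\<Sum>k<n. wt \<theta> k *\<^sub>R outer_product (r k) (r k)) - A0) \<le> 10 * K * C ^ 3 / sqrt (real n)"
proof -
  have "(1 / real n) *\<^sub>R (\<Sum>k<n. wt \<theta> k *\<^sub>R outer_product (r k) (r k)) - A0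
      = (1 / real n) *\<^sub>R (\<Sum>k<n. (wt \<theta> k - 1) *\<^sub>R outer_product (r k) (r k))"
    by (simp add: A0_def scaleR_diff_left sum_subtractf scaleR_diff_right)
  also have "norm \<dots> \<le> (10 * (K * C / sqrt (real n))) * (C * C)"
  proof (rule norm_average_le[OF _ n])
    fix k
    have "\<bar>wt \<theta> k - 1\<bar> \<le> 10 * (K * C / sqrt (real n))"
      using inverse_square_bounds(1)[OF deviation_le_half[of k]] deviation_bound[of k] by (simp add: wt_def)
    then show "norm ((wt \<theta> k - 1) *\<^sub>R outer_product (r k) (r k)) \<le> (10 * (K * C / sqrt (real n))) * (C * C)"
      using r_bound[of k] C_nonneg K_nonneg by (simp only: norm_scaleR norm_outer_product real_norm_def) (intro mult_mono, auto)
  qed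
  also have "\<dots> = 10 * K * C ^ 3 / sqrt (real n)" by (simp add: power3_eq_cube)
  finally show ?thesis .
qed

text \<open>
  Expand each weight to second order. The linear term sums to \<open>- 2 N0 u\<close> with \<open>u = \<surd>n (\<theta> - \<theta>\<^sub>0)\<close>, because
  \<open>(u \<bullet> r) r\<close> is the outer product of \<open>r\<close> applied to \<open>u\<close>; the remainder is of order \<open>\<bar>u\<bar>\<^sup>2 / n\<close> in each
  of the \<open>n\<close> summands and is divided by \<open>\<surd>n\<close> only.
\<close>
lemma weighted_score_close:
  "norm ((1 / sqrt (real n)) *\<^sub>R (\<Sum>k<n. (wt \<theta> k * \<eta> k) *\<^sub>R r k) - W0)
    \<le> 2 * norm N0 * K + 16 * C ^ 3 * K\<^sup>2 * E0 / sqrt (real n)"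
proof -
  define x where "x k = (\<theta> - \<theta>\<^sub>0) \<bullet> r k" for k
  define u where "u = sqrt (real n) *\<^sub>R (\<theta> - \<theta>\<^sub>0)"
  have sq: "sqrt (real n) * sqrt (real n) = real n" by simp
  have sp: "sqrt (real n) > 0" using n by simp
  have xu: "x k = (r k \<bullet> u) / sqrt (real n)" for k using sp by (simp add: x_def u_def inner_commute)
  define R where "R = (\<Sum>k<n. ((wt \<theta> k - 1 + 2 * x k) * \<eta> k) *\<^sub>R r k)"
  have N0u: "(\<Sum>k<n. (x k * \<eta> k) *\<^sub>R r k) = sqrt (real n) *\<^sub>R (N0 *v u)"
  proof -
    have "N0 *v u = (1 / real n) *\<^sub>R (\<Sum>k<n. (\<eta> k * (r k \<bullet> u)) *\<^sub>R r k)"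
      by (simp add: N0_def scaleR_matrix_vector_assoc[symmetric] matrix_vector_mult_sum_left outer_product_mult_vec)
    moreover have "(\<Sum>k<n. (x k * \<eta> k) *\<^sub>R r k) = (1 / sqrt (real n)) *\<^sub>R (\<Sum>k<n. (\<eta> k * (r k \<bullet> u)) *\<^sub>R r k)"
      by (simp add: xu scaleR_sum_right mult.commute)
    moreover have "1 / sqrt (real n) = sqrt (real n) * (1 / real n)" using sp sq by (simp add: field_simps)
    ultimately show ?thesis by (simp del: mult_1 times_divide_eq_right)
  qed
  have "(\<Sum>k<n. (wt \<theta> k * \<eta> k) *\<^sub>R r k) = (\<Sum>k<n. \<eta> k *\<^sub>R r k) - 2 *\<^sub>R (\<Sum>k<n. (x k * \<eta> k) *\<^sub>R r k) + R"
    unfolding R_def scaleR_sum_right sum_subtractf[symmetric] sum.distrib[symmetric]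
    by (intro sum.cong refl) (simp add: algebra_simps flip: scaleR_add_left scaleR_diff_left)
  then have "(1 / sqrt (real n)) *\<^sub>R (\<Sum>k<n. (wt \<theta> k * \<eta> k) *\<^sub>R r k) - W0
      = (1 / sqrt (real n)) *\<^sub>R R - 2 *\<^sub>R (N0 *v u)"
    using sp by (simp add: W0_def N0u scaleR_add_right scaleR_diff_right)
  also have "norm \<dots> \<le> norm R / sqrt (real n) + 2 * norm (N0 *v u)"
    using sp by (intro order_trans[OF norm_triangle_ineq4]) simp
  also have "norm (N0 *v u) \<le> norm N0 * K"
    using K unfolding u_def by (intro order_trans[OF norm_matrix_vector_mult_le] mult_left_mono) auto
  also have "norm R \<le> 16 * C ^ 3 * K\<^sup>2 * E0"
  proof -
    have "norm R \<le> (\<Sum>k<n. (16 * (K * C / sqrt (real n))\<^sup>2 * C) * \<bar>\<eta> k\<bar>)"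
      unfolding R_def
    proof (rule sum_norm_le)
      fix k
      have "\<bar>wt \<theta> k - 1 + 2 * x k\<bar> \<le> 16 * (x k)\<^sup>2"
        using inverse_square_bounds(2)[OF deviation_le_half[of k]] by (simp add: wt_def x_def)
      also have "\<dots> \<le> 16 * (K * C / sqrt (real n))\<^sup>2"
        using power_mono[OF deviation_bound[of k], of 2] by (simp add: x_def)
      finally have 1: "\<bar>wt \<theta> k - 1 + 2 * x k\<bar> \<le> 16 * (K * C / sqrt (real n))\<^sup>2" .
      have "norm (((wt \<theta> k - 1 + 2 * x k) * \<eta> k) *\<^sub>R r k) = \<bar>wt \<theta> k - 1 + 2 * x k\<bar> * norm (r k) * \<bar>\<eta> k\<bar>"
        by (simp add: abs_mult)
      also have "\<dots> \<le> (16 * (K * C / sqrt (real n))\<^sup>2 * C) * \<bar>\<eta> k\<bar>"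
        using 1 r_bound[of k] by (intro mult_right_mono mult_mono) auto
      finally show "norm (((wt \<theta> k - 1 + 2 * x k) * \<eta> k) *\<^sub>R r k) \<le> (16 * (K * C / sqrt (real n))\<^sup>2 * C) * \<bar>\<eta> k\<bar>" .
    qed
    also have "\<dots> = 16 * C ^ 3 * K\<^sup>2 * E0"
      unfolding E0_def sum_distrib_left[symmetric] power_divide power_mult_distrib
      by (simp add: power3_eq_cube power2_eq_square)
    finally show ?thesis .
  qed
  finally show ?thesis using sp by (simp add: divide_right_mono)
qed

text \<open>
  The equation \<open>A z = \<dots>\<close> is equivalent to \<open>An Z = W\<close> for \<open>An = A / n\<close>, \<open>Z = \<surd>n (z - \<theta>\<^sub>0)\<close> and the weighted score \<open>W\<close>, as
  \<open>A \<theta>\<^sub>0\<close> cancels the part of the right hand side without noise. Then \<open>G Z - W0 = (W - W0) - (An - G) Z\<close>, and coercivity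
  of \<open>An\<close>, inherited from \<open>G\<close>, bounds \<open>Z\<close> by \<open>W\<close>. Working with \<open>G Z\<close> avoids comparing inverse matrices.
\<close>
lemma weighted_estimator_close:
  fixes G :: "real^'m^'m"
  assumes c: "c > 0" and G: "\<And>x. x \<bullet> (G *v x) \<ge> c * (norm x)\<^sup>2"
    and d: "norm (A0 - G) \<le> d" "norm N0 \<le> d" and W0K: "norm W0 \<le> K" and E0K: "E0 \<le> K"
    and \<tau>: "d + 10 * K * C ^ 3 / sqrt (real n) \<le> \<tau>" "\<tau> \<le> c / 2"
    and \<rho>: "2 * d * K + 16 * C ^ 3 * K ^ 3 / sqrt (real n) \<le> \<rho>"
  defines "A \<equiv> \<Sum>k<n. wt \<theta> k *\<^sub>R outer_product (r k) (r k)"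
  shows "invertible A"
    and "\<And>z. A *v z = (\<Sum>k<n. (wt \<theta> k * (1 + \<eta> k)) *\<^sub>R r k) \<Longrightarrow>
      norm (G *v (sqrt (real n) *\<^sub>R (z - \<theta>\<^sub>0)) - W0) \<le> \<rho> + \<tau> * (2 / c) * (K + \<rho>)"
proof -
  define An where "An = (1 / real n) *\<^sub>R A"
  have An: "norm (An - G) \<le> \<tau>"
    using norm_triangle_mono[OF weighted_matrix_close d(1)] \<tau>(1) by (simp add: An_def A_def)
  then have "norm (An - G) \<le> c / 2" using \<tau> by linarith
  from coercive_perturbation[OF G this] have co: "x \<bullet> (An *v x) \<ge> c / 2 * (norm x)\<^sup>2" for x by simp
  have A_eq: "A = real n *\<^sub>R An" using n by (simp add: An_def)
  show "invertible A"
  proof (rule positive_definite_invertible)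
    fix x :: "real^'m" assume "x \<noteq> 0"
    then have "0 < c / 2 * (norm x)\<^sup>2" using c by simp
    then have "0 < x \<bullet> (An *v x)" using co[of x] by linarith
    then show "0 < x \<bullet> (A *v x)" using n by (simp add: A_eq scaleR_matrix_vector_assoc[symmetric])
  qed
  fix z assume z: "A *v z = (\<Sum>k<n. (wt \<theta> k * (1 + \<eta> k)) *\<^sub>R r k)"
  define Z where "Z = sqrt (real n) *\<^sub>R (z - \<theta>\<^sub>0)"
  define W where "W = (1 / sqrt (real n)) *\<^sub>R (\<Sum>k<n. (wt \<theta> k * \<eta> k) *\<^sub>R r k)"
  have sp: "sqrt (real n) > 0" "sqrt (real n) * sqrt (real n) = real n" using n by auto
  have "A *v \<theta>\<^sub>0 = (\<Sum>k<n. wt \<theta> k *\<^sub>R r k)"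
    unfolding A_def by (simp add: matrix_vector_mult_sum_left scaleR_matrix_vector_assoc[symmetric] outer_product_mult_vec r_unit inner_commute[of "r _"])
  then have "A *v (z - \<theta>\<^sub>0) = (\<Sum>k<n. (wt \<theta> k * \<eta> k) *\<^sub>R r k)"
    by (simp add: matrix_vector_mult_diff_distrib z distrib_left scaleR_add_left sum.distrib)
  then have AZ: "An *v Z = W"
  proof -
    assume *: "A *v (z - \<theta>\<^sub>0) = (\<Sum>k<n. (wt \<theta> k * \<eta> k) *\<^sub>R r k)"
    have "An *v Z = (sqrt (real n) * (1 / real n)) *\<^sub>R (A *v (z - \<theta>\<^sub>0))"
      by (simp add: An_def Z_def scaleR_matrix_vector_assoc[symmetric] matrix_vector_mult_scaleR)
    also have "sqrt (real n) * (1 / real n) = 1 / sqrt (real n)" using sp by (simp add: field_simps)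
    finally show ?thesis by (simp add: * W_def)
  qed
  have C0: "C \<ge> 0" and K0: "K \<ge> 0" using C_nonneg K_nonneg by auto
  have WW: "norm (W - W0) \<le> \<rho>"
  proof -
    have "norm (W - W0) \<le> 2 * norm N0 * K + 16 * C ^ 3 * K\<^sup>2 * E0 / sqrt (real n)"
      unfolding W_def by (rule weighted_score_close)
    also have "\<dots> \<le> 2 * d * K + 16 * C ^ 3 * K\<^sup>2 * K / sqrt (real n)"
      using d E0K C0 K0 sp by (intro add_mono mult_right_mono divide_right_mono mult_left_mono) auto
    also have "\<dots> \<le> \<rho>" using \<rho> by (simp add: power3_eq_cube power2_eq_square mult_ac)
    finally show ?thesis .
  qed
  then have W: "norm W \<le> K + \<rho>" using W0K norm_triangle_ineq[of "W - W0" W0] by simp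
  have "c / 2 * norm Z \<le> norm W" using coercive_norm_le[OF co[of Z]] AZ by simp
  then have "norm Z \<le> (2 / c) * norm W" using c by (simp add: field_simps)
  then have Z: "norm Z \<le> (2 / c) * (K + \<rho>)" using W c by (smt (verit, best) divide_nonneg_pos mult_left_mono)
  have \<tau>0: "\<tau> \<ge> 0" using An norm_ge_zero order_trans by blast
  have "G *v Z - W0 = (W - W0) - (An - G) *v Z"
    by (simp add: matrix_vector_mult_diff_rdistrib AZ)
  then have "norm (G *v Z - W0) \<le> norm (W - W0) + norm ((An - G) *v Z)"
    by (simp only: norm_triangle_ineq4)
  also have "\<dots> \<le> \<rho> + norm (An - G) * norm Z" using WW norm_matrix_vector_mult_le by (intro add_mono)
  also have "\<dots> \<le> \<rho> + \<tau> * ((2 / c) * (K + \<rho>))" using An Z \<tau>0 by (intro add_mono mult_mono) auto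
  finally show "norm (G *v (sqrt (real n) *\<^sub>R (z - \<theta>\<^sub>0)) - W0) \<le> \<rho> + \<tau> * (2 / c) * (K + \<rho>)"
    by (simp add: Z_def mult.assoc)
qed

end

end

section \<open>ARCH processes with positive coefficients\<close>

lemma sum_int_shift: "(\<Sum>t = 1..int n. f t) = (\<Sum>k<n. f (int k + 1))"
  by (rule sum.reindex_bij_witness[of _ "\<lambda>k. int k + 1" "\<lambda>t. nat (t - 1)"]) auto

lemma lag_ge_1: "lag j \<ge> 1"
  using bij_betwE[OF bij_betw_lag, rule_format, of j] by simp

lemma lag_strict_mono: "i < j \<Longrightarrow> lag i < lag j"
  unfolding lag_def by (intro psubset_card_mono) auto

lemma borel_measurable_regressor:
  assumes "\<And>j :: 'p::{finite, linorder}. X (t - int (lag j) + 1) \<in> borel_measurable N"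
  shows "(regressor X t :: 'a \<Rightarrow> real^('p option)) \<in> borel_measurable N"
proof (rule borel_measurable_vecI)
  fix i :: "'p option"
  show "(\<lambda>w. (regressor X t w :: real^('p option)) $ i) \<in> borel_measurable N"
    using assms by (cases i) (auto simp: regressor_def)
qed

lemma le_one_plus_square: "x \<le> 1 + x\<^sup>2" for x :: real
  using zero_le_power2[of "x - 1 / 2"] by (simp add: power2_eq_square algebra_simps)

text \<open>An interior \<open>\<theta>\<^sub>0\<close> has only positive coefficients.\<close>
locale arch_interior = arch_process M X \<epsilon> \<theta>\<^sub>0
  for M :: "'a measure" and X \<epsilon> :: "int \<Rightarrow> 'a \<Rightarrow> real"
    and \<theta>\<^sub>0 :: "real^('p::{finite, linorder} option)" +
  assumes alpha_pos: "\<And>j. \<theta>\<^sub>0 $ Some j > 0"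
    and fourth_moment: "\<And>t. integrable M (\<lambda>w. \<epsilon> t w ^ 4)"
    and nondegenerate: "\<And>t. \<not> (\<exists>c. AE w in M. (\<epsilon> t w)\<^sup>2 = c)"
begin

abbreviation Y :: "int \<Rightarrow> 'a \<Rightarrow> real^('p option)" where "Y t \<equiv> regressor X (t - 1)"
abbreviation s :: "int \<Rightarrow> 'a \<Rightarrow> real" where "s \<equiv> sigma2 X \<theta>\<^sub>0"
definition r :: "int \<Rightarrow> 'a \<Rightarrow> real^('p option)" where "r t w = (1 / s t w) *\<^sub>R Y t w"
definition \<eta> :: "int \<Rightarrow> 'a \<Rightarrow> real" where "\<eta> t w = (X t w)\<^sup>2 / s t w - 1"
definition past :: "int \<Rightarrow> 'a measure" where
  "past t = vimage_algebra (space M) (\<lambda>w. \<lambda>s\<in>{..<t}. X s w) (Pi\<^sub>M {..<t} (\<lambda>_. borel))"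
text \<open>The bound on the standardized regressors.\<close>
definition C :: real where "C = 1 / Min (range (\<lambda>i. \<theta>\<^sub>0 $ i))"
definition \<kappa> :: real where "\<kappa> = variance (\<lambda>w. (\<epsilon> 0 w)\<^sup>2)"
definition D :: "real measure" where "D = distr M borel (\<lambda>w. (\<epsilon> 0 w)\<^sup>2 - 1)"

abbreviation rr :: "int \<Rightarrow> 'a \<Rightarrow> real^('p option)^('p option)" where
  "rr t w \<equiv> outer_product (r t w) (r t w)"

lemma theta_pos: "\<theta>\<^sub>0 $ i > 0"
  using omega_pos alpha_pos by (cases i) auto

lemma regressor_nonneg: "Y t w $ i \<ge> 0"
  by (cases i) (auto simp: regressor_def)

lemma s_eq: "s t w = (\<Sum>i\<in>UNIV. \<theta>\<^sub>0 $ i * Y t w $ i)"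
  by (simp add: sigma2_def inner_vec_def)

lemma s_ge: "s t w \<ge> \<theta>\<^sub>0 $ None"
proof -
  have "\<theta>\<^sub>0 $ None * Y t w $ None \<le> s t w"
    unfolding s_eq
    by (rule member_le_sum[where f = "\<lambda>i. \<theta>\<^sub>0 $ i * Y t w $ i"])
      (simp_all add: less_imp_le[OF theta_pos] regressor_nonneg)
  then show ?thesis by (simp add: regressor_def)
qed

lemma s_pos: "s t w > 0"
  using s_ge[of t w] omega_pos by linarith

lemma C_pos: "C > 0"
  using theta_pos by (simp add: C_def)

text \<open>With \<open>m\<close> the smallest component of \<open>\<theta>\<^sub>0\<close>, the \<open>\<ell>\<^sup>1\<close> norm of the nonnegative vector \<open>Y\<close> is at most \<open>(\<theta>\<^sub>0 \<bullet> Y) / m\<close>.\<close>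
lemma norm_regressor_le: "norm (Y t w) \<le> C * s t w"
proof -
  define m where "m = Min (range (\<lambda>i. \<theta>\<^sub>0 $ i))"
  have m: "m > 0" "m \<le> \<theta>\<^sub>0 $ i" for i using theta_pos by (auto simp: m_def)
  have "norm (Y t w) \<le> (\<Sum>i\<in>UNIV. \<bar>Y t w $ i\<bar>)" by (rule norm_le_l1_cart)
  also have "\<dots> = (\<Sum>i\<in>UNIV. Y t w $ i)" using regressor_nonneg by simp
  finally have "m * norm (Y t w) \<le> m * (\<Sum>i\<in>UNIV. Y t w $ i)" using m by simp
  also have "\<dots> \<le> s t w"
    unfolding s_eq sum_distrib_left using m regressor_nonneg by (intro sum_mono mult_right_mono) auto
  finally show ?thesis using m by (simp add: C_def m_def[symmetric] field_simps)
qed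

lemma r_bound: "norm (r t w) \<le> C"
  using norm_regressor_le[of t w] s_pos[of t w] by (simp add: r_def divide_le_eq)

lemma r_unit: "\<theta>\<^sub>0 \<bullet> r t w = 1"
  using s_pos[of t w] by (simp add: r_def sigma2_def)

lemma weighted_outer_eq: "weighted_outer X \<theta>\<^sub>0 t w = rr t w"
  by (simp add: weighted_outer_def r_def outer_product_scaleR power2_eq_square)

lemma X_past: "j < t \<Longrightarrow> X j \<in> borel_measurable (past t)"
proof -
  assume j: "j < t"
  have "(\<lambda>w. \<lambda>s\<in>{..<t}. X s w) \<in> past t \<rightarrow>\<^sub>M Pi\<^sub>M {..<t} (\<lambda>_. borel)"
    unfolding past_def by (rule measurable_vimage_algebra1) (auto simp: space_PiM)
  from measurable_compose[OF this measurable_component_singleton[of j]] j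
  show ?thesis by simp
qed

lemma space_past [simp]: "space (past t) = space M"
  by (simp add: past_def)

lemma Y_past: "Y t \<in> borel_measurable (past t)"
proof (rule borel_measurable_regressor)
  show "X (t - 1 - int (lag j) + 1) \<in> borel_measurable (past t)" for j :: 'p
    using lag_ge_1[of j] by (intro X_past) linarith
qed

lemma s_past: "s t \<in> borel_measurable (past t)"
  unfolding sigma2_def[abs_def] by (intro borel_measurable_inner borel_measurable_const Y_past)

lemma r_past: "r t \<in> borel_measurable (past t)"
  unfolding r_def[abs_def] by (intro borel_measurable_scaleR borel_measurable_divide borel_measurable_const Y_past s_past)

lemma past_sets_le:
  assumes "space N = space M" "\<And>j. j < t \<Longrightarrow> X j \<in> borel_measurable N"
  shows "sets (past t) \<subseteq> sets N"
  unfolding past_def using assms by (intro sets_image_in_sets measurable_restrict) auto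

lemma past_mono: "sets (past t) \<subseteq> sets (past (t + 1))"
  by (intro past_sets_le X_past) auto

lemma past_subalgebra: "subalgebra M (past t)"
  unfolding subalgebra_def using past_sets_le[OF refl X_measurable] by simp

lemma past_measurable: "f \<in> borel_measurable (past t) \<Longrightarrow> f \<in> borel_measurable M"
  by (rule measurable_from_subalg[OF past_subalgebra])

lemma eta_adapted: "\<eta> t \<in> borel_measurable (past (t + 1))"
proof -
  have "s t \<in> borel_measurable (past (t + 1))"
    using s_past past_mono[of t] by (auto simp: measurable_def)
  then show ?thesis
    unfolding \<eta>_def[abs_def]
    by (intro borel_measurable_diff borel_measurable_divide borel_measurable_power borel_measurable_const X_past) auto
qed

lemma measurable_basic [measurable]: "Y t \<in> borel_measurable M" "s t \<in> borel_measurable M"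
  "r t \<in> borel_measurable M" "\<eta> t \<in> borel_measurable M" "X t \<in> borel_measurable M"
  by (rule past_measurable, rule Y_past s_past r_past eta_adapted)+ (rule X_measurable)

lemma eps_measurable [measurable]: "\<epsilon> t \<in> borel_measurable M"
  using innov_mean(1) by (rule borel_measurable_integrable)

lemma eta_AE: "AE w in M. \<eta> t w = (\<epsilon> t w)\<^sup>2 - 1"
  using model[of t]
proof eventually_elim
  case (elim w)
  then show ?case using s_pos[of t w] by (simp add: \<eta>_def power_mult_distrib)
qed

lemma eta_indep: "indep_set (sets (past t)) (sets (vimage_algebra (space M) (\<eta> t) borel))"
proof -
  let ?e = "\<lambda>w. (\<epsilon> t w)\<^sup>2 - 1"
  have "sets (vimage_algebra (space M) ?e borel) \<subseteq> sets (vimage_algebra (space M) (\<epsilon> t) borel)"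
  proof (rule sets_image_in_sets)
    have "\<epsilon> t \<in> borel_measurable (vimage_algebra (space M) (\<epsilon> t) borel)"
      by (rule measurable_vimage_algebra1) simp
    then show "?e \<in> borel_measurable (vimage_algebra (space M) (\<epsilon> t) borel)"
      by (intro borel_measurable_diff borel_measurable_power borel_measurable_const)
  qed simp
  then have sub: "b \<in> sets (vimage_algebra (space M) (\<epsilon> t) borel)" if "b \<in> sets (vimage_algebra (space M) ?e borel)" for b
    using that by blast
  note ind = innov_indep_past[of t, folded past_def, unfolded indep_sets2_eq]
  have "prob (a \<inter> b) = prob a * prob b"
    if "a \<in> sets (past t)" "b \<in> sets (vimage_algebra (space M) ?e borel)" for a b
    using ind sub[OF that(2)] that(1) by (metis Int_commute mult.commute)
  moreover have "sets (past t) \<subseteq> events" "sets (vimage_algebra (space M) ?e borel) \<subseteq> events"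
    using ind sub by blast+
  ultimately have "indep_set (sets (past t)) (sets (vimage_algebra (space M) ?e borel))"
    unfolding indep_sets2_eq by blast
  then show ?thesis
    by (rule indep_set_vimage_algebra_AE_cong) (use eta_AE[of t] in \<open>auto elim!: eventually_mono\<close>)
qed

lemma eta_distr: "distr M borel (\<eta> t) = D"
proof -
  have "distr M borel (\<eta> t) = distr M borel (\<lambda>w. (\<epsilon> t w)\<^sup>2 - 1)"
    by (rule distr_cong_AE) (use eta_AE[of t] in auto)
  also have "\<dots> = distr (distr M borel (\<epsilon> t)) borel (\<lambda>x. x\<^sup>2 - 1)"
    by (subst distr_distr) (auto simp: comp_def)
  also have "distr M borel (\<epsilon> t) = distr M borel (\<epsilon> 0)" by (rule innov_distr)
  also have "distr (distr M borel (\<epsilon> 0)) borel (\<lambda>x. x\<^sup>2 - 1) = D"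
    unfolding D_def by (subst distr_distr) (auto simp: comp_def)
  finally show ?thesis .
qed

lemma eps_square_centered:
  "integrable M (\<lambda>w. ((\<epsilon> t w)\<^sup>2 - 1)\<^sup>2)" "expectation (\<lambda>w. (\<epsilon> t w)\<^sup>2 - 1) = 0"
proof -
  have "((\<epsilon> t w)\<^sup>2 - 1)\<^sup>2 = \<epsilon> t w ^ 4 - 2 * (\<epsilon> t w)\<^sup>2 + 1" for w
    by (simp add: power2_eq_square power4_eq_xxxx algebra_simps)
  then show "integrable M (\<lambda>w. ((\<epsilon> t w)\<^sup>2 - 1)\<^sup>2)"
    using fourth_moment[of t] innov_square(1)[of t] by simp
  show "expectation (\<lambda>w. (\<epsilon> t w)\<^sup>2 - 1) = 0"
    using innov_square[of t] by (simp add: prob_space)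
qed

sublocale noise: martingale_noise M "\<lambda>k. past (int k + 1)" "\<lambda>k. \<eta> (int k + 1)" D \<kappa>
proof
  show "subalgebra M (past (int k + 1))" for k by (rule past_subalgebra)
  show "sets (past (int k + 1)) \<subseteq> sets (past (int (Suc k) + 1))" for k
    using past_mono[of "int k + 1"] by (simp add: add.commute)
  show "\<eta> (int k + 1) \<in> borel_measurable (past (int (Suc k) + 1))" for k
    using eta_adapted[of "int k + 1"] by (simp add: add.commute)
  show "indep_set (sets (past (int k + 1))) (sets (vimage_algebra (space M) (\<eta> (int k + 1)) borel))" for k
    by (rule eta_indep)
  show "distr M borel (\<eta> (int k + 1)) = D" for k by (rule eta_distr)
  have m: "(\<lambda>w. (\<epsilon> 0 w)\<^sup>2 - 1) \<in> borel_measurable M" by measurable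
  show "integrable D (\<lambda>x. x\<^sup>2)"
    unfolding D_def using eps_square_centered(1)[of 0] by (subst integrable_distr_eq[OF m]) auto
  show "(\<integral>x. x\<^sup>2 \<partial>D) = \<kappa>"
    unfolding D_def \<kappa>_def by (subst integral_distr[OF m]) (auto simp: innov_square(2))
  show "(\<integral>x. x \<partial>D) = 0"
    unfolding D_def using eps_square_centered(2)[of 0] by (subst integral_distr[OF m]) auto
qed

lemma eta_moments:
  "integrable M (\<eta> t)" "expectation (\<eta> t) = 0" "integrable M (\<lambda>w. (\<eta> t w)\<^sup>2)" "expectation (\<lambda>w. (\<eta> t w)\<^sup>2) = \<kappa>"
proof -
  have *: "integrable M (\<lambda>w. f (\<eta> t w)) \<longleftrightarrow> integrable D f" "(\<integral>w. f (\<eta> t w) \<partial>M) = (\<integral>x. f x \<partial>D)"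
    if "f \<in> borel_measurable borel" for f :: "real \<Rightarrow> real"
    using integrable_distr_eq[OF measurable_basic(4) that, of t] integral_distr[OF measurable_basic(4) that, of t]
    by (simp_all only: eta_distr)
  show "integrable M (\<eta> t)" "expectation (\<eta> t) = 0" "integrable M (\<lambda>w. (\<eta> t w)\<^sup>2)" "expectation (\<lambda>w. (\<eta> t w)\<^sup>2) = \<kappa>"
    using *[of "\<lambda>x. x"] *[of "\<lambda>x. x\<^sup>2"] by (simp_all add: noise.D_integrable noise.noise_mean noise.noise_square)
qed

text \<open>If \<open>\<eta> t\<close> were a function \<open>H\<close> of the past, then \<open>E (\<eta> t)\<^sup>2 = E (H \<cdot> \<eta> t) = E H \<cdot> E (\<eta> t) = 0\<close>, so \<open>\<epsilon>\<^sub>t\<^sup>2\<close> would be constant.\<close>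
lemma eta_not_past_measurable:
  assumes H: "H \<in> borel_measurable (past t)"
  shows "\<not> (AE w in M. \<eta> t w = H w)"
proof
  assume eq: "AE w in M. \<eta> t w = H w"
  note [measurable] = past_measurable[OF H]
  have ind: "indep_var borel H borel (\<eta> t)"
    by (rule indep_var_of_indep_set[OF past_subalgebra eta_indep H]) simp
  have "AE w in M. H w = \<eta> t w" using eq by (auto elim!: eventually_mono)
  then have Hint: "integrable M H" by (subst integrable_cong_AE[where g = "\<eta> t"]) (auto simp: eta_moments)
  have "(\<integral>w. (\<eta> t w)\<^sup>2 \<partial>M) = (\<integral>w. H w * \<eta> t w \<partial>M)"
    using eq by (intro integral_cong_AE) (auto simp: power2_eq_square elim!: eventually_mono)
  also have "\<dots> = 0"
    using indep_var_lebesgue_integral[OF ind Hint eta_moments(1)[of t]] eta_moments(2)[of t] by simp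
  finally have "AE w in M. (\<eta> t w)\<^sup>2 = 0"
    using integral_nonneg_eq_0_iff_AE[OF eta_moments(3)[of t]] by simp
  with eta_AE[of t] have "AE w in M. (\<epsilon> t w)\<^sup>2 = 1"
    by eventually_elim simp
  then show False using nondegenerate[of t] by blast
qed

lemma kappa_pos: "\<kappa> > 0"
proof (rule ccontr)
  assume "\<not> \<kappa> > 0"
  then have "(\<integral>w. (\<eta> 0 w)\<^sup>2 \<partial>M) = 0" using noise.variance_nonneg eta_moments(4)[of 0] by simp
  then have "AE w in M. \<eta> 0 w = 0"
    using integral_nonneg_eq_0_iff_AE[OF eta_moments(3)[of 0]] by simp
  with eta_not_past_measurable[of "\<lambda>_. 0" 0] show False by simp
qed

text \<open>
  Suppose some lag has a nonzero coefficient, and take the smallest such lag, belonging to time \<open>t\<close>. All other terms of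
  \<open>a \<bullet> Y\<close> that do not vanish are constant or refer to times before \<open>t\<close>, so the relation \<open>a \<bullet> Y = 0\<close> can be solved for \<open>\<eta> t\<close> in terms of the past.
\<close>
lemma regressor_not_degenerate:
  assumes a: "AE w in M. a \<bullet> Y 1 w = 0"
  shows "a = 0"
proof -
  have "a $ Some j = 0" for j
  proof (rule ccontr)
    assume "a $ Some j \<noteq> 0"
    define i where "i = Min {j. a $ Some j \<noteq> 0}"
    have "i \<in> {j. a $ Some j \<noteq> 0}" unfolding i_def using \<open>a $ Some j \<noteq> 0\<close> by (intro Min_in) auto
    then have ai: "a $ Some i \<noteq> 0" by simp
    have min: "a $ Some k = 0" if "k < i" for k
    proof (rule ccontr)
      assume "a $ Some k \<noteq> 0"
      then have "i \<le> k" unfolding i_def by (intro Min_le) auto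
      then show False using that by simp
    qed
    define t where "t = 1 - int (lag i)"
    define R where "R w = a $ None + (\<Sum>k\<in>{k. i < k}. a $ Some k * (X (1 - int (lag k)) w)\<^sup>2)" for w
    have R: "R \<in> borel_measurable (past t)"
      unfolding R_def[abs_def]
      by (intro borel_measurable_add borel_measurable_sum borel_measurable_times borel_measurable_power
          borel_measurable_const X_past) (use lag_strict_mono[of i] in \<open>auto simp: t_def\<close>)
    have split: "a \<bullet> Y 1 w = R w + a $ Some i * (X t w)\<^sup>2" for w
    proof -
      have "a \<bullet> Y 1 w = a $ None * Y 1 w $ None + (\<Sum>k\<in>UNIV. a $ Some k * Y 1 w $ Some k)"
        by (simp add: inner_vec_def UNIV_option_conv sum.reindex)
      also have "(\<Sum>k\<in>UNIV. a $ Some k * Y 1 w $ Some k) = (\<Sum>k\<in>insert i {k. i < k}. a $ Some k * Y 1 w $ Some k)"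
      proof (rule sum.mono_neutral_right)
        show "\<forall>k\<in>UNIV - insert i {k. i < k}. a $ Some k * Y 1 w $ Some k = 0"
        proof
          fix k assume "k \<in> UNIV - insert i {k. i < k}"
          then have "k < i" by (auto simp: not_less le_less)
          then show "a $ Some k * Y 1 w $ Some k = 0" by (simp add: min)
        qed
      qed auto
      finally show ?thesis by (simp add: R_def regressor_def t_def algebra_simps)
    qed
    define H where "H w = - R w / (a $ Some i * s t w) - 1" for w
    have "H \<in> borel_measurable (past t)"
      unfolding H_def[abs_def]
      by (intro borel_measurable_diff borel_measurable_divide borel_measurable_uminus borel_measurable_times
          borel_measurable_const R s_past)
    moreover have "AE w in M. \<eta> t w = H w"
      using a
    proof eventually_elim
      case (elim w)
      then have "a $ Some i * (X t w)\<^sup>2 = - R w" using split[of w] by linarith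
      then have "(X t w)\<^sup>2 = - R w / a $ Some i" using ai by (simp add: field_simps)
      then show ?case by (simp add: \<eta>_def H_def)
    qed
    ultimately show False using eta_not_past_measurable by blast
  qed
  note Some0 = this
  have eq: "a \<bullet> Y 1 w = a $ None" for w
    by (simp add: inner_vec_def UNIV_option_conv sum.reindex Some0 regressor_def)
  have "AE w in M. a $ None = 0" using a unfolding eq .
  then have "a $ None = 0" by simp
  with Some0 show ?thesis by (auto simp: vec_eq_iff split_option_all)
qed

abbreviation \<Gamma> :: "real^('p option)^('p option)" where "\<Gamma> \<equiv> arch_Gamma M X \<theta>\<^sub>0"

lemma outer_measurable [measurable]: "(\<lambda>w. rr t w) \<in> borel_measurable M"
  by (intro borel_measurable_outer_product) measurable

lemma outer_norm_le: "norm (rr t w) \<le> C * C"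
  unfolding norm_outer_product using r_bound C_pos by (intro mult_mono) auto

lemma outer_integrable: "integrable M (\<lambda>w. rr t w)"
  by (rule integrable_const_bound[where B = "C * C"]) (auto simp: outer_norm_le)

lemma Gamma_eq: "\<Gamma> = (\<integral>w. rr 1 w \<partial>M)"
  by (simp add: arch_Gamma_def weighted_outer_eq)

lemma Gamma_quadratic: "a \<bullet> (\<Gamma> *v a) = (\<integral>w. (a \<bullet> r 1 w)\<^sup>2 \<partial>M)" "integrable M (\<lambda>w. (a \<bullet> r 1 w)\<^sup>2)"
  using integral_bounded_linear[OF bounded_linear_quadratic_form[of a a] outer_integrable[of 1]]
    integrable_bounded_linear[OF bounded_linear_quadratic_form[of a a] outer_integrable[of 1]]
  by (simp_all add: quadratic_form_outer Gamma_eq)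

lemma Gamma_positive_definite: "a \<noteq> 0 \<Longrightarrow> a \<bullet> (\<Gamma> *v a) > 0"
proof (rule ccontr)
  assume "a \<noteq> 0" "\<not> a \<bullet> (\<Gamma> *v a) > 0"
  moreover have "a \<bullet> (\<Gamma> *v a) \<ge> 0" unfolding Gamma_quadratic by simp
  ultimately have "a \<bullet> (\<Gamma> *v a) = 0" by linarith
  then have "(\<integral>w. (a \<bullet> r 1 w)\<^sup>2 \<partial>M) = 0" by (simp add: Gamma_quadratic(1))
  then have "AE w in M. (a \<bullet> r 1 w)\<^sup>2 = 0"
    using integral_nonneg_eq_0_iff_AE[OF Gamma_quadratic(2)[of a]] by simp
  then have "AE w in M. a \<bullet> Y 1 w = 0"
  proof eventually_elim
    case (elim w)
    then show ?case using s_pos[of 1 w] by (simp add: r_def)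
  qed
  then show False using regressor_not_degenerate \<open>a \<noteq> 0\<close> by blast
qed

lemma transpose_Gamma: "transpose \<Gamma> = \<Gamma>"
proof -
  have bl: "bounded_linear (\<lambda>G :: real^('p option)^('p option). G $ i $ j)" for i j
    by (rule bounded_linear_compose[OF bounded_linear_vec_nth bounded_linear_vec_nth])
  have "\<Gamma> $ i $ j = (\<integral>w. r 1 w $ i * r 1 w $ j \<partial>M)" for i j
    using integral_bounded_linear[OF bl[of i j] outer_integrable[of 1]] by (simp add: Gamma_eq outer_product_def)
  then show ?thesis by (simp add: transpose_def vec_eq_iff mult.commute)
qed

definition path :: "'a \<Rightarrow> int \<Rightarrow> real" where "path w = (\<lambda>t. X t w)"
definition path_shift :: "(int \<Rightarrow> real) \<Rightarrow> int \<Rightarrow> real" where "path_shift x = (\<lambda>t. x (t + 1))"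
abbreviation PS :: "(int \<Rightarrow> real) measure" where "PS \<equiv> Pi\<^sub>M UNIV (\<lambda>_. borel)"

abbreviation law :: "(int \<Rightarrow> real) measure" where "law \<equiv> distr M PS path"

lemma path_measurable [measurable]: "path \<in> M \<rightarrow>\<^sub>M PS"
  unfolding path_def[abs_def] by (rule measurable_PiM_single') (auto intro: X_measurable)

lemma path_shift_measurable [measurable]: "path_shift \<in> PS \<rightarrow>\<^sub>M PS"
  unfolding path_shift_def[abs_def] by (rule measurable_PiM_single') (auto simp: space_PiM)

lemma funpow_path_shift: "(path_shift ^^ k) x = (\<lambda>t. x (t + int k))"
  by (induction k arbitrary: x) (auto simp: path_shift_def funpow_swap1 add_ac)

text \<open>
  The invariant sets in \<open>ergodic_process\<close> are sets of paths, so ergodicity is a property of the law of the process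
  on path space rather than of a transformation of the underlying probability space.
\<close>
lemma path_ergodic: "ergodic_transformation law path_shift"
proof -
  interpret PP: prob_space law by (rule prob_space_distr) simp
  show ?thesis
  proof
    show "path_shift \<in> law \<rightarrow>\<^sub>M law" by simp
    have "distr law law path_shift = distr law PS path_shift"
      by (rule distr_cong) auto
    also have "\<dots> = distr M PS (path_shift \<circ> path)" by (rule distr_distr) auto
    also have "path_shift \<circ> path = (\<lambda>w t. X (t + 1) w)" by (auto simp: path_shift_def path_def)
    also have "distr M PS \<dots> = law"
      using stationary unfolding stationary_process_def path_def[abs_def] by blast
    finally show "distr law law path_shift = law" .
    fix A assume A: "A \<in> sets law"
      and inv: "\<And>x. x \<in> space law \<Longrightarrow> path_shift x \<in> A \<longleftrightarrow> x \<in> A"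
    then have A': "A \<in> sets PS" by simp
    have "\<forall>x. (\<lambda>t. x (t + 1)) \<in> A \<longleftrightarrow> x \<in> A" using inv by (simp add: space_PiM path_shift_def)
    then have "\<P>(w in M. (\<lambda>t. X t w) \<in> A) \<in> {0, 1}"
      using ergodic A' unfolding ergodic_process_def by blast
    moreover have "measure law A = \<P>(w in M. (\<lambda>t. X t w) \<in> A)"
      using A' by (subst measure_distr) (auto simp: path_def vimage_def Int_def conj_commute)
    ultimately show "measure law A \<in> {0, 1}" by simp
  qed
qed

definition info_average :: "nat \<Rightarrow> 'a \<Rightarrow> real^('p option)^('p option)" where
  "info_average n w = (1 / real n) *\<^sub>R (\<Sum>k<n. rr (int k + 1) w)"

text \<open>The summand at time \<open>k + 1\<close> is one fixed function on path space evaluated at the path shifted by \<open>k\<close>.\<close>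
theorem info_average_tendsto: "AE w in M. (\<lambda>n. info_average n w) \<longlonglongrightarrow> \<Gamma>"
proof -
  interpret E: ergodic_transformation law path_shift by (rule path_ergodic)
  define f :: "(int \<Rightarrow> real) \<Rightarrow> real^('p option)^('p option)" where
    "f x = weighted_outer (\<lambda>t x. x t) \<theta>\<^sub>0 1 x" for x
  have reg [measurable]: "(regressor (\<lambda>t x. x t) 0 :: (int \<Rightarrow> real) \<Rightarrow> real^('p option)) \<in> borel_measurable PS"
    by (rule borel_measurable_regressor) simp
  have f [measurable]: "f \<in> borel_measurable PS"
    unfolding f_def[abs_def] weighted_outer_def sigma2_def
    by (intro borel_measurable_scaleR borel_measurable_outer_product) auto
  have f_shift: "f ((path_shift ^^ k) (path w)) = rr (int k + 1) w" for k w
  proof -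
    have "regressor (\<lambda>t x. x t) 0 ((path_shift ^^ k) (path w)) = Y (int k + 1) w"
      by (simp add: regressor_def funpow_path_shift path_def vec_eq_iff algebra_simps split: option.split)
    then have "f ((path_shift ^^ k) (path w)) = weighted_outer X \<theta>\<^sub>0 (int k + 1) w"
      by (simp add: f_def weighted_outer_def sigma2_def)
    then show ?thesis by (simp add: weighted_outer_eq)
  qed
  have int: "integrable law f"
    using outer_integrable[of 1] f_shift[of 0] by (subst integrable_distr_eq) auto
  have "(\<integral>x. f x \<partial>law) = \<Gamma>"
    using f_shift[of 0] by (subst integral_distr) (auto simp: Gamma_eq)
  with E.birkhoff_ergodic[OF int]
  have "AE x in law. (\<lambda>n. birkhoff_sum path_shift f n x /\<^sub>R real n) \<longlonglongrightarrow> \<Gamma>" by simp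
  then have "AE w in M. (\<lambda>n. birkhoff_sum path_shift f n (path w) /\<^sub>R real n) \<longlonglongrightarrow> \<Gamma>"
    by (rule AE_distrD[OF path_measurable])
  then show ?thesis
    by (simp add: birkhoff_sum_def f_shift info_average_def inverse_eq_divide)
qed

section \<open>Linearization and asymptotic normality\<close>

definition score :: "nat \<Rightarrow> 'a \<Rightarrow> real^('p option)" where
  "score n w = (1 / sqrt (real n)) *\<^sub>R (\<Sum>k<n. \<eta> (int k + 1) w *\<^sub>R r (int k + 1) w)"

definition noise_average :: "nat \<Rightarrow> 'a \<Rightarrow> real^('p option)^('p option)" where
  "noise_average n w = (1 / real n) *\<^sub>R
     (\<Sum>k<n. \<eta> (int k + 1) w *\<^sub>R rr (int k + 1) w)"

definition abs_noise_average :: "nat \<Rightarrow> 'a \<Rightarrow> real" where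
  "abs_noise_average n w = (1 / real n) * (\<Sum>k<n. \<bar>\<eta> (int k + 1) w\<bar>)"

lemma averages_measurable [measurable]:
  "score n \<in> borel_measurable M" "noise_average n \<in> borel_measurable M"
  "abs_noise_average n \<in> borel_measurable M" "info_average n \<in> borel_measurable M"
  unfolding score_def[abs_def] noise_average_def[abs_def] abs_noise_average_def[abs_def] info_average_def[abs_def]
  by measurable

lemma score_second_moment:
  "integrable M (\<lambda>w. (norm (score n w))\<^sup>2)"
  "(\<integral>w. (norm (score n w))\<^sup>2 \<partial>M) \<le> real DIM(real^('p option)) * (C\<^sup>2 * \<kappa>)"
proof -
  have eq: "(norm (score n w))\<^sup>2 = (1 / real n) * (norm (\<Sum>k<n. \<eta> (int k + 1) w *\<^sub>R r (int k + 1) w))\<^sup>2" for w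
    by (simp add: score_def power_mult_distrib power_divide)
  note sm = noise.second_moment_partial_sum_vec[of "\<lambda>k. r (int k + 1)" C n, OF r_past r_bound]
  show "integrable M (\<lambda>w. (norm (score n w))\<^sup>2)" unfolding eq using sm(1) by simp
  have "(\<integral>w. (norm (score n w))\<^sup>2 \<partial>M) \<le> (1 / real n) * (real DIM(real^('p option)) * (real n * (C\<^sup>2 * \<kappa>)))"
    unfolding eq integral_mult_right_zero by (intro mult_left_mono sm(2)) simp
  also have "\<dots> \<le> real DIM(real^('p option)) * (C\<^sup>2 * \<kappa>)"
    using noise.variance_nonneg by (cases "n = 0") auto
  finally show "(\<integral>w. (norm (score n w))\<^sup>2 \<partial>M) \<le> real DIM(real^('p option)) * (C\<^sup>2 * \<kappa>)" .
qed

lemma score_bounded_in_probability: "bounded_in_probability M score"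
proof (rule bounded_in_probability_of_first_moment)
  fix n
  have int: "integrable M (\<lambda>w. 1 + (norm (score n w))\<^sup>2)" using score_second_moment(1)[of n] by simp
  show int': "integrable M (\<lambda>w. norm (score n w))"
    by (rule Bochner_Integration.integrable_bound[OF int]) (auto simp: le_one_plus_square)
  show "(\<integral>w. norm (score n w) \<partial>M) \<le> 1 + real DIM(real^('p option)) * (C\<^sup>2 * \<kappa>)"
    using integral_mono[OF int' int le_one_plus_square] score_second_moment[of n] by (simp add: prob_space)
qed

lemma noise_average_tendsto:
  assumes "e > 0"
  shows "(\<lambda>n. \<P>(w in M. norm (noise_average n w) > e)) \<longlonglongrightarrow> 0"
proof (rule second_moment_tendsto_zero_imp_in_probability[OF _ _ assms])
  let ?c = "real DIM(real^('p option)^('p option)) * ((C * C)\<^sup>2 * \<kappa>)"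
  have eq: "(norm (noise_average n w))\<^sup>2 = (1 / real n)\<^sup>2 *
      (norm (\<Sum>k<n. \<eta> (int k + 1) w *\<^sub>R rr (int k + 1) w))\<^sup>2" for n w
    by (simp add: noise_average_def power_mult_distrib power_divide)
  note sm = noise.second_moment_partial_sum_vec[of "\<lambda>k w. rr (int k + 1) w" "C * C",
      OF borel_measurable_outer_product[OF r_past r_past] outer_norm_le]
  show "integrable M (\<lambda>w. (norm (noise_average n w))\<^sup>2)" for n unfolding eq using sm(1) by simp
  have "(\<integral>w. (norm (noise_average n w))\<^sup>2 \<partial>M) \<le> ?c / real n" for n
  proof -
    have "(\<integral>w. (norm (noise_average n w))\<^sup>2 \<partial>M)
        \<le> (1 / real n)\<^sup>2 * (real DIM(real^('p option)^('p option)) * (real n * ((C * C)\<^sup>2 * \<kappa>)))"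
      unfolding eq using sm(2)[of n] by (simp only: integral_mult_right_zero) (intro mult_left_mono, auto)
    also have "\<dots> = ?c / real n" by (cases "n = 0") (simp_all add: power2_eq_square)
    finally show ?thesis .
  qed
  then show "(\<lambda>n. \<integral>w. (norm (noise_average n w))\<^sup>2 \<partial>M) \<longlonglongrightarrow> 0"
    by (intro tendsto_sandwich[OF _ _ tendsto_const lim_const_over_n[of ?c]]) auto
qed measurable

lemma abs_noise_average_bounded_in_probability: "bounded_in_probability M abs_noise_average"
proof (rule bounded_in_probability_of_first_moment)
  fix n
  have eq: "norm (abs_noise_average n w) = abs_noise_average n w" for w
    by (simp add: abs_noise_average_def sum_nonneg)
  have mom: "integrable M (\<lambda>w. \<bar>\<eta> t w\<bar>)" "(\<integral>w. \<bar>\<eta> t w\<bar> \<partial>M) \<le> 1 + \<kappa>" for t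
  proof -
    show i: "integrable M (\<lambda>w. \<bar>\<eta> t w\<bar>)" using eta_moments(1) by simp
    have "\<bar>\<eta> t w\<bar> \<le> 1 + (\<eta> t w)\<^sup>2" for w
      using le_one_plus_square[of "\<bar>\<eta> t w\<bar>"] by simp
    then show "(\<integral>w. \<bar>\<eta> t w\<bar> \<partial>M) \<le> 1 + \<kappa>"
      using integral_mono[OF i, of "\<lambda>w. 1 + (\<eta> t w)\<^sup>2"] eta_moments[of t] by (simp add: prob_space)
  qed
  show "integrable M (\<lambda>w. norm (abs_noise_average n w))"
    unfolding eq unfolding abs_noise_average_def using mom(1) by simp
  have "(\<integral>w. norm (abs_noise_average n w) \<partial>M) = (1 / real n) * (\<Sum>k<n. \<integral>w. \<bar>\<eta> (int k + 1) w\<bar> \<partial>M)"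
    unfolding eq unfolding abs_noise_average_def using mom(1) by simp
  also have "\<dots> \<le> (1 / real n) * (real n * (1 + \<kappa>))"
    using sum_bounded_above[of "{..<n}" "\<lambda>k. \<integral>w. \<bar>\<eta> (int k + 1) w\<bar> \<partial>M" "1 + \<kappa>"] mom(2)
    by (intro mult_left_mono) auto
  also have "\<dots> \<le> 1 + \<kappa>" using noise.variance_nonneg by (cases "n = 0") auto
  finally show "(\<integral>w. norm (abs_noise_average n w) \<partial>M) \<le> 1 + \<kappa>" .
qed

lemma info_average_in_probability:
  assumes "e > 0"
  shows "(\<lambda>n. \<P>(w in M. norm (info_average n w - \<Gamma>) > e)) \<longlonglongrightarrow> 0"
proof (rule AE_tendsto_zero_imp_in_probability[OF _ _ assms])
  show "AE w in M. (\<lambda>n. info_average n w - \<Gamma>) \<longlonglongrightarrow> 0"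
    using info_average_tendsto by eventually_elim (rule LIM_zero)
qed measurable

theorem score_char_tendsto:
  "(\<lambda>n. \<integral>w. iexp (a \<bullet> score n w) \<partial>M) \<longlonglongrightarrow> of_real (exp (- (\<kappa> * (a \<bullet> (\<Gamma> *v a))) / 2))"
proof -
  have "(\<lambda>n. \<integral>w. iexp ((\<Sum>k<n. (a \<bullet> r (int k + 1) w) * \<eta> (int k + 1) w) / sqrt (real n)) \<partial>M)
      \<longlonglongrightarrow> of_real (exp (- (\<kappa> * (a \<bullet> (\<Gamma> *v a))) / 2))"
  proof (rule noise.clt_char)
    show "(\<lambda>w. a \<bullet> r (int k + 1) w) \<in> borel_measurable (past (int k + 1))" for k
      by (intro borel_measurable_inner borel_measurable_const r_past)
    show "\<bar>a \<bullet> r (int k + 1) w\<bar> \<le> norm a * C" for k w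
      by (rule order_trans[OF Cauchy_Schwarz_ineq2]) (intro mult_left_mono r_bound norm_ge_zero)
    show "AE w in M. (\<lambda>n. (\<Sum>k<n. (a \<bullet> r (int k + 1) w)\<^sup>2) / real n) \<longlonglongrightarrow> a \<bullet> (\<Gamma> *v a)"
      using info_average_tendsto
    proof eventually_elim
      case (elim w)
      have "a \<bullet> (info_average n w *v a) = (\<Sum>k<n. (a \<bullet> r (int k + 1) w)\<^sup>2) / real n" for n
        by (simp add: info_average_def scaleR_matrix_vector_assoc[symmetric] matrix_vector_mult_sum_left
            inner_sum_right quadratic_form_outer)
      then show ?case
        using bounded_linear.tendsto[OF bounded_linear_quadratic_form[of a a] elim] by simp
    qed
  qed
  moreover have "(\<Sum>k<n. (a \<bullet> r (int k + 1) w) * \<eta> (int k + 1) w) / sqrt (real n) = a \<bullet> score n w" for n w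
    by (simp add: score_def inner_sum_right mult.commute)
  ultimately show ?thesis by simp
qed

abbreviation ls :: "nat \<Rightarrow> 'a \<Rightarrow> real^('p option)" where "ls \<equiv> ls_estimator X"
abbreviation ls_error :: "nat \<Rightarrow> 'a \<Rightarrow> real^('p option)" where
  "ls_error n w \<equiv> sqrt (real n) *\<^sub>R (ls n w - \<theta>\<^sub>0)"
abbreviation ef_error :: "nat \<Rightarrow> 'a \<Rightarrow> real^('p option)" where
  "ef_error n w \<equiv> sqrt (real n) *\<^sub>R (ef_estimator X n w - \<theta>\<^sub>0)"

lemma regressor_eq: "Y t w = s t w *\<^sub>R r t w"
  using s_pos[of t w] by (simp add: r_def)

lemma sigma2_eq: "sigma2 X \<theta> t w = s t w * (1 + (\<theta> - \<theta>\<^sub>0) \<bullet> r t w)"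
proof -
  have "sigma2 X \<theta> t w = s t w * (\<theta> \<bullet> r t w)" by (simp add: sigma2_def[of X \<theta>] regressor_eq)
  then show ?thesis by (simp add: inner_diff_left r_unit)
qed

text \<open>
  On this event all inverses exist as well: the weights
  stay away from zero and infinity, and the least squares matrix \<open>\<Sum> s\<^sub>t\<^sup>2 r\<^sub>t r\<^sub>t\<^sup>T\<close> dominates \<open>\<omega>\<^sub>0\<^sup>2 \<Sum> r\<^sub>t r\<^sub>t\<^sup>T\<close>.
\<close>
lemma good_sample:
  assumes n: "n > 0" and c: "c > 0" "\<And>x. x \<bullet> (\<Gamma> *v x) \<ge> c * (norm x)\<^sup>2"
    and K: "norm (ls_error n w) \<le> K" "norm (score n w) \<le> K" "abs_noise_average n w \<le> K"
    and d: "norm (info_average n w - \<Gamma>) \<le> d" "norm (noise_average n w) \<le> d"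
    and small: "K * C / sqrt (real n) \<le> 1 / 2"
      "d + 10 * K * C ^ 3 / sqrt (real n) \<le> \<tau>" "\<tau> \<le> c / 2"
      "2 * d * K + 16 * C ^ 3 * K ^ 3 / sqrt (real n) \<le> \<rho>"
  shows "ef_well_defined TYPE('p) X n w"
    and "norm (\<Gamma> *v ef_error n w - score n w) \<le> \<rho> + \<tau> * (2 / c) * (K + \<rho>)"
proof -
  interpret weighted_regression n "\<lambda>k. r (int k + 1) w" "\<lambda>k. \<eta> (int k + 1) w" \<theta>\<^sub>0 C
    by unfold_locales (use n r_bound r_unit in auto)
  have A0: "A0 = info_average n w" and W0: "W0 = score n w" and N0: "N0 = noise_average n w"
    and E0: "E0 = abs_noise_average n w"
    by (simp_all add: A0_def W0_def N0_def E0_def info_average_def score_def noise_average_def abs_noise_average_def)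
  note close = weighted_estimator_close[OF K(1) small(1) c, unfolded A0 W0 N0 E0, OF d K(2,3) small(2-4)]
  have K0: "K \<ge> 0" using K(1) norm_ge_zero order_trans by blast
  have half: "\<bar>(ls n w - \<theta>\<^sub>0) \<bullet> r (int k + 1) w\<bar> \<le> 1 / 2" for k
    by (rule deviation_le_half[OF K(1) small(1)])
  have wt_eq: "weighted_outer X (ls n w) (int k + 1) w
      = wt (ls n w) k *\<^sub>R rr (int k + 1) w" for k
    unfolding weighted_outer_def sigma2_eq[of "ls n w"] regressor_eq outer_product_scaleR
    using s_pos[of "int k + 1" w] by (simp add: wt_def power_mult_distrib power2_eq_square)
  have ef_matrix: "ef_matrix X n w = (\<Sum>k<n. wt (ls n w) k *\<^sub>R rr (int k + 1) w)"
    by (simp add: ef_matrix_def sum_int_shift wt_eq)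
  have ef_term: "((X t w)\<^sup>2 / (sigma2 X (ls n w) t w)\<^sup>2) *\<^sub>R Y t w
      = (1 / (1 + (ls n w - \<theta>\<^sub>0) \<bullet> r t w)\<^sup>2 * (1 + \<eta> t w)) *\<^sub>R r t w" for t
    unfolding sigma2_eq[of "ls n w"] regressor_eq
    using s_pos[of t w] by (simp add: \<eta>_def power_mult_distrib power2_eq_square)
  have ef_vector: "ef_vector X n w = (\<Sum>k<n. (wt (ls n w) k * (1 + \<eta> (int k + 1) w)) *\<^sub>R r (int k + 1) w)"
    unfolding ef_vector_def ef_term sum_int_shift wt_def ..
  have inv: "invertible (ef_matrix X n w :: real^('p option)^('p option))"
    unfolding ef_matrix by (rule close(1))
  have "ef_matrix X n w *v ef_estimator X n w = (ef_vector X n w :: real^('p option))"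
    unfolding ef_estimator_def matrix_vector_mul_assoc matrix_inv_inverse(1)[OF inv] by simp
  then show "norm (\<Gamma> *v ef_error n w - score n w) \<le> \<rho> + \<tau> * (2 / c) * (K + \<rho>)"
    using close(2)[of "ef_estimator X n w"] by (simp add: ef_matrix ef_vector)
  have "invertible (ls_matrix X n w :: real^('p option)^('p option))"
  proof (rule positive_definite_invertible)
    fix x :: "real^('p option)" assume x: "x \<noteq> 0"
    have "d \<le> c / 2"
      using small(2,3) K0 C_pos n by (smt (verit) divide_nonneg_pos mult_nonneg_nonneg of_nat_0_less_iff real_sqrt_gt_zero zero_le_power)
    then have "0 < (c - d) * (norm x)\<^sup>2" using c x by (intro mult_pos_pos) auto
    also have "\<dots> \<le> x \<bullet> (info_average n w *v x)"
      by (rule coercive_perturbation[OF c(2) d(1)])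
    also have "\<dots> = (1 / real n) * (\<Sum>k<n. (x \<bullet> r (int k + 1) w)\<^sup>2)"
      by (simp add: info_average_def scaleR_matrix_vector_assoc[symmetric] matrix_vector_mult_sum_left
            inner_sum_right quadratic_form_outer)
    finally have pos: "0 < (\<Sum>k<n. (x \<bullet> r (int k + 1) w)\<^sup>2)" using n by (simp add: zero_less_divide_iff)
    have "0 < (\<theta>\<^sub>0 $ None)\<^sup>2 * (\<Sum>k<n. (x \<bullet> r (int k + 1) w)\<^sup>2)" using pos omega_pos by simp
    also have "\<dots> \<le> (\<Sum>k<n. (s (int k + 1) w)\<^sup>2 * (x \<bullet> r (int k + 1) w)\<^sup>2)"
      unfolding sum_distrib_left
      using s_ge omega_pos by (intro sum_mono mult_right_mono power_mono) auto
    also have "\<dots> = x \<bullet> (ls_matrix X n w *v x)"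
      unfolding ls_matrix_def sum_int_shift regressor_eq outer_product_scaleR
      by (simp add: scaleR_matrix_vector_assoc[symmetric] matrix_vector_mult_sum_left
            inner_sum_right quadratic_form_outer power2_eq_square)
    finally show "0 < x \<bullet> (ls_matrix X n w *v x)" .
  qed
  moreover have "sigma2 X (ls n w) t w \<noteq> 0" if "t \<in> {1..int n}" for t
  proof -
    have "t = int (nat (t - 1)) + 1" using that by simp
    then have "\<bar>(ls n w - \<theta>\<^sub>0) \<bullet> r t w\<bar> \<le> 1 / 2" using half[of "nat (t - 1)"] by simp
    then have "1 + (ls n w - \<theta>\<^sub>0) \<bullet> r t w \<noteq> 0" by linarith
    then show ?thesis unfolding sigma2_eq[of "ls n w"] using s_pos[of t w] by simp
  qed
  ultimately show "ef_well_defined TYPE('p) X n w"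
    unfolding ef_well_defined_def using inv by blast
qed

lemma estimators_measurable [measurable]:
  "ls n \<in> borel_measurable M" "ef_estimator X n \<in> (borel_measurable M :: ('a \<Rightarrow> real^('p option)) set)"
  "{w\<in>space M. ef_well_defined TYPE('p) X n w} \<in> sets M"
proof -
  have lsm: "(ls_matrix X n :: 'a \<Rightarrow> real^('p option)^('p option)) \<in> borel_measurable M"
    unfolding ls_matrix_def[abs_def] by (intro borel_measurable_sum borel_measurable_outer_product) measurable
  have lsv: "(ls_vector X n :: 'a \<Rightarrow> real^('p option)) \<in> borel_measurable M"
    unfolding ls_vector_def[abs_def] by measurable
  show ls [measurable]: "ls n \<in> borel_measurable M"
    unfolding ls_estimator_def[abs_def] by (rule borel_measurable_matrix_inv_mult[OF lsm lsv])
  have sig [measurable]: "(\<lambda>w. sigma2 X (ls n w) t w) \<in> borel_measurable M" for t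
    unfolding sigma2_def by measurable
  have efm: "(ef_matrix X n :: 'a \<Rightarrow> real^('p option)^('p option)) \<in> borel_measurable M"
    unfolding ef_matrix_def[abs_def] weighted_outer_def
    by (intro borel_measurable_sum borel_measurable_scaleR borel_measurable_outer_product) measurable
  have efv: "(ef_vector X n :: 'a \<Rightarrow> real^('p option)) \<in> borel_measurable M"
    unfolding ef_vector_def[abs_def] by measurable
  show "ef_estimator X n \<in> (borel_measurable M :: ('a \<Rightarrow> real^('p option)) set)"
    unfolding ef_estimator_def[abs_def] by (rule borel_measurable_matrix_inv_mult[OF efm efv])
  note [measurable] = borel_measurable_det[OF lsm] borel_measurable_det[OF efm]
  show "{w\<in>space M. ef_well_defined TYPE('p) X n w} \<in> sets M"
    unfolding ef_well_defined_def invertible_det_nz by measurable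
qed

text \<open>
  Choose \<open>K\<close> first, to make large values of the three stochastically bounded quantities improbable, then the tolerance
  \<open>d\<close> for the two averages that converge; for large \<open>n\<close> the terms with \<open>\<surd>n\<close> in the denominator are small as well.
\<close>
theorem linearization_in_probability:
  assumes ls: "bounded_in_probability M ls_error" and e: "e > 0"
  shows "(\<lambda>n. \<P>(w in M. \<not> (ef_well_defined TYPE('p) X n w \<and> norm (\<Gamma> *v ef_error n w - score n w) \<le> e))) \<longlonglongrightarrow> 0"
    (is "(\<lambda>n. prob (?A n)) \<longlonglongrightarrow> 0")
proof (rule tendstoI)
  fix \<delta> :: real assume \<delta>: "\<delta> > 0"
  obtain c where c: "c > 0" "\<And>x. x \<bullet> (\<Gamma> *v x) \<ge> c * (norm x)\<^sup>2"
    using positive_definite_coercive[OF Gamma_positive_definite] by blast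
  have five: "\<delta> / 5 > 0" using \<delta> by simp
  obtain K1 where K1: "\<forall>\<^sub>F n in sequentially. \<P>(w in M. norm (ls_error n w) > K1) < \<delta> / 5"
    using ls[unfolded bounded_in_probability_def, rule_format, OF five] by blast
  obtain K2 where K2: "\<forall>\<^sub>F n in sequentially. \<P>(w in M. norm (score n w) > K2) < \<delta> / 5"
    using score_bounded_in_probability[unfolded bounded_in_probability_def, rule_format, OF five] by blast
  obtain K3 where K3: "\<forall>\<^sub>F n in sequentially. \<P>(w in M. norm (abs_noise_average n w) > K3) < \<delta> / 5"
    using abs_noise_average_bounded_in_probability[unfolded bounded_in_probability_def, rule_format, OF five] by blast
  define K where "K = max 1 (max K1 (max K2 K3))"
  have K: "K \<ge> 1" "K1 \<le> K" "K2 \<le> K" "K3 \<le> K" by (auto simp: K_def)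
  \<comment> \<open>\<open>\<rho>\<close> bounds the error of the score and \<open>\<tau>\<close> that of the matrix; each contributes at most \<open>e / 2\<close>.\<close>
  define \<rho> where "\<rho> = min 1 (e / 2)"
  define \<tau> where "\<tau> = min (c / 2) (e * c / (4 * (K + 1)))"
  define d where "d = min (\<rho> / (4 * K)) (\<tau> / 2)"
  have \<rho>: "\<rho> > 0" "\<rho> \<le> 1" "\<rho> \<le> e / 2" using e by (auto simp: \<rho>_def)
  have \<tau>: "\<tau> > 0" "\<tau> \<le> c / 2" "\<tau> \<le> e * c / (4 * (K + 1))"     unfolding \<tau>_def by (use e c K in \<open>simp add: add_pos_pos\<close>) (rule min.cobounded1, rule min.cobounded2)
  have d: "d > 0" "2 * d * K \<le> \<rho> / 2" "d \<le> \<tau> / 2"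
  proof -
    show "d > 0" using \<rho> \<tau> K by (simp add: d_def)
    have "d \<le> \<rho> / (4 * K)" by (simp add: d_def)
    then show "2 * d * K \<le> \<rho> / 2" using K by (simp add: field_simps)
  qed (simp add: d_def)
  have bound: "\<rho> + \<tau> * (2 / c) * (K + \<rho>) \<le> e"
  proof -
    have "\<tau> * (2 / c) * (K + \<rho>) \<le> (e * c / (4 * (K + 1))) * (2 / c) * (K + 1)"
      using \<rho> \<tau> c K by (intro mult_mono mult_right_mono) auto
    also have "\<dots> = e / 2" using c K by (simp add: field_simps)
    finally show ?thesis using \<rho> by linarith
  qed
  have over_sqrt: "(\<lambda>n. b / sqrt (real n)) \<longlonglongrightarrow> 0" for b
    by (intro real_tendsto_divide_at_top[OF tendsto_const] filterlim_compose[OF sqrt_at_top filterlim_real_sequentially])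
  have small: "\<forall>\<^sub>F n in sequentially. K * C / sqrt (real n) < 1 / 2"
    "\<forall>\<^sub>F n in sequentially. 10 * K * C ^ 3 / sqrt (real n) < \<tau> / 2"
    "\<forall>\<^sub>F n in sequentially. 16 * C ^ 3 * K ^ 3 / sqrt (real n) < \<rho> / 2"
    using \<rho> \<tau> by (auto intro!: order_tendstoD(2)[OF over_sqrt])
  have info: "\<forall>\<^sub>F n in sequentially. \<P>(w in M. norm (info_average n w - \<Gamma>) > d) < \<delta> / 5"
    and noise: "\<forall>\<^sub>F n in sequentially. \<P>(w in M. norm (noise_average n w) > d) < \<delta> / 5"
    using order_tendstoD(2)[OF info_average_in_probability[OF d(1)] five]
      order_tendstoD(2)[OF noise_average_tendsto[OF d(1)] five] by auto
  from K1 K2 K3 small info noise eventually_gt_at_top[of 0]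
  show "\<forall>\<^sub>F n in sequentially. dist (prob (?A n)) 0 < \<delta>"
  proof eventually_elim
    case (elim n)
    let ?B1 = "{w\<in>space M. norm (ls_error n w) > K1}"
    let ?B2 = "{w\<in>space M. norm (score n w) > K2}"
    let ?B3 = "{w\<in>space M. norm (abs_noise_average n w) > K3}"
    let ?B4 = "{w\<in>space M. norm (info_average n w - \<Gamma>) > d}"
    let ?B5 = "{w\<in>space M. norm (noise_average n w) > d}"
    have sets: "?B1 \<in> sets M" "?B2 \<in> sets M" "?B3 \<in> sets M" "?B4 \<in> sets M" "?B5 \<in> sets M" by measurable
    have "?A n \<subseteq> ?B1 \<union> (?B2 \<union> (?B3 \<union> (?B4 \<union> ?B5)))"
    proof (rule subsetI, rule ccontr)
      fix w assume w: "w \<in> ?A n" "w \<notin> ?B1 \<union> (?B2 \<union> (?B3 \<union> (?B4 \<union> ?B5)))"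
      then have wM: "w \<in> space M" by simp
      have "norm (ls_error n w) \<le> K" "norm (score n w) \<le> K" "norm (abs_noise_average n w) \<le> K"
        using w(2) wM K by (auto simp: not_less)
      moreover have "norm (info_average n w - \<Gamma>) \<le> d" "norm (noise_average n w) \<le> d"
        using w(2) wM by (auto simp: not_less)
      moreover have "abs_noise_average n w \<le> K" using calculation(3) by simp
      ultimately have "ef_well_defined TYPE('p) X n w"
        "norm (\<Gamma> *v ef_error n w - score n w) \<le> \<rho> + \<tau> * (2 / c) * (K + \<rho>)"
        using good_sample[OF \<open>0 < n\<close> c, of w K d \<tau> \<rho>] elim d \<tau> by auto
      then show False using w(1) bound by auto
    qed
    then have "prob (?A n) \<le> prob (?B1 \<union> (?B2 \<union> (?B3 \<union> (?B4 \<union> ?B5))))"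
      using sets by (intro finite_measure_mono) auto
    also have "\<dots> \<le> prob ?B1 + (prob ?B2 + (prob ?B3 + (prob ?B4 + prob ?B5)))"
      using sets by (intro order_trans[OF measure_Un_le] add_left_mono) auto
    finally show ?case using elim by simp
  qed
qed

text \<open>The properties of \<open>\<Gamma>\<close> needed to recognize \<open>\<kappa> \<Gamma>\<^sup>-\<^sup>1\<close> as a covariance matrix pass to the inverse.\<close>
lemma covariance_factor:
  defines "V \<equiv> matrix_inv \<Gamma>"
  shows "\<Gamma> ** V = mat 1" "V ** \<Gamma> = mat 1" "transpose V = V" "x \<noteq> 0 \<Longrightarrow> x \<bullet> (V *v x) > 0"
proof -
  have inv: "invertible \<Gamma>" by (rule positive_definite_invertible[OF Gamma_positive_definite])
  show 1: "\<Gamma> ** V = mat 1" and 2: "V ** \<Gamma> = mat 1" unfolding V_def by (rule matrix_inv_inverse[OF inv])+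
  have "\<Gamma> ** transpose V = transpose (V ** \<Gamma>)" by (simp add: matrix_transpose_mul transpose_Gamma)
  then have "\<Gamma> ** transpose V = mat 1" by (simp add: 2)
  then show "transpose V = V" unfolding V_def by (metis matrix_inv_eq)
  show "x \<bullet> (V *v x) > 0" if x: "x \<noteq> 0"
  proof -
    have eq: "x = \<Gamma> *v (V *v x)" by (simp add: matrix_vector_mul_assoc 1)
    then have "V *v x \<noteq> 0" using x by auto
    then have "0 < (V *v x) \<bullet> (\<Gamma> *v (V *v x))" by (rule Gamma_positive_definite)
    then show ?thesis using eq by (simp add: inner_commute)
  qed
qed

text \<open>
  By linearization the estimation error is close to \<open>\<Gamma>\<^sup>-\<^sup>1\<close> times the score. The characteristic function of the latter
  at \<open>a\<close> is that of the score at \<open>\<Gamma>\<^sup>-\<^sup>1 a\<close>, and \<open>\<kappa> (\<Gamma>\<^sup>-\<^sup>1 a) \<bullet> \<Gamma> (\<Gamma>\<^sup>-\<^sup>1 a) = a \<bullet> \<kappa> \<Gamma>\<^sup>-\<^sup>1 a\<close>.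
\<close>
theorem ef_estimator_asymptotics:
  assumes ls: "bounded_in_probability M ls_error"
  shows "(\<lambda>n. \<P>(w in M. ef_well_defined TYPE('p) X n w)) \<longlonglongrightarrow> 1"
      (is "(\<lambda>n. prob (?W n)) \<longlonglongrightarrow> 1")
    and "invertible \<Gamma>"
    and "converges_in_distribution M ef_error (multivariate_normal 0 (\<kappa> *\<^sub>R matrix_inv \<Gamma>))"
proof -
  note lin = linearization_in_probability[OF ls]
  let ?bad = "\<lambda>e n. {w\<in>space M. \<not> (ef_well_defined TYPE('p) X n w \<and> norm (\<Gamma> *v ef_error n w - score n w) \<le> e)}"
  have [measurable]: "(\<lambda>w. \<Gamma> *v ef_error n w - score n w) \<in> borel_measurable M" for n
    by (intro borel_measurable_diff borel_measurable_matrix_vector_mult) measurable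
  have bad [measurable]: "?bad e n \<in> sets M" for e n
  proof -
    have "?bad e n = space M - (?W n \<inter>
        {w\<in>space M. norm (\<Gamma> *v ef_error n w - score n w) \<le> e})" by auto
    also have "\<dots> \<in> sets M" by measurable
    finally show ?thesis .
  qed
  show "invertible \<Gamma>" by (rule positive_definite_invertible[OF Gamma_positive_definite])
  show "(\<lambda>n. prob (?W n)) \<longlonglongrightarrow> 1"
  proof (rule tendsto_sandwich[OF _ _ _ tendsto_const])
    have "(\<lambda>n. 1 - prob (?bad 1 n)) \<longlonglongrightarrow> 1 - 0" by (intro tendsto_intros lin) simp
    then show "(\<lambda>n. 1 - prob (?bad 1 n)) \<longlonglongrightarrow> 1" by simp
    have "1 - prob (?bad 1 n) \<le> prob (?W n)" for n
    proof -
      have "1 - prob (?bad 1 n) = prob (space M - ?bad 1 n)" using bad by (simp only: prob_compl)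
      also have "\<dots> \<le> prob (?W n)"
        by (intro finite_measure_mono) auto
      finally show ?thesis .
    qed
    then show "\<forall>\<^sub>F n in sequentially. 1 - prob (?bad 1 n) \<le> prob (?W n)"
      by simp
  qed simp
  let ?V = "matrix_inv \<Gamma>"
  let ?L = "\<lambda>n w. ?V *v score n w"
  note V = covariance_factor
  obtain c where c: "c > 0" "\<And>x. x \<bullet> (\<Gamma> *v x) \<ge> c * (norm x)\<^sup>2"
    using positive_definite_coercive[OF Gamma_positive_definite] by blast
  have Lm [measurable]: "?L n \<in> borel_measurable M" for n
    by (intro borel_measurable_matrix_vector_mult) measurable
  have diff: "(\<lambda>n. \<P>(w in M. norm (ef_error n w - ?L n w) > e)) \<longlonglongrightarrow> 0" if e: "e > 0" for e
  proof (rule tendsto_sandwich[OF _ _ tendsto_const lin])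
    show "c * e > 0" using c e by simp
    have "{w\<in>space M. norm (ef_error n w - ?L n w) > e} \<subseteq> ?bad (c * e) n" for n
    proof
      fix w assume w: "w \<in> {w\<in>space M. norm (ef_error n w - ?L n w) > e}"
      have "c * e < c * norm (ef_error n w - ?L n w)" using w c by simp
      also have "\<dots> \<le> norm (\<Gamma> *v (ef_error n w - ?L n w))" by (rule coercive_norm_le[OF c(2)])
      also have "\<Gamma> *v (ef_error n w - ?L n w) = \<Gamma> *v ef_error n w - score n w"
        by (simp only: matrix_vector_mult_diff_distrib) (simp add: matrix_vector_mul_assoc V(1))
      finally show "w \<in> ?bad (c * e) n" using w by auto
    qed
    then show "\<forall>\<^sub>F n in sequentially. \<P>(w in M. norm (ef_error n w - ?L n w) > e) \<le> prob (?bad (c * e) n)"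
      by (intro always_eventually allI finite_measure_mono bad)
  qed simp
  have L_bounded: "bounded_in_probability M ?L"
    unfolding bounded_in_probability_def
  proof (intro allI impI)
    fix e :: real assume "e > 0"
    then obtain K where K: "\<forall>\<^sub>F n in sequentially. \<P>(w in M. norm (score n w) > K) < e"
      using score_bounded_in_probability unfolding bounded_in_probability_def by blast
    have "{w\<in>space M. norm (?L n w) > norm ?V * K} \<subseteq> {w\<in>space M. norm (score n w) > K}" for n
    proof
      fix w assume w: "w \<in> {w\<in>space M. norm (?L n w) > norm ?V * K}"
      then have "norm ?V * K < norm ?V * norm (score n w)"
        using norm_matrix_vector_mult_le[of ?V "score n w"] by auto
      then have "K < norm (score n w)" by (rule mult_left_less_imp_less) simp
      then show "w \<in> {w\<in>space M. norm (score n w) > K}" using w by simp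
    qed
    then have le: "\<P>(w in M. norm (?L n w) > norm ?V * K) \<le> \<P>(w in M. norm (score n w) > K)" for n
      by (intro finite_measure_mono) measurable
    have "\<forall>\<^sub>F n in sequentially. \<P>(w in M. norm (?L n w) > norm ?V * K) < e"
      using K by eventually_elim (rule le_less_trans[OF le])
    then show "\<exists>K. \<forall>\<^sub>F n in sequentially. \<P>(w in M. norm (?L n w) > K) < e" by blast
  qed
  let ?S = "\<kappa> *\<^sub>R ?V"
  have S_sym: "transpose ?S = ?S" using V(3) by (simp add: transpose_scalar)
  have S_pos: "x \<bullet> (?S *v x) > 0" if "x \<noteq> 0" for x
    using V(4)[OF that] kappa_pos by (simp add: scaleR_matrix_vector_assoc[symmetric])
  show "converges_in_distribution M ef_error (multivariate_normal 0 ?S)"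
  proof (rule levy_cramer_continuity)
    show "ef_error n \<in> borel_measurable M" for n by measurable
    show "prob_space (multivariate_normal 0 ?S)" by (rule prob_space_multivariate_normal[OF S_sym S_pos])
    show "sets (multivariate_normal 0 ?S) = sets borel" by (simp add: multivariate_normal_def)
    show "bounded_in_probability M ef_error"
      by (rule bounded_in_probability_perturb[OF _ _ L_bounded diff]) measurable
    show "(\<lambda>n. \<integral>w. iexp (a \<bullet> ef_error n w) \<partial>M) \<longlonglongrightarrow> (\<integral>x. iexp (a \<bullet> x) \<partial>multivariate_normal 0 ?S)" for a
    proof (rule slutsky_char[OF _ _ diff])
      have swap: "a \<bullet> ?L n w = (?V *v a) \<bullet> score n w" for n w
        using symmetric_matrix_inner[OF V(3)] .
      have "(?V *v a) \<bullet> (\<Gamma> *v (?V *v a)) = (?V *v a) \<bullet> a"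
        by (simp add: matrix_vector_mul_assoc V(1))
      then have "\<kappa> * ((?V *v a) \<bullet> (\<Gamma> *v (?V *v a))) = a \<bullet> (?S *v a)"
        by (simp add: scaleR_matrix_vector_assoc[symmetric] inner_commute)
      moreover have "(\<integral>x. iexp (a \<bullet> x) \<partial>multivariate_normal 0 ?S) = of_real (exp (- (a \<bullet> (?S *v a)) / 2))"
        by (rule char_multivariate_normal[OF S_sym S_pos])
      ultimately show "(\<lambda>n. \<integral>w. iexp (a \<bullet> ?L n w) \<partial>M) \<longlonglongrightarrow> (\<integral>x. iexp (a \<bullet> x) \<partial>multivariate_normal 0 ?S)"
        unfolding swap using score_char_tendsto[of "?V *v a"] by (simp only:)
    qed measurable
  qed
qed

end

theorem theorem1:
  fixes M :: "'a measure" and X \<epsilon> :: "int \<Rightarrow> 'a \<Rightarrow> real"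
    and \<theta>\<^sub>0 :: "real^('p::{finite, linorder} option)" and \<Theta> :: "(real^('p option)) set"
  assumes "arch_process M X \<epsilon> \<theta>\<^sub>0"
    and "compact \<Theta>" and "\<Theta> \<subseteq> arch_parameters" and "\<theta>\<^sub>0 \<in> interior \<Theta>"
    and "top_lyapunov_exponent M (\<lambda>t w. arch_matrix \<theta>\<^sub>0 (\<epsilon> t w)) < 0"
    and "\<forall>t. \<not> (\<exists>c. AE w in M. (\<epsilon> t w)\<^sup>2 = c)"
    and "\<forall>t. prob_space.expectation M (\<lambda>w. (\<epsilon> t w)\<^sup>2) = 1"
    and "\<forall>t. integrable M (\<lambda>w. \<epsilon> t w ^ 4)"
    and "\<forall>t. integrable M (weighted_outer X \<theta>\<^sub>0 t)"
    and "bounded_in_probability M (\<lambda>n w. sqrt (real n) *\<^sub>R (ls_estimator X n w - \<theta>\<^sub>0))"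
  shows "(\<lambda>n. measure M {w \<in> space M. ef_well_defined TYPE('p) X n w}) \<longlonglongrightarrow> 1 \<and>
    invertible (arch_Gamma M X \<theta>\<^sub>0) \<and>
    converges_in_distribution M (\<lambda>n w. sqrt (real n) *\<^sub>R (ef_estimator X n w - \<theta>\<^sub>0))
      (multivariate_normal 0
        (prob_space.variance M (\<lambda>w. (\<epsilon> 0 w)\<^sup>2) *\<^sub>R matrix_inv (arch_Gamma M X \<theta>\<^sub>0)))"
proof -
  interpret arch_process M X \<epsilon> \<theta>\<^sub>0 by fact
  have alpha_pos: "\<theta>\<^sub>0 $ Some j > 0" for j
  proof -
    obtain e where e: "e > 0" "ball \<theta>\<^sub>0 e \<subseteq> \<Theta>" using assms(4) unfolding mem_interior by auto
    have "\<theta>\<^sub>0 - (e / 2) *\<^sub>R axis (Some j) 1 \<in> ball \<theta>\<^sub>0 e" using e by (simp add: dist_norm)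
    then have "\<theta>\<^sub>0 - (e / 2) *\<^sub>R axis (Some j) 1 \<in> arch_parameters" using e assms(3) by blast
    then have "(\<theta>\<^sub>0 - (e / 2) *\<^sub>R axis (Some j) 1) $ Some j \<ge> 0" unfolding arch_parameters_def by blast
    then show ?thesis using e by simp
  qed
  interpret arch_interior M X \<epsilon> \<theta>\<^sub>0
    by unfold_locales (use alpha_pos assms(6,8) in auto)
  show ?thesis
    using ef_estimator_asymptotics[OF assms(10)] unfolding \<kappa>_def by blast
qed

end
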